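(* Let $|V(x)|\lesssim(1+|x|)^{-\beta}$ on $\mathbb{R}^3$ and $H=\Delta^2+V$. (i) If $\beta>11$, then $f\in S_1L^2\setminus\{0\}$ if and only if $f=Uv\phi$ for some $\phi\in W_{3/2}$ with $H\phi=0$ in the distributional sense and $\phi=-G_0vf+c_0$, where $c_0=\|V\|_{L^1}^{-1}\langle v,Tf\rangle$. (ii) If $\beta>19$, then $f\in S_2L^2\setminus\{0\}$ if and only if $f=Uv\phi$ for some $\phi\in W_{1/2}$ with $H\phi=0$ in the distributional sense and $\phi=-G_0vf$. (iii) If $\beta>23$, then $f\in S_3L^2\setminus\{0\}$ if and only if $f=Uv\phi$ for some $\phi\in L^2$ with $H\phi=0$ in the distributional sense and $\phi=-G_0vf$.
   Context: $U=\operatorname{sign}V$ ($U=1$ where $V=0$), $v=|V|^{1/2}$. $W_\sigma(\mathbb{R}^3)=\bigcap_{s>\sigma}L^2_{-s}(\mathbb{R}^3)$ where $L^2_{-s}=\{f:\langle x\rangle^{-s}f\in L^2\}$, $\langle x\rangle=(1+|x|^2)^{1/2}$. $G_0,G_1,G_3$ are integral operators with kernels $-\frac{|x-y|}{8\pi}$, $|x-y|^2$, $|x-y|^4$. $T=U+vG_0v$, $P=\|V\|_{L^1}^{-1}v\langle v,\cdot\rangle$, $Q=I-P$. $S_1$ is the Riesz projection onto the kernel of $QTQ$ on $QL^2$; $T_1=S_1TPTS_1-\frac{\|V\|_{L^1}}{3(8\pi)^2}S_1vG_1vS_1$ on $S_1L^2$; $S_2$ is the Riesz projection onto $\ker T_1$,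 $D_1=(T_1+S_2)^{-1}$ on $S_1L^2$; $T_2=S_2vG_3vS_2+\frac{10}{3\|V\|_{L^1}}S_2(vG_1v)^2S_2-\frac{10}{3\|V\|_{L^1}}S_2vG_1vTD_1TvG_1vS_2$ on $S_2L^2$; $S_3$ is the Riesz projection onto $\ker T_2$.
   Formalization: The equivalences are stated for nonzero f in L^2 (at f=0 the right side holds with φ=0 while 0 is excluded on the left), and V is assumed not almost everywhere zero, since otherwise P is undefined; S_1 and S_2 are taken as orthogonal projections onto the kernels. *)

theory Defs
  imports "HOL-Analysis.Analysis"
begin

type_synonym fn = "real^3 \<Rightarrow> complex"

definition sq_int :: "fn \<Rightarrow> bool" where
  "sq_int f \<longleftrightarrow> f \<in> borel_measurable lborel \<and> integrable lborel (\<lambda>x. (cmod (f x))^2)"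

definition aeq :: "fn \<Rightarrow> fn \<Rightarrow> bool" where
  "aeq f g \<longleftrightarrow> (AE x in lborel. f x = g x)"

definition L2_inner :: "fn \<Rightarrow> fn \<Rightarrow> complex" where
  "L2_inner f g = (LINT x|lborel. cnj (f x) * g x)"

definition wL2 :: "real \<Rightarrow> fn \<Rightarrow> bool" where
  "wL2 s f \<longleftrightarrow> sq_int (\<lambda>x. complex_of_real ((1 + (norm x)^2) powr (- s / 2)) * f x)"

definition Wsp :: "real \<Rightarrow> fn set" where
  "Wsp \<sigma> = {f. \<forall>s>\<sigma>. wL2 s f}"

definition sgnU :: "(real^3 \<Rightarrow> real) \<Rightarrow> real^3 \<Rightarrow> real" where
  "sgnU V x = (if V x < 0 then -1 else 1)"

definition vfun :: "(real^3 \<Rightarrow> real) \<Rightarrow> real^3 \<Rightarrow> real" where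
  "vfun V x = sqrt \<bar>V x\<bar>"

definition L1norm :: "(real^3 \<Rightarrow> real) \<Rightarrow> real" where
  "L1norm V = (LINT x|lborel. \<bar>V x\<bar>)"

definition mult :: "(real^3 \<Rightarrow> real) \<Rightarrow> fn \<Rightarrow> fn" where
  "mult a f = (\<lambda>x. complex_of_real (a x) * f x)"

definition intop :: "(real^3 \<Rightarrow> real^3 \<Rightarrow> real) \<Rightarrow> fn \<Rightarrow> fn" where
  "intop K f = (\<lambda>x. LINT y|lborel. complex_of_real (K x y) * f y)"

definition G0k :: "real^3 \<Rightarrow> real^3 \<Rightarrow> real" where
  "G0k x y = - dist x y / (8 * pi)"

definition G1k :: "real^3 \<Rightarrow> real^3 \<Rightarrow> real" where
  "G1k x y = (dist x y)^2"

definition G3k :: "real^3 \<Rightarrow> real^3 \<Rightarrow> real" where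
  "G3k x y = (dist x y)^4"

definition vGv :: "(real^3 \<Rightarrow> real^3 \<Rightarrow> real) \<Rightarrow> (real^3 \<Rightarrow> real) \<Rightarrow> fn \<Rightarrow> fn" where
  "vGv K V f = mult (vfun V) (intop K (mult (vfun V) f))"

definition Top :: "(real^3 \<Rightarrow> real) \<Rightarrow> fn \<Rightarrow> fn" where
  "Top V f = (\<lambda>x. complex_of_real (sgnU V x) * f x + vGv G0k V f x)"

definition vpair :: "(real^3 \<Rightarrow> real) \<Rightarrow> fn \<Rightarrow> complex" where
  "vpair V f = (LINT x|lborel. complex_of_real (vfun V x) * f x)"

definition Pop :: "(real^3 \<Rightarrow> real) \<Rightarrow> fn \<Rightarrow> fn" where
  "Pop V f = (\<lambda>x. complex_of_real (vfun V x / L1norm V) * vpair V f)"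

definition Qop :: "(real^3 \<Rightarrow> real) \<Rightarrow> fn \<Rightarrow> fn" where
  "Qop V f = (\<lambda>x. f x - Pop V f x)"

definition QL2 :: "(real^3 \<Rightarrow> real) \<Rightarrow> fn set" where
  "QL2 V = {f. sq_int f \<and> aeq (Qop V f) f}"

text \<open>Orthogonal projection onto a (closed) subspace K of L^2 (representative chosen by SOME).\<close>
definition orth_proj :: "fn set \<Rightarrow> fn \<Rightarrow> fn" where
  "orth_proj K g = (SOME h. h \<in> K \<and> (\<forall>k\<in>K. L2_inner k (\<lambda>x. g x - h x) = 0))"

definition S1L2 :: "(real^3 \<Rightarrow> real) \<Rightarrow> fn set" where
  "S1L2 V = {f \<in> QL2 V. aeq (Qop V (Top V (Qop V f))) (\<lambda>_. 0)}"

definition S1 :: "(real^3 \<Rightarrow> real) \<Rightarrow> fn \<Rightarrow> fn" where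
  "S1 V = orth_proj (S1L2 V)"

definition T1 :: "(real^3 \<Rightarrow> real) \<Rightarrow> fn \<Rightarrow> fn" where
  "T1 V f = (\<lambda>x. S1 V (Top V (Pop V (Top V f))) x
      - complex_of_real (L1norm V / (3 * (8 * pi)^2)) * S1 V (vGv G1k V f) x)"

definition S2L2 :: "(real^3 \<Rightarrow> real) \<Rightarrow> fn set" where
  "S2L2 V = {f \<in> S1L2 V. aeq (T1 V f) (\<lambda>_. 0)}"

definition S2 :: "(real^3 \<Rightarrow> real) \<Rightarrow> fn \<Rightarrow> fn" where
  "S2 V = orth_proj (S2L2 V)"

text \<open>D_1 = (T_1 + S_2)^{-1} on S_1 L^2, applied to S_1 g.\<close>
definition D1 :: "(real^3 \<Rightarrow> real) \<Rightarrow> fn \<Rightarrow> fn" where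
  "D1 V g = (SOME h. h \<in> S1L2 V \<and> aeq (\<lambda>x. T1 V h x + S2 V h x) (S1 V g))"

definition T2 :: "(real^3 \<Rightarrow> real) \<Rightarrow> fn \<Rightarrow> fn" where
  "T2 V f = S2 V (\<lambda>x. vGv G3k V f x
      + complex_of_real (10 / (3 * L1norm V)) * vGv G1k V (vGv G1k V f) x
      - complex_of_real (10 / (3 * L1norm V)) * vGv G1k V (Top V (D1 V (Top V (vGv G1k V f)))) x)"

definition S3L2 :: "(real^3 \<Rightarrow> real) \<Rightarrow> fn set" where
  "S3L2 V = {f \<in> S2L2 V. aeq (T2 V f) (\<lambda>_. 0)}"

definition pd :: "3 \<Rightarrow> (real^3 \<Rightarrow> real) \<Rightarrow> real^3 \<Rightarrow> real" where
  "pd i \<psi> x = deriv (\<lambda>t. \<psi> (x + t *\<^sub>R axis i 1)) 0"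

definition iter_pd :: "3 list \<Rightarrow> (real^3 \<Rightarrow> real) \<Rightarrow> real^3 \<Rightarrow> real" where
  "iter_pd is \<psi> = foldr pd is \<psi>"

definition test_fun :: "(real^3 \<Rightarrow> real) \<Rightarrow> bool" where
  "test_fun \<psi> \<longleftrightarrow> (\<exists>K. compact K \<and> (\<forall>x. x \<notin> K \<longrightarrow> \<psi> x = 0))
     \<and> (\<forall>is. continuous_on UNIV (iter_pd is \<psi>))
     \<and> (\<forall>is i x. (\<lambda>t. iter_pd is \<psi> (x + t *\<^sub>R axis i 1)) differentiable at 0)"

definition lap :: "(real^3 \<Rightarrow> real) \<Rightarrow> real^3 \<Rightarrow> real" where
  "lap \<psi> = (\<lambda>x. \<Sum>i\<in>UNIV. pd i (pd i \<psi>) x)"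

definition dist_H_zero :: "(real^3 \<Rightarrow> real) \<Rightarrow> fn \<Rightarrow> bool" where
  "dist_H_zero V \<phi> \<longleftrightarrow> (\<forall>\<psi>. test_fun \<psi> \<longrightarrow>
      (LINT x|lborel. \<phi> x * complex_of_real (lap (lap \<psi>) x))
      + (LINT x|lborel. complex_of_real (V x * \<psi> x) * \<phi> x) = 0)"

end

theory Submission
  imports Defs "HOL-Real_Asymp.Real_Asymp"
begin

text \<open>
  If \<open>f = U v \<phi>\<close>, the equation \<open>\<phi> = - G\<^sub>0 v f + c\<close> says exactly that \<open>T f = c v\<close>, and such a \<open>\<phi>\<close>
  solves \<open>H \<phi> = 0\<close> because \<open>- \<bar>x\<bar> / (8 \<pi>)\<close> is a fundamental solution of the bilaplacian. The
  weighted spaces measure how many moments of \<open>v f\<close> vanish: the expansion of \<open>\<bar>x - y\<bar>\<close> for large \<open>x\<close>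
  has the terms \<open>\<bar>x\<bar>\<close>, \<open>- x \<bullet> y / \<bar>x\<bar>\<close> and \<open>(\<bar>y\<bar>\<^sup>2 - (x \<bullet> y)\<^sup>2 / \<bar>x\<bar>\<^sup>2) / (2 \<bar>x\<bar>)\<close>, none of which is
  admissible unless its coefficient is zero, so \<open>\<phi>\<close> lies in \<open>W\<^sub>3\<^sub>/\<^sub>2\<close>, \<open>W\<^sub>1\<^sub>/\<^sub>2\<close> or \<open>L\<^sup>2\<close> iff the
  moments of order at most 0, 1 or 2 vanish. On the other side \<open>T\<^sub>1\<close> and \<open>T\<^sub>2\<close> are non-negative
  quadratic forms in these moments (and in \<open>\<langle>v, T f\<rangle>\<close>), so their kernels are cut out by the same
  conditions. Orthogonal projections and \<open>D\<^sub>1\<close> exist because \<open>S\<^sub>1 L\<^sup>2\<close> is finite-dimensional, being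
  fixed by an integral operator with square-integrable kernel.
\<close>

section \<open>Square-integrable functions\<close>

lemma borel_measurable_cnj [measurable (raw)]:
  "f \<in> borel_measurable M \<Longrightarrow> (\<lambda>x. cnj (f x)) \<in> borel_measurable M"
  by (rule borel_measurable_continuous_on[OF continuous_on_cnj[OF continuous_on_id]])

lemma aeq_refl [simp]: "aeq f f"
  unfolding aeq_def by simp

lemma aeq_trans: "aeq f g \<Longrightarrow> aeq g h \<Longrightarrow> aeq f h"
  unfolding aeq_def by (auto elim: AE_mp)

lemma aeq_mult: "aeq f g \<Longrightarrow> aeq (mult a f) (mult a g)"
  unfolding aeq_def mult_def by (auto elim: AE_mp)

lemma sq_int_borel: "sq_int f \<Longrightarrow> f \<in> borel_measurable borel"
  unfolding sq_int_def by simp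

lemma sq_int_integrable: "sq_int f \<Longrightarrow> integrable lborel (\<lambda>x. (cmod (f x))\<^sup>2)"
  unfolding sq_int_def by simp

lemma sq_intI_AE_bound:
  assumes "f \<in> borel_measurable borel" "integrable lborel h"
    "AE x in lborel. (cmod (f x))\<^sup>2 \<le> h x"
  shows "sq_int f"
  unfolding sq_int_def
proof
  show "integrable lborel (\<lambda>x. (cmod (f x))\<^sup>2)"
    by (rule Bochner_Integration.integrable_bound[OF assms(2)]) (use assms(1,3) in auto)
qed (use assms(1) in simp)

lemma sq_int_dominated:
  assumes "f \<in> borel_measurable borel" "sq_int g" "\<And>x. cmod (f x) \<le> c * cmod (g x)"
  shows "sq_int f"
proof (rule sq_intI_AE_bound[OF assms(1)])
  show "integrable lborel (\<lambda>x. c\<^sup>2 * (cmod (g x))\<^sup>2)"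
    using sq_int_integrable[OF assms(2)] by simp
  show "AE x in lborel. (cmod (f x))\<^sup>2 \<le> c\<^sup>2 * (cmod (g x))\<^sup>2"
    using power_mono[OF assms(3), where n=2] by (simp add: power_mult_distrib)
qed

lemma sq_int_aeq:
  assumes "sq_int f" "aeq f g" "g \<in> borel_measurable borel"
  shows "sq_int g"
  by (rule sq_intI_AE_bound[OF assms(3) sq_int_integrable[OF assms(1)]])
    (use assms(2) in \<open>auto simp: aeq_def\<close>)

lemma sq_int_zero: "sq_int (\<lambda>_. 0)"
  unfolding sq_int_def by simp

lemma sq_int_add:
  assumes f: "sq_int f" and g: "sq_int g"
  shows "sq_int (\<lambda>x. f x + g x)"
proof (rule sq_intI_AE_bound)
  note [measurable] = f[THEN sq_int_borel] g[THEN sq_int_borel]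
  show "(\<lambda>x. f x + g x) \<in> borel_measurable borel"
    by measurable
  show "integrable lborel (\<lambda>x. 2 * (cmod (f x))\<^sup>2 + 2 * (cmod (g x))\<^sup>2)"
    using f g by (simp add: sq_int_integrable)
  have "(cmod (a + b))\<^sup>2 \<le> 2 * (cmod a)\<^sup>2 + 2 * (cmod b)\<^sup>2" for a b
  proof -
    have "(cmod (a + b))\<^sup>2 \<le> (cmod a + cmod b)\<^sup>2"
      by (intro power_mono norm_triangle_ineq) auto
    also have "\<dots> \<le> 2 * (cmod a)\<^sup>2 + 2 * (cmod b)\<^sup>2"
      using sum_squares_bound[of "cmod a" "cmod b"] by (simp add: power2_sum)
    finally show ?thesis .
  qed
  then show "AE x in lborel. (cmod (f x + g x))\<^sup>2 \<le> 2 * (cmod (f x))\<^sup>2 + 2 * (cmod (g x))\<^sup>2"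
    by blast
qed

lemma sq_int_cmult: "sq_int f \<Longrightarrow> sq_int (\<lambda>x. c * f x)"
  unfolding sq_int_def by (auto simp: norm_mult power_mult_distrib)

lemma sq_int_diff: "sq_int f \<Longrightarrow> sq_int g \<Longrightarrow> sq_int (\<lambda>x. f x - g x)"
  using sq_int_add[of f "\<lambda>x. (-1) * g x"] sq_int_cmult[of g "-1"] by simp

lemma sq_int_sum:
  "finite I \<Longrightarrow> (\<And>i. i \<in> I \<Longrightarrow> sq_int (f i)) \<Longrightarrow> sq_int (\<lambda>x. \<Sum>i\<in>I. f i x)"
  by (induction I rule: finite_induct) (auto intro: sq_int_zero sq_int_add)

lemma sq_int_cnj: "sq_int f \<Longrightarrow> sq_int (\<lambda>x. cnj (f x))"
  by (rule sq_int_dominated[where g=f and c=1]) (auto dest: sq_int_borel)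

lemma integrable_sq_int_mult:
  assumes f: "sq_int f" and g: "sq_int g"
  shows "integrable lborel (\<lambda>x. f x * g x)"
proof (rule Bochner_Integration.integrable_bound)
  show "integrable lborel (\<lambda>x. (cmod (f x))\<^sup>2 + (cmod (g x))\<^sup>2)"
    using f g by (simp add: sq_int_integrable)
  note [measurable] = f[THEN sq_int_borel] g[THEN sq_int_borel]
  show "(\<lambda>x. f x * g x) \<in> borel_measurable lborel"
    by measurable
  have "cmod (f x) * cmod (g x) \<le> (cmod (f x))\<^sup>2 + (cmod (g x))\<^sup>2" for x
    using sum_squares_bound[of "cmod (f x)" "cmod (g x)"]
      mult_nonneg_nonneg[of "cmod (f x)" "cmod (g x)"] by (simp del: mult_nonneg_nonneg)
  then show "AE x in lborel. norm (f x * g x) \<le> norm ((cmod (f x))\<^sup>2 + (cmod (g x))\<^sup>2)"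
    by (simp add: norm_mult)
qed

lemma integrable_sq_int_norm_mult:
  "sq_int f \<Longrightarrow> sq_int g \<Longrightarrow> integrable lborel (\<lambda>x. cmod (f x) * cmod (g x))"
  using integrable_norm[OF integrable_sq_int_mult] by (simp add: norm_mult)

lemma integrable_L2_inner: "sq_int f \<Longrightarrow> sq_int g \<Longrightarrow> integrable lborel (\<lambda>x. cnj (f x) * g x)"
  by (intro integrable_sq_int_mult sq_int_cnj)

lemma L2_inner_commute: "L2_inner f g = cnj (L2_inner g f)"
  unfolding L2_inner_def
  by (subst Bochner_Integration.integral_cnj[symmetric]) (simp add: mult.commute)

lemma L2_inner_zero_right [simp]: "L2_inner f (\<lambda>_. 0) = 0"
  by (simp add: L2_inner_def)

lemma L2_inner_add_right:
  "sq_int f \<Longrightarrow> sq_int g \<Longrightarrow> sq_int h \<Longrightarrow>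
    L2_inner f (\<lambda>x. g x + h x) = L2_inner f g + L2_inner f h"
  unfolding L2_inner_def by (simp add: distrib_left integrable_L2_inner)

lemma L2_inner_diff_right:
  "sq_int f \<Longrightarrow> sq_int g \<Longrightarrow> sq_int h \<Longrightarrow>
    L2_inner f (\<lambda>x. g x - h x) = L2_inner f g - L2_inner f h"
  unfolding L2_inner_def by (simp add: right_diff_distrib integrable_L2_inner)

lemma L2_inner_cmult_right: "L2_inner f (\<lambda>x. c * g x) = c * L2_inner f g"
  unfolding L2_inner_def by (simp add: mult.left_commute)

lemma L2_inner_sum_right:
  "finite I \<Longrightarrow> sq_int f \<Longrightarrow> (\<And>i. i \<in> I \<Longrightarrow> sq_int (g i)) \<Longrightarrow>
    L2_inner f (\<lambda>x. \<Sum>i\<in>I. g i x) = (\<Sum>i\<in>I. L2_inner f (g i))"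
  by (induction I rule: finite_induct) (simp_all add: L2_inner_add_right sq_int_sum)

lemma L2_inner_add_left:
  "sq_int f \<Longrightarrow> sq_int g \<Longrightarrow> sq_int h \<Longrightarrow>
    L2_inner (\<lambda>x. f x + g x) h = L2_inner f h + L2_inner g h"
  by (simp add: L2_inner_commute[of _ h] L2_inner_add_right)

lemma L2_inner_diff_left:
  "sq_int f \<Longrightarrow> sq_int g \<Longrightarrow> sq_int h \<Longrightarrow>
    L2_inner (\<lambda>x. f x - g x) h = L2_inner f h - L2_inner g h"
  by (simp add: L2_inner_commute[of _ h] L2_inner_diff_right)

lemma L2_inner_cmult_left: "L2_inner (\<lambda>x. c * f x) g = cnj c * L2_inner f g"
  by (simp add: L2_inner_commute[of _ g] L2_inner_cmult_right)

lemma L2_inner_aeq_right: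
  assumes f: "sq_int f" and g: "sq_int g" "sq_int g'" "aeq g g'"
  shows "L2_inner f g = L2_inner f g'"
proof -
  note [measurable] = f[THEN sq_int_borel] g(1,2)[THEN sq_int_borel]
  have "AE x in lborel. cnj (f x) * g x = cnj (f x) * g' x"
    using g(3) unfolding aeq_def by eventually_elim simp
  then show ?thesis
    unfolding L2_inner_def by (intro integral_cong_AE) auto
qed

lemma L2_inner_aeq_left:
  "sq_int f \<Longrightarrow> sq_int f' \<Longrightarrow> sq_int g \<Longrightarrow> aeq f f' \<Longrightarrow> L2_inner f g = L2_inner f' g"
  by (metis L2_inner_aeq_right L2_inner_commute)

definition L2norm :: "fn \<Rightarrow> real" where
  "L2norm f = sqrt (LINT x|lborel. (cmod (f x))\<^sup>2)"

lemma L2norm_nonneg [simp]: "0 \<le> L2norm f"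
  unfolding L2norm_def by simp

lemma L2norm_square: "(L2norm f)\<^sup>2 = (LINT x|lborel. (cmod (f x))\<^sup>2)"
  unfolding L2norm_def by simp

lemma L2norm_cmult: "L2norm (\<lambda>x. c * f x) = cmod c * L2norm f"
  unfolding L2norm_def by (simp add: norm_mult power_mult_distrib real_sqrt_mult)

lemma L2_inner_self: "L2_inner f f = complex_of_real ((L2norm f)\<^sup>2)"
  unfolding L2norm_square L2_inner_def
  by (subst integral_complex_of_real[symmetric])
    (rule Bochner_Integration.integral_cong; simp only: complex_norm_square mult.commute)

lemma aeq_zero_if_L2norm_eq_zero:
  assumes "sq_int f" "L2norm f = 0"
  shows "aeq f (\<lambda>_. 0)"
proof -
  have "(LINT x|lborel. (cmod (f x))\<^sup>2) = 0"
    using assms(2) unfolding L2norm_def by simp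
  then have "AE x in lborel. (cmod (f x))\<^sup>2 = 0"
    by (subst (asm) integral_nonneg_eq_0_iff_AE) (auto intro: sq_int_integrable[OF assms(1)])
  then show ?thesis
    unfolding aeq_def by simp
qed

lemma L2norm_mono:
  assumes "sq_int f" "sq_int g" "\<And>x. cmod (f x) \<le> cmod (g x)"
  shows "L2norm f \<le> L2norm g"
  unfolding L2norm_def
  by (intro real_sqrt_le_mono integral_mono sq_int_integrable assms power_mono) auto

lemma integral_norm_mult_le_L2norm:
  assumes f: "sq_int f" and g: "sq_int g"
  shows "(LINT x|lborel. cmod (f x) * cmod (g x)) \<le> L2norm f * L2norm g"
proof -
  note [measurable] = f[THEN sq_int_borel] g[THEN sq_int_borel]
  have "ennreal ((LINT x|lborel. cmod (f x) * cmod (g x))\<^sup>2)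
      = (\<integral>\<^sup>+x. ennreal (cmod (f x)) * ennreal (cmod (g x)) \<partial>lborel)\<^sup>2"
    using integrable_sq_int_norm_mult[OF f g]
    by (simp add: nn_integral_eq_integral ennreal_power flip: ennreal_mult)
  also have "\<dots> \<le> (\<integral>\<^sup>+x. (ennreal (cmod (f x)))\<^sup>2 \<partial>lborel)
      * (\<integral>\<^sup>+x. (ennreal (cmod (g x)))\<^sup>2 \<partial>lborel)"
    by (rule Cauchy_Schwarz_nn_integral) auto
  also have "\<dots> = ennreal ((L2norm f * L2norm g)\<^sup>2)"
    using sq_int_integrable[OF f] sq_int_integrable[OF g]
    by (simp add: ennreal_power nn_integral_eq_integral L2norm_square power_mult_distrib
        flip: ennreal_mult)
  finally have "(LINT x|lborel. cmod (f x) * cmod (g x))\<^sup>2 \<le> (L2norm f * L2norm g)\<^sup>2"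
    by simp
  then show ?thesis
    by (rule power2_le_imp_le) simp
qed

lemma L2_inner_le_L2norm:
  assumes "sq_int f" "sq_int g"
  shows "cmod (L2_inner f g) \<le> L2norm f * L2norm g"
proof -
  have "cmod (L2_inner f g) \<le> (LINT x|lborel. cmod (cnj (f x) * g x))"
    unfolding L2_inner_def by (rule integral_norm_bound)
  also have "\<dots> = (LINT x|lborel. cmod (f x) * cmod (g x))"
    by (simp add: norm_mult)
  also have "\<dots> \<le> L2norm f * L2norm g"
    by (rule integral_norm_mult_le_L2norm[OF assms])
  finally show ?thesis .
qed

lemma L2norm_triangle:
  assumes f: "sq_int f" and g: "sq_int g"
  shows "L2norm (\<lambda>x. f x + g x) \<le> L2norm f + L2norm g"
proof (rule power2_le_imp_le)
  have "(L2norm (\<lambda>x. f x + g x))\<^sup>2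
      \<le> (LINT x|lborel. (cmod (f x))\<^sup>2 + 2 * (cmod (f x) * cmod (g x)) + (cmod (g x))\<^sup>2)"
    unfolding L2norm_square
  proof (rule integral_mono)
    show "integrable lborel (\<lambda>x. (cmod (f x + g x))\<^sup>2)"
      by (intro sq_int_integrable sq_int_add f g)
    show "integrable lborel
        (\<lambda>x. (cmod (f x))\<^sup>2 + 2 * (cmod (f x) * cmod (g x)) + (cmod (g x))\<^sup>2)"
      by (intro Bochner_Integration.integrable_add integrable_mult_right sq_int_integrable
          integrable_sq_int_norm_mult f g)
    show "(cmod (f x + g x))\<^sup>2 \<le> (cmod (f x))\<^sup>2 + 2 * (cmod (f x) * cmod (g x)) + (cmod (g x))\<^sup>2"
      for x
      using power_mono[OF norm_triangle_ineq[of "f x" "g x"], of 2] by (simp add: power2_sum)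
  qed
  also have "\<dots> = (L2norm f)\<^sup>2 + 2 * (LINT x|lborel. cmod (f x) * cmod (g x)) + (L2norm g)\<^sup>2"
    using f g by (simp add: sq_int_integrable integrable_sq_int_norm_mult L2norm_square)
  also have "\<dots> \<le> (L2norm f + L2norm g)\<^sup>2"
    using integral_norm_mult_le_L2norm[OF f g] by (simp add: power2_sum)
  finally show "(L2norm (\<lambda>x. f x + g x))\<^sup>2 \<le> (L2norm f + L2norm g)\<^sup>2" .
qed simp

section \<open>Finite-dimensional subspaces\<close>

definition L2_subspace :: "fn set \<Rightarrow> bool" where
  "L2_subspace K \<longleftrightarrow> (\<forall>f\<in>K. sq_int f) \<and> (\<lambda>_. 0) \<in> K \<and>
     (\<forall>f\<in>K. \<forall>g\<in>K. (\<lambda>x. f x + g x) \<in> K) \<and> (\<forall>f\<in>K. \<forall>c. (\<lambda>x. c * f x) \<in> K)"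

lemma L2_subspace_sq_int: "L2_subspace K \<Longrightarrow> f \<in> K \<Longrightarrow> sq_int f"
  unfolding L2_subspace_def by blast

lemma L2_subspace_zero: "L2_subspace K \<Longrightarrow> (\<lambda>_. 0) \<in> K"
  unfolding L2_subspace_def by blast

lemma L2_subspace_add: "L2_subspace K \<Longrightarrow> f \<in> K \<Longrightarrow> g \<in> K \<Longrightarrow> (\<lambda>x. f x + g x) \<in> K"
  unfolding L2_subspace_def by blast

lemma L2_subspace_cmult: "L2_subspace K \<Longrightarrow> f \<in> K \<Longrightarrow> (\<lambda>x. c * f x) \<in> K"
  unfolding L2_subspace_def by blast

lemma L2_subspace_diff: "L2_subspace K \<Longrightarrow> f \<in> K \<Longrightarrow> g \<in> K \<Longrightarrow> (\<lambda>x. f x - g x) \<in> K"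
  using L2_subspace_add[of K f "\<lambda>x. (-1) * g x"] L2_subspace_cmult[of K g "-1"] by simp

lemma L2_subspace_sum:
  "finite I \<Longrightarrow> L2_subspace K \<Longrightarrow> (\<And>i. i \<in> I \<Longrightarrow> f i \<in> K) \<Longrightarrow> (\<lambda>x. \<Sum>i\<in>I. f i x) \<in> K"
  by (induction I rule: finite_induct) (auto intro: L2_subspace_zero L2_subspace_add)

lemma aeq_zero_iff_orthogonal:
  assumes K: "L2_subspace K" and h: "h \<in> K"
  shows "aeq h (\<lambda>_. 0) \<longleftrightarrow> (\<forall>k\<in>K. L2_inner k h = 0)"
proof
  note sq = L2_subspace_sq_int[OF K]
  show "\<forall>k\<in>K. L2_inner k h = 0" if "aeq h (\<lambda>_. 0)"
    using L2_inner_aeq_right[OF sq sq[OF h] sq_int_zero that] by simp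
  assume "\<forall>k\<in>K. L2_inner k h = 0"
  then have "L2norm h = 0"
    using h L2_inner_self[of h] by simp
  then show "aeq h (\<lambda>_. 0)"
    by (rule aeq_zero_if_L2norm_eq_zero[OF sq[OF h]])
qed

lemma aeq_if_L2_inner_eq:
  assumes K: "L2_subspace K" and f: "f \<in> K" and g: "g \<in> K"
    and eq: "\<And>k. k \<in> K \<Longrightarrow> L2_inner k f = L2_inner k g"
  shows "aeq f g"
proof -
  have "aeq (\<lambda>x. f x - g x) (\<lambda>_. 0)"
    unfolding aeq_zero_iff_orthogonal[OF K L2_subspace_diff[OF K f g]]
    using f g eq by (simp add: L2_inner_diff_right L2_subspace_sq_int[OF K])
  then show ?thesis
    unfolding aeq_def by simp
qed

definition orthonormal :: "nat \<Rightarrow> (nat \<Rightarrow> fn) \<Rightarrow> bool" where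
  "orthonormal m e \<longleftrightarrow> (\<forall>i<m. sq_int (e i)) \<and>
     (\<forall>i<m. \<forall>j<m. L2_inner (e i) (e j) = (if i = j then 1 else 0))"

lemma orthonormal_sq_int: "orthonormal m e \<Longrightarrow> i < m \<Longrightarrow> sq_int (e i)"
  unfolding orthonormal_def by blast

lemma orthonormal_L2_inner:
  "orthonormal m e \<Longrightarrow> i < m \<Longrightarrow> j < m \<Longrightarrow> L2_inner (e i) (e j) = (if i = j then 1 else 0)"
  unfolding orthonormal_def by blast

lemma orthonormal_extend:
  assumes on: "orthonormal m e" and r: "sq_int r" "L2norm r \<noteq> 0"
    and orth: "\<And>i. i < m \<Longrightarrow> L2_inner (e i) r = 0"
  shows "orthonormal (Suc m) (e(m := (\<lambda>x. complex_of_real (1 / L2norm r) * r x)))"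
proof -
  define u where "u = (\<lambda>x. complex_of_real (1 / L2norm r) * r x)"
  have "sq_int u"
    unfolding u_def by (rule sq_int_cmult[OF r(1)])
  moreover have "L2_inner u u = 1"
    unfolding u_def L2_inner_cmult_left L2_inner_cmult_right L2_inner_self
    using r(2) by (simp add: power2_eq_square)
  moreover have eu: "L2_inner (e i) u = 0" if "i < m" for i
    unfolding u_def L2_inner_cmult_right using orth[OF that] by simp
  moreover have "L2_inner u (e i) = 0" if "i < m" for i
    using eu[OF that] L2_inner_commute[of u "e i"] by simp
  ultimately show ?thesis
    using on unfolding orthonormal_def u_def[symmetric] by (auto simp: less_Suc_eq)
qed

definition orthonormal_proj :: "nat \<Rightarrow> (nat \<Rightarrow> fn) \<Rightarrow> fn \<Rightarrow> fn" where
  "orthonormal_proj m e u = (\<lambda>x. \<Sum>i<m. L2_inner (e i) u * e i x)"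

lemma orthonormal_proj_in_subspace:
  "L2_subspace K \<Longrightarrow> (\<And>i. i < m \<Longrightarrow> e i \<in> K) \<Longrightarrow> orthonormal_proj m e u \<in> K"
  unfolding orthonormal_proj_def by (intro L2_subspace_sum) (auto intro: L2_subspace_cmult)

lemma sq_int_orthonormal_proj: "orthonormal m e \<Longrightarrow> sq_int (orthonormal_proj m e u)"
  unfolding orthonormal_proj_def by (intro sq_int_sum sq_int_cmult) (auto dest: orthonormal_sq_int)

lemma L2_inner_orthonormal_proj_right:
  assumes "orthonormal m e" "sq_int h"
  shows "L2_inner h (orthonormal_proj m e u) = (\<Sum>i<m. L2_inner (e i) u * L2_inner h (e i))"
proof -
  have "L2_inner h (orthonormal_proj m e u) = (\<Sum>i<m. L2_inner h (\<lambda>x. L2_inner (e i) u * e i x))"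
    unfolding orthonormal_proj_def
    by (rule L2_inner_sum_right)
      (use assms orthonormal_sq_int[OF assms(1)] in \<open>auto intro: sq_int_cmult\<close>)
  then show ?thesis
    by (simp add: L2_inner_cmult_right)
qed

lemma L2_inner_orthonormal_proj_left:
  assumes "orthonormal m e" "sq_int h"
  shows "L2_inner (orthonormal_proj m e u) h = (\<Sum>i<m. cnj (L2_inner (e i) u) * L2_inner (e i) h)"
proof -
  have "L2_inner (orthonormal_proj m e u) h = cnj (\<Sum>i<m. L2_inner (e i) u * L2_inner h (e i))"
    using L2_inner_commute[of _ h] L2_inner_orthonormal_proj_right[OF assms] by metis
  then show ?thesis
    by (simp add: L2_inner_commute[of _ h])
qed

lemma orthonormal_proj_residual:
  assumes on: "orthonormal m e" and u: "sq_int u" and j: "j < m"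
  shows "L2_inner (e j) (\<lambda>x. u x - orthonormal_proj m e u x) = 0"
proof -
  have "L2_inner (e j) (orthonormal_proj m e u) = (\<Sum>i<m. if i = j then L2_inner (e i) u else 0)"
    unfolding L2_inner_orthonormal_proj_right[OF on orthonormal_sq_int[OF on j]]
    using on j by (intro sum.cong) (auto simp: orthonormal_L2_inner)
  also have "\<dots> = L2_inner (e j) u"
    using j by simp
  finally show ?thesis
    using on u j by (simp add: L2_inner_diff_right orthonormal_sq_int sq_int_orthonormal_proj)
qed

lemma Bessel_inequality:
  assumes on: "orthonormal m e" and u: "sq_int u"
  shows "(\<Sum>i<m. (cmod (L2_inner (e i) u))\<^sup>2) \<le> (L2norm u)\<^sup>2"
proof -
  define p where "p = orthonormal_proj m e u"
  define r where "r = (\<lambda>x. u x - p x)"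
  have p: "sq_int p"
    unfolding p_def by (rule sq_int_orthonormal_proj[OF on])
  have r: "sq_int r"
    unfolding r_def by (intro sq_int_diff u p)
  have "L2_inner p r = 0"
    using L2_inner_orthonormal_proj_left[OF on r] orthonormal_proj_residual[OF on u]
    by (simp add: p_def r_def)
  then have "L2_inner r r = L2_inner u r"
    unfolding r_def using u p by (simp add: L2_inner_diff_left sq_int_diff)
  also have "\<dots> = L2_inner u u - L2_inner u p"
    unfolding r_def using u p by (simp add: L2_inner_diff_right)
  also have "L2_inner u p = complex_of_real (\<Sum>i<m. (cmod (L2_inner (e i) u))\<^sup>2)"
    unfolding p_def L2_inner_orthonormal_proj_right[OF on u] of_real_sum
    by (intro sum.cong refl) (metis L2_inner_commute complex_norm_square)
  finally have "(L2norm r)\<^sup>2 = (L2norm u)\<^sup>2 - (\<Sum>i<m. (cmod (L2_inner (e i) u))\<^sup>2)"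
    unfolding L2_inner_self of_real_diff[symmetric] of_real_eq_iff .
  then show ?thesis
    using zero_le_power2[of "L2norm r"] by linarith
qed

definition L2_finite_dim :: "fn set \<Rightarrow> bool" where
  "L2_finite_dim K \<longleftrightarrow> (\<exists>N. \<forall>m e. orthonormal m e \<longrightarrow> (\<forall>i<m. e i \<in> K) \<longrightarrow> m \<le> N)"

lemma L2_finite_dim_subset: "L2_finite_dim K \<Longrightarrow> K' \<subseteq> K \<Longrightarrow> L2_finite_dim K'"
  unfolding L2_finite_dim_def by (meson subsetD)

text \<open>For orthonormal functions in \<open>K\<close>, Bessel's inequality for \<open>\<kappa> x\<close> bounds the sum of their
  squared moduli at \<open>x\<close>; integrating over \<open>x\<close> bounds their number.\<close>

lemma L2_finite_dim_if_reproducing_kernel: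
  assumes K: "\<And>f. f \<in> K \<Longrightarrow> aeq f (\<lambda>x. L2_inner (\<kappa> x) f)"
    and \<kappa>: "\<And>x. sq_int (\<kappa> x)" "\<And>x. L2norm (\<kappa> x) \<le> a x"
    and a: "integrable lborel (\<lambda>x. (a x)\<^sup>2)"
  shows "L2_finite_dim K"
proof -
  have "real m \<le> (LINT x|lborel. (a x)\<^sup>2)" if on: "orthonormal m e" and e: "\<forall>i<m. e i \<in> K" for m e
  proof -
    have int: "integrable lborel (\<lambda>x. (cmod (e i x))\<^sup>2)" if "i < m" for i
      using on that by (intro sq_int_integrable) (rule orthonormal_sq_int)
    have norm_e: "(LINT x|lborel. (cmod (e i x))\<^sup>2) = 1" if "i < m" for i
      using L2_inner_self[of "e i"] orthonormal_L2_inner[OF on that that]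
      unfolding L2norm_square by (metis of_real_eq_1_iff)
    have "AE x in lborel. \<forall>i\<in>{..<m}. e i x = L2_inner (\<kappa> x) (e i)"
      using e K unfolding aeq_def by (intro AE_finite_allI) auto
    then have "AE x in lborel. (\<Sum>i<m. (cmod (e i x))\<^sup>2) \<le> (a x)\<^sup>2"
    proof eventually_elim
      case (elim x)
      then have "(\<Sum>i<m. (cmod (e i x))\<^sup>2) = (\<Sum>i<m. (cmod (L2_inner (e i) (\<kappa> x)))\<^sup>2)"
        by (intro sum.cong) (auto simp: L2_inner_commute[of "\<kappa> x"])
      also have "\<dots> \<le> (L2norm (\<kappa> x))\<^sup>2"
        by (rule Bessel_inequality[OF on \<kappa>(1)])
      also have "\<dots> \<le> (a x)\<^sup>2"
        by (intro power_mono \<kappa>) simp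
      finally show ?case .
    qed
    then have "(LINT x|lborel. (\<Sum>i<m. (cmod (e i x))\<^sup>2)) \<le> (LINT x|lborel. (a x)\<^sup>2)"
      using int a by (intro integral_mono_AE) auto
    also have "(LINT x|lborel. (\<Sum>i<m. (cmod (e i x))\<^sup>2)) = real m"
      using int norm_e by (subst Bochner_Integration.integral_sum) auto
    finally show ?thesis .
  qed
  then have "m \<le> nat \<lceil>LINT x|lborel. (a x)\<^sup>2\<rceil>" if "orthonormal m e" "\<forall>i<m. e i \<in> K" for m e
    using order_trans[OF _ real_nat_ceiling_ge] that of_nat_le_iff by blast
  then show ?thesis
    unfolding L2_finite_dim_def by blast
qed

lemma maximal_orthonormal_exists:
  assumes "L2_finite_dim K"
  shows "\<exists>m e. orthonormal m e \<and> (\<forall>i<m. e i \<in> K) \<and>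
    (\<nexists>e'. orthonormal (Suc m) e' \<and> (\<forall>i<Suc m. e' i \<in> K))"
proof -
  let ?P = "\<lambda>m. \<exists>e. orthonormal m e \<and> (\<forall>i<m. e i \<in> K)"
  define m where "m = (GREATEST m. ?P m)"
  obtain N where bound: "\<And>m. ?P m \<Longrightarrow> m \<le> N"
    using assms unfolding L2_finite_dim_def by blast
  have "?P 0"
    by (simp add: orthonormal_def)
  then have "?P m"
    unfolding m_def by (rule GreatestI_nat[where P="?P"]) (rule bound)
  moreover have "\<not> ?P (Suc m)"
    using Greatest_le_nat[of ?P "Suc m", OF _ bound] unfolding m_def by auto
  ultimately show ?thesis
    by blast
qed

lemma orthonormal_basis_exists:
  assumes K: "L2_subspace K" and dim: "L2_finite_dim K"
  shows "\<exists>m e. orthonormal m e \<and> (\<forall>i<m. e i \<in> K) \<and> (\<forall>k\<in>K. aeq k (orthonormal_proj m e k))"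
proof -
  obtain m e where on: "orthonormal m e" and e: "\<And>i. i < m \<Longrightarrow> e i \<in> K"
    and maximal: "\<nexists>e'. orthonormal (Suc m) e' \<and> (\<forall>i<Suc m. e' i \<in> K)"
    using maximal_orthonormal_exists[OF dim] by blast
  have "aeq k (orthonormal_proj m e k)" if k: "k \<in> K" for k
  proof -
    define r where "r = (\<lambda>x. k x - orthonormal_proj m e k x)"
    have r: "r \<in> K"
      unfolding r_def by (intro L2_subspace_diff[OF K k] orthonormal_proj_in_subspace[OF K] e)
    note sq = L2_subspace_sq_int[OF K]
    have "L2norm r = 0"
    proof (rule ccontr)
      assume nonzero: "L2norm r \<noteq> 0"
      have orth: "L2_inner (e i) r = 0" if "i < m" for i
        unfolding r_def by (rule orthonormal_proj_residual[OF on sq[OF k] that])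
      let ?e = "e(m := (\<lambda>x. complex_of_real (1 / L2norm r) * r x))"
      have "orthonormal (Suc m) ?e"
        by (rule orthonormal_extend[OF on sq[OF r] nonzero]) (rule orth)
      moreover have "\<forall>i<Suc m. ?e i \<in> K"
        using e L2_subspace_cmult[OF K r, of "complex_of_real (1 / L2norm r)"]
        by (simp add: less_Suc_eq)
      ultimately show False
        using maximal by blast
    qed
    then have "aeq r (\<lambda>_. 0)"
      by (rule aeq_zero_if_L2norm_eq_zero[OF sq[OF r]])
    then show ?thesis
      unfolding r_def aeq_def by simp
  qed
  then show ?thesis
    using on e by blast
qed

lemma orth_proj_exists:
  assumes K: "L2_subspace K" and dim: "L2_finite_dim K" and g: "sq_int g"
  shows "\<exists>h. h \<in> K \<and> (\<forall>k\<in>K. L2_inner k (\<lambda>x. g x - h x) = 0)"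
proof -
  obtain m e where on: "orthonormal m e" and e: "\<And>i. i < m \<Longrightarrow> e i \<in> K"
    and basis: "\<And>k. k \<in> K \<Longrightarrow> aeq k (orthonormal_proj m e k)"
    using orthonormal_basis_exists[OF K dim] by blast
  let ?r = "\<lambda>x. g x - orthonormal_proj m e g x"
  have r: "sq_int ?r"
    by (intro sq_int_diff g sq_int_orthonormal_proj[OF on])
  have "L2_inner k ?r = 0" if k: "k \<in> K" for k
  proof -
    have "L2_inner k ?r = L2_inner (orthonormal_proj m e k) ?r"
      by (rule L2_inner_aeq_left[OF L2_subspace_sq_int[OF K k] sq_int_orthonormal_proj[OF on] r
            basis[OF k]])
    also have "\<dots> = 0"
      unfolding L2_inner_orthonormal_proj_left[OF on r]
      by (intro sum.neutral ballI) (simp add: orthonormal_proj_residual[OF on g])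
    finally show ?thesis .
  qed
  moreover have "orthonormal_proj m e g \<in> K"
    by (rule orthonormal_proj_in_subspace[OF K e])
  ultimately show ?thesis
    by blast
qed

lemma orth_proj:
  assumes "L2_subspace K" "L2_finite_dim K" "sq_int g"
  shows "orth_proj K g \<in> K"
    and "k \<in> K \<Longrightarrow> L2_inner k (orth_proj K g) = L2_inner k g"
proof -
  have proj: "orth_proj K g \<in> K \<and> (\<forall>k\<in>K. L2_inner k (\<lambda>x. g x - orth_proj K g x) = 0)"
    unfolding orth_proj_def by (rule someI_ex[OF orth_proj_exists[OF assms]])
  then show "orth_proj K g \<in> K"
    by blast
  assume k: "k \<in> K"
  then have "L2_inner k (\<lambda>x. g x - orth_proj K g x) = 0"
    using proj by blast
  then show "L2_inner k (orth_proj K g) = L2_inner k g"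
    using proj k assms(3) by (simp add: L2_inner_diff_right L2_subspace_sq_int[OF assms(1)])
qed

lemma L2_inner_orth_proj_symmetric:
  assumes K: "L2_subspace K" "L2_finite_dim K" and g: "sq_int g" and h: "sq_int h"
  shows "L2_inner g (orth_proj K h) = L2_inner (orth_proj K g) (orth_proj K h)"
    and "L2_inner (orth_proj K g) h = L2_inner (orth_proj K g) (orth_proj K h)"
proof -
  note pg = orth_proj[OF K g] and ph = orth_proj[OF K h]
  show "L2_inner (orth_proj K g) h = L2_inner (orth_proj K g) (orth_proj K h)"
    using ph(2)[OF pg(1)] by simp
  show "L2_inner g (orth_proj K h) = L2_inner (orth_proj K g) (orth_proj K h)"
    using pg(2)[OF ph(1)] L2_inner_commute[of _ "orth_proj K h"] by simp
qed

text \<open>Forms, rather than operators, because operators built from \<^const>\<open>orth_proj\<close> are linear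
  only up to null sets.\<close>

definition hermitian_form_on :: "fn set \<Rightarrow> (fn \<Rightarrow> fn \<Rightarrow> complex) \<Rightarrow> bool" where
  "hermitian_form_on K B \<longleftrightarrow>
     (\<forall>k\<in>K. \<forall>h\<in>K. \<forall>h'\<in>K. B k (\<lambda>x. h x + h' x) = B k h + B k h') \<and>
     (\<forall>k\<in>K. \<forall>h\<in>K. \<forall>c. B k (\<lambda>x. c * h x) = c * B k h) \<and>
     (\<forall>k\<in>K. \<forall>h\<in>K. B k h = cnj (B h k))"

lemma hermitian_form_on_add_right:
  "hermitian_form_on K B \<Longrightarrow> k \<in> K \<Longrightarrow> h \<in> K \<Longrightarrow> h' \<in> K \<Longrightarrow>
    B k (\<lambda>x. h x + h' x) = B k h + B k h'"
  unfolding hermitian_form_on_def by blast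

lemma hermitian_form_on_cmult_right:
  "hermitian_form_on K B \<Longrightarrow> k \<in> K \<Longrightarrow> h \<in> K \<Longrightarrow> B k (\<lambda>x. c * h x) = c * B k h"
  unfolding hermitian_form_on_def by blast

lemma hermitian_form_on_commute:
  "hermitian_form_on K B \<Longrightarrow> k \<in> K \<Longrightarrow> h \<in> K \<Longrightarrow> B k h = cnj (B h k)"
  unfolding hermitian_form_on_def by blast

lemma hermitian_form_on_add:
  assumes "hermitian_form_on K B" "hermitian_form_on K B'"
  shows "hermitian_form_on K (\<lambda>k h. B k h + B' k h)"
proof -
  note add = assms[THEN hermitian_form_on_add_right]
    and cmult = assms[THEN hermitian_form_on_cmult_right]
    and commute = assms[THEN hermitian_form_on_commute]
  show ?thesis
    unfolding hermitian_form_on_def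
  proof (intro conjI ballI allI)
    fix k h assume kh: "k \<in> K" "h \<in> K"
    show "B k h + B' k h = cnj (B h k + B' h k)"
      unfolding complex_cnj_add using commute[OF kh] by (rule arg_cong2)
  qed (simp_all add: add cmult algebra_simps)
qed

lemma L2_subspace_form_range:
  assumes K: "L2_subspace K" and B: "hermitian_form_on K B"
  shows "L2_subspace {b \<in> K. \<exists>h\<in>K. \<forall>k\<in>K. L2_inner k b = B k h}" (is "L2_subspace ?R")
  unfolding L2_subspace_def
proof (intro conjI ballI allI)
  note sq = L2_subspace_sq_int[OF K]
  note add = hermitian_form_on_add_right[OF B] and cmult = hermitian_form_on_cmult_right[OF B]
  show "sq_int f" if "f \<in> ?R" for f
    using that sq by blast
  have "B k (\<lambda>_. 0) = 0" if "k \<in> K" for k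
    using cmult[OF that L2_subspace_zero[OF K], of 0] by simp
  then show "(\<lambda>_. 0) \<in> ?R"
    using L2_subspace_zero[OF K] by force
  fix f assume "f \<in> ?R"
  then obtain h where h: "f \<in> K" "h \<in> K" "\<And>k. k \<in> K \<Longrightarrow> L2_inner k f = B k h"
    by blast
  then have "\<forall>k\<in>K. L2_inner k (\<lambda>x. c * f x) = B k (\<lambda>x. c * h x)" for c
    by (simp add: L2_inner_cmult_right cmult)
  then show "(\<lambda>x. c * f x) \<in> ?R" for c
    using h(1,2) L2_subspace_cmult[OF K] by blast
  fix g assume "g \<in> ?R"
  then obtain h' where h': "g \<in> K" "h' \<in> K" "\<And>k. k \<in> K \<Longrightarrow> L2_inner k g = B k h'"
    by blast
  have "\<forall>k\<in>K. L2_inner k (\<lambda>x. f x + g x) = B k (\<lambda>x. h x + h' x)"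
    using h h' by (simp add: L2_inner_add_right sq add)
  then show "(\<lambda>x. f x + g x) \<in> ?R"
    using h(1,2) h'(1,2) L2_subspace_add[OF K] by blast
qed

text \<open>The difference of the projections of \<open>g\<close> to \<open>K\<close> and to the range of the form is a null vector
  of the form.\<close>

lemma definite_form_represents_L2_inner:
  assumes K: "L2_subspace K" "L2_finite_dim K" and g: "sq_int g"
    and B: "hermitian_form_on K B"
    and A: "\<And>h. h \<in> K \<Longrightarrow> A h \<in> K"
      "\<And>k h. k \<in> K \<Longrightarrow> h \<in> K \<Longrightarrow> L2_inner k (A h) = B k h"
    and definite: "\<And>h. h \<in> K \<Longrightarrow> B h h = 0 \<Longrightarrow> aeq h (\<lambda>_. 0)"
  shows "\<exists>h\<in>K. \<forall>k\<in>K. B k h = L2_inner k g"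
proof -
  define R where "R = {b \<in> K. \<exists>h\<in>K. \<forall>k\<in>K. L2_inner k b = B k h}"
  note sq = L2_subspace_sq_int[OF K(1)]
  have R: "L2_subspace R"
    unfolding R_def by (rule L2_subspace_form_range[OF K(1) B])
  have "R \<subseteq> K"
    unfolding R_def by blast
  define p where "p = orth_proj K g"
  define r where "r = orth_proj R g"
  define s where "s = (\<lambda>x. p x - r x)"
  note p = orth_proj[OF K g, folded p_def]
  note r = orth_proj[OF R L2_finite_dim_subset[OF K(2) \<open>R \<subseteq> K\<close>] g, folded r_def]
  have "r \<in> K"
    using r(1) \<open>R \<subseteq> K\<close> by blast
  have s: "s \<in> K"
    unfolding s_def by (rule L2_subspace_diff[OF K(1) p(1) \<open>r \<in> K\<close>])
  have "A s \<in> R"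
    unfolding R_def using A s by blast
  then have "L2_inner (A s) s = 0"
    unfolding s_def using r(2) p(2) A(1)[OF s] \<open>r \<in> K\<close> p(1) \<open>R \<subseteq> K\<close>
    by (simp add: L2_inner_diff_right sq s_def subset_iff)
  then have "B s s = 0"
    using A(2)[OF s s] L2_inner_commute[of s] by simp
  then have "aeq p r"
    using definite[OF s] unfolding s_def aeq_def by simp
  moreover obtain h where h: "h \<in> K" "\<And>k. k \<in> K \<Longrightarrow> L2_inner k r = B k h"
    using r(1) unfolding R_def by blast
  ultimately have "B k h = L2_inner k g" if "k \<in> K" for k
    using L2_inner_aeq_right[OF sq[OF that] sq[OF p(1)] sq[OF \<open>r \<in> K\<close>]] p(2)[OF that] h(2)[OF that]
    by simp
  then show ?thesis
    using h(1) by blast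
qed

section \<open>Radial integrals\<close>

lemma nn_integral_radial:
  fixes g G :: "real \<Rightarrow> real"
  assumes [measurable]: "g \<in> borel_measurable borel"
    and der: "\<And>r. 0 \<le> r \<Longrightarrow> (G has_real_derivative g r) (at r)"
    and nonneg: "\<And>r. 0 \<le> r \<Longrightarrow> 0 \<le> g r"
    and lim: "(G \<longlongrightarrow> T) at_top"
  shows "(\<integral>\<^sup>+x. ennreal (T - G (norm (x::'a::euclidean_space))) \<partial>lborel)
    = (\<integral>\<^sup>+r. ennreal (g r * (unit_ball_vol (DIM('a)) * r ^ DIM('a))) * indicator {0..} r \<partial>lborel)"
proof -
  have ball: "(\<integral>\<^sup>+x. ennreal (g r) * (if norm (x::'a) \<le> r then 1 else 0) \<partial>lborel)
      = ennreal (g r * (unit_ball_vol (DIM('a)) * r ^ DIM('a))) * indicator {0..} r" for r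
  proof -
    have "(\<integral>\<^sup>+x. ennreal (g r) * (if norm (x::'a) \<le> r then 1 else 0) \<partial>lborel)
        = (\<integral>\<^sup>+x. ennreal (g r) * indicator (cball 0 r :: 'a set) x \<partial>lborel)"
      by (intro nn_integral_cong) (auto simp: indicator_def)
    also have "\<dots> = ennreal (g r) * emeasure lborel (cball 0 r :: 'a set)"
      by (simp add: nn_integral_cmult_indicator)
    also have "\<dots> = ennreal (g r * (unit_ball_vol (DIM('a)) * r ^ DIM('a))) * indicator {0..} r"
      by (cases "0 \<le> r") (simp_all add: emeasure_cball nonneg flip: ennreal_mult')
    finally show ?thesis .
  qed
  have "(\<integral>\<^sup>+x. ennreal (T - G (norm (x::'a))) \<partial>lborel)
      = (\<integral>\<^sup>+x. (\<integral>\<^sup>+r. ennreal (g r) * indicator {norm (x::'a)..} r \<partial>lborel) \<partial>lborel)"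
    by (intro nn_integral_cong nn_integral_FTC_atLeast[symmetric])
      (auto intro: der nonneg lim order_trans[OF norm_ge_zero])
  also have "\<dots> = (\<integral>\<^sup>+x. (\<integral>\<^sup>+r. ennreal (g r) * (if norm (x::'a) \<le> r then 1 else 0) \<partial>lborel)
      \<partial>lborel)"
    by (intro nn_integral_cong) (auto simp: indicator_def)
  also have "\<dots> = (\<integral>\<^sup>+r. (\<integral>\<^sup>+x. ennreal (g r) * (if norm (x::'a) \<le> r then 1 else 0) \<partial>lborel)
      \<partial>lborel)"
    by (subst lborel_pair.Fubini') auto
  finally show ?thesis
    unfolding ball .
qed

lemma one_plus_powr_mult_power_le:
  fixes r p :: real
  assumes "0 \<le> r"
  shows "(1 + r) powr p * r ^ n \<le> (1 + r) powr (n + p)"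
proof -
  have "(1 + r) powr p * r ^ n \<le> (1 + r) powr p * (1 + r) ^ n"
    using assms by (intro mult_left_mono power_mono) auto
  also have "\<dots> = (1 + r) powr (n + p)"
    using assms powr_add[of "1 + r" p n] by (simp add: powr_realpow add.commute)
  finally show ?thesis .
qed

lemma integrable_one_plus_norm_powr:
  assumes p: "p > real DIM('a)"
  shows "integrable lborel (\<lambda>x::'a::euclidean_space. (1 + norm x) powr (- p))"
proof (rule integrableI_nonneg)
  let ?n = "DIM('a)" and ?\<omega> = "unit_ball_vol (DIM('a))"
  have "0 < p"
    using p of_nat_0_le_iff[of ?n] by linarith
  have bound: "(p * (1 + r) powr (- p - 1)) * (?\<omega> * r ^ ?n) \<le> ?\<omega> * p * (1 + r) powr (?n - p - 1)"
    if r: "0 \<le> r" for r :: real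
    using mult_left_mono[OF one_plus_powr_mult_power_le[OF r, of "- p - 1" ?n], of "?\<omega> * p"] \<open>0 < p\<close>
    by (simp add: algebra_simps)
  have "(\<integral>\<^sup>+x. ennreal ((1 + norm (x::'a)) powr (- p)) \<partial>lborel)
      = (\<integral>\<^sup>+x. ennreal (0 - (\<lambda>r. - ((1 + r) powr (- p))) (norm (x::'a))) \<partial>lborel)"
    by simp
  also have "\<dots> = (\<integral>\<^sup>+r. ennreal ((p * (1 + r) powr (- p - 1)) * (?\<omega> * r ^ ?n)) * indicator {0..} r
      \<partial>lborel)"
  proof (rule nn_integral_radial)
    show "((\<lambda>r. - ((1 + r) powr (- p))) \<longlongrightarrow> 0) at_top"
      using \<open>0 < p\<close> by real_asymp
    show "((\<lambda>r. - ((1 + r) powr - p)) has_real_derivative p * (1 + r) powr (- p - 1)) (at r)"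
      if "0 \<le> r" for r
      using that by (auto intro!: derivative_eq_intros)
  qed (use \<open>0 < p\<close> in auto)
  also have "\<dots> \<le> (\<integral>\<^sup>+r. ennreal (?\<omega> * p * (1 + r) powr (?n - p - 1)) * indicator {0..} r \<partial>lborel)"
    using bound by (intro nn_integral_mono) (auto simp: indicator_def ennreal_leI)
  also have "\<dots> = ennreal (0 - (\<lambda>r. ?\<omega> * p / (?n - p) * (1 + r) powr (?n - p)) 0)"
  proof (rule nn_integral_FTC_atLeast)
    show "((\<lambda>r. ?\<omega> * p / (?n - p) * (1 + r) powr (?n - p)) \<longlongrightarrow> 0) at_top"
      using p by real_asymp
    show "((\<lambda>r. ?\<omega> * p / (?n - p) * (1 + r) powr (?n - p))
        has_real_derivative ?\<omega> * p * (1 + r) powr (?n - p - 1)) (at r)" if "0 \<le> r" for r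
      using that p by (auto intro!: derivative_eq_intros)
  qed (use \<open>0 < p\<close> in auto)
  also have "\<dots> < \<infinity>"
    by simp
  finally show "(\<integral>\<^sup>+x. ennreal ((1 + norm (x::'a)) powr (- p)) \<partial>lborel) < \<infinity>" .
qed auto

lemma one_plus_square_pos: "0 < 1 + (r::real)\<^sup>2"
  by (simp add: add_pos_nonneg)

lemma DERIV_power_mult_one_plus_square_powr:
  fixes r :: real
  assumes "0 < n"
  shows "((\<lambda>r. r ^ n * (1 + r\<^sup>2) powr (- (real n / 2))) has_real_derivative
    real n * r ^ (n - 1) * (1 + r\<^sup>2) powr (- (real n / 2) - 1)) (at r)"
proof -
  let ?q = "(1 + r\<^sup>2) powr (- (real n / 2) - 1)"
  have powr: "(1 + r\<^sup>2) powr (- (real n / 2)) = ?q * (1 + r\<^sup>2)"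
    using powr_add[of "1 + r\<^sup>2" "- (real n / 2) - 1" 1] one_plus_square_pos[of r] by simp
  have "((\<lambda>r. r ^ n * (1 + r\<^sup>2) powr (- (real n / 2))) has_real_derivative
      real n * r ^ (n - 1) * (1 + r\<^sup>2) powr (- (real n / 2))
        + r ^ n * (- (real n / 2) * ?q * (2 * r))) (at r)"
    using one_plus_square_pos[of r] by (auto intro!: derivative_eq_intros)
  moreover have "real n * r ^ (n - 1) * (?q * (1 + r\<^sup>2)) + r ^ n * (- (real n / 2) * ?q * (2 * r))
      = real n * r ^ (n - 1) * ?q"
    using assms by (simp add: power_eq_if[of r n] power2_eq_square algebra_simps)
  ultimately show ?thesis
    unfolding powr by simp
qed

lemma DERIV_diff_power_mult_one_plus_square_powr:
  fixes r :: real
  shows "((\<lambda>r. r ^ 5 * (1 + r\<^sup>2) powr (- (5 / 2)) / 5 - r ^ 7 * (1 + r\<^sup>2) powr (- (7 / 2)) / 7)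
    has_real_derivative r ^ 4 * (1 + r\<^sup>2) powr (- 9 / 2)) (at r)"
proof -
  have "((\<lambda>r. r ^ 5 * (1 + r\<^sup>2) powr (- (5 / 2)) / 5 - r ^ 7 * (1 + r\<^sup>2) powr (- (7 / 2)) / 7)
      has_real_derivative 5 * r ^ 4 * (1 + r\<^sup>2) powr (- 7 / 2) / 5
        - 7 * r ^ 6 * (1 + r\<^sup>2) powr (- 9 / 2) / 7) (at r)"
    using DERIV_power_mult_one_plus_square_powr[of 5 r]
      DERIV_power_mult_one_plus_square_powr[of 7 r]
    by (intro DERIV_diff DERIV_cdivide) simp_all
  moreover have "(1 + r\<^sup>2) powr (- 7 / 2) = (1 + r\<^sup>2) powr (- 9 / 2) * (1 + r\<^sup>2)"
    using powr_add[of "1 + r\<^sup>2" "- 9 / 2" 1] one_plus_square_pos[of r] by simp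
  moreover have "5 * r ^ 4 * (q * (1 + r\<^sup>2)) / 5 - 7 * r ^ 6 * q / 7 = r ^ 4 * q" for q
    by (simp add: field_simps eval_nat_numeral)
  ultimately show ?thesis
    by (simp only:)
qed

lemma nn_integral_one_plus_norm_square_powr_7_2:
  "(\<integral>\<^sup>+x. ennreal ((1 + (norm (x::real^3))\<^sup>2) powr (- 7 / 2)) \<partial>lborel) = ennreal (8 * pi / 15)"
proof -
  let ?F = "\<lambda>r. 28 * pi / 3 *
    (r ^ 5 * (1 + r\<^sup>2) powr (- (5 / 2)) / 5 - r ^ 7 * (1 + r\<^sup>2) powr (- (7 / 2)) / 7)"
  have "(\<integral>\<^sup>+x. ennreal ((1 + (norm (x::real^3))\<^sup>2) powr (- 7 / 2)) \<partial>lborel)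
      = (\<integral>\<^sup>+x. ennreal (0 - (\<lambda>r. - ((1 + r\<^sup>2) powr (- 7 / 2))) (norm (x::real^3))) \<partial>lborel)"
    by simp
  also have "\<dots> = (\<integral>\<^sup>+r. ennreal (7 * r * (1 + r\<^sup>2) powr (- 9 / 2)
      * (unit_ball_vol (DIM(real^3)) * r ^ DIM(real^3))) * indicator {0..} r \<partial>lborel)"
  proof (rule nn_integral_radial)
    show "((\<lambda>r::real. - ((1 + r\<^sup>2) powr (- 7 / 2))) \<longlongrightarrow> 0) at_top"
      by real_asymp
    show "((\<lambda>r. - ((1 + r\<^sup>2) powr (- 7 / 2))) has_real_derivative 7 * r * (1 + r\<^sup>2) powr (- 9 / 2))
        (at r)" for r
      using one_plus_square_pos[of r] by (auto intro!: derivative_eq_intros)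
  qed auto
  also have "\<dots> = (\<integral>\<^sup>+r. ennreal (28 * pi / 3 * (r ^ 4 * (1 + r\<^sup>2) powr (- 9 / 2)))
      * indicator {0..} r \<partial>lborel)"
    by (simp add: unit_ball_vol_3 eval_nat_numeral mult_ac)
  also have "\<dots> = ennreal (28 * pi / 3 * (1 / 5 - 1 / 7) - ?F 0)"
  proof (rule nn_integral_FTC_atLeast)
    show "(?F \<longlongrightarrow> 28 * pi / 3 * (1 / 5 - 1 / 7)) at_top"
    proof (intro tendsto_intros)
      show "((\<lambda>r::real. r ^ 5 * (1 + r\<^sup>2) powr (- (5 / 2))) \<longlongrightarrow> 1) at_top"
        "((\<lambda>r::real. r ^ 7 * (1 + r\<^sup>2) powr (- (7 / 2))) \<longlongrightarrow> 1) at_top"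
        by real_asymp+
    qed auto
    show "(?F has_real_derivative 28 * pi / 3 * (r ^ 4 * (1 + r\<^sup>2) powr (- 9 / 2))) (at r)" for r
      by (rule DERIV_cmult[OF DERIV_diff_power_mult_one_plus_square_powr])
  qed auto
  also have "28 * pi / 3 * (1 / 5 - 1 / 7) - ?F 0 = 8 * pi / 15"
    by simp
  finally show ?thesis .
qed

lemma integrable_one_plus_norm_square_powr_7_2:
  "integrable lborel (\<lambda>x::real^3. (1 + (norm x)\<^sup>2) powr (- 7 / 2))"
  by (rule integrableI_nonneg) (use nn_integral_one_plus_norm_square_powr_7_2 in auto)

lemma integral_one_plus_norm_square_powr_7_2:
  "(LINT x|lborel. (1 + (norm (x::real^3))\<^sup>2) powr (- 7 / 2)) = 8 * pi / 15"
  by (subst integral_eq_nn_integral) (use nn_integral_one_plus_norm_square_powr_7_2 in auto)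

section \<open>Integration by parts and the fundamental solution of the bilaplacian\<close>

lemma
  fixes f :: "'a::euclidean_space \<Rightarrow> real"
  shows integrable_translate: "integrable lborel f \<Longrightarrow> integrable lborel (\<lambda>x. f (a + x))"
    and integral_translate:
      "f \<in> borel_measurable borel \<Longrightarrow> (LINT x|lborel. f (a + x)) = (LINT x|lborel. f x)"
proof -
  assume f: "integrable lborel f"
  then have [measurable]: "f \<in> borel_measurable borel"
    using borel_measurable_integrable by simp
  have "integrable (distr lborel borel ((+) a)) f"
    unfolding lborel_distr_plus by (rule f)
  then show "integrable lborel (\<lambda>x. f (a + x))"
    by (subst (asm) integrable_distr_eq) auto
next
  assume [measurable]: "f \<in> borel_measurable borel"
  have "(LINT x|lborel. f x) = (LINT x|distr lborel borel ((+) a). f x)"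
    unfolding lborel_distr_plus ..
  also have "\<dots> = (LINT x|lborel. f (a + x))"
    by (subst integral_distr) auto
  finally show "(LINT x|lborel. f (a + x)) = (LINT x|lborel. f x)"
    by simp
qed

lemma integral_affine:
  fixes f :: "'a::euclidean_space \<Rightarrow> real"
  assumes [measurable]: "f \<in> borel_measurable borel" and c: "0 < c"
  shows "(LINT x|lborel. f x) = c ^ DIM('a) * (LINT z|lborel. f (t + c *\<^sub>R z))"
  using c by (subst lborel_affine[of c t]) (simp_all add: integral_density integral_distr)

lemma integrable_continuous_bounded_support:
  fixes u :: "'a::euclidean_space \<Rightarrow> real"
  assumes "continuous_on UNIV u" "\<And>x. norm x > B \<Longrightarrow> u x = 0"
  shows "integrable lborel u"
proof -
  have "integrable lborel (\<lambda>x. indicator (cball 0 B) x *\<^sub>R u x)"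
    by (rule borel_integrable_compact) (auto intro: continuous_on_subset[OF assms(1)])
  also have "(\<lambda>x. indicator (cball 0 B) x *\<^sub>R u x) = u"
    using assms(2) by (auto simp: indicator_def fun_eq_iff not_le)
  finally show ?thesis .
qed

lemma bounded_continuous_bounded_support:
  fixes u :: "'a::euclidean_space \<Rightarrow> real"
  assumes "continuous_on UNIV u" "\<And>x. norm x > B \<Longrightarrow> u x = 0"
  shows "\<exists>M. \<forall>x. \<bar>u x\<bar> \<le> M"
proof -
  have "bounded (u ` cball 0 B)"
    by (intro compact_imp_bounded compact_continuous_image continuous_on_subset[OF assms(1)]) auto
  then obtain M where "\<forall>x\<in>cball 0 B. \<bar>u x\<bar> \<le> M"
    unfolding bounded_iff by auto
  then have "\<bar>u x\<bar> \<le> max M 0" for x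
    using assms(2)[of x] by (cases "norm x \<le> B") (auto simp: le_max_iff_disj)
  then show ?thesis
    by blast
qed

definition C1_along ::
  "'a::real_normed_vector \<Rightarrow> ('a \<Rightarrow> real) \<Rightarrow> ('a \<Rightarrow> real) \<Rightarrow> bool" where
  "C1_along e u u' \<longleftrightarrow> continuous_on UNIV u \<and> continuous_on UNIV u' \<and>
     (\<forall>x. ((\<lambda>t. u (x + t *\<^sub>R e)) has_real_derivative u' x) (at 0))"

lemma C1_along_continuous:
  "C1_along e u u' \<Longrightarrow> continuous_on UNIV u" "C1_along e u u' \<Longrightarrow> continuous_on UNIV u'"
  unfolding C1_along_def by blast+

lemma C1_along_DERIV:
  assumes "C1_along e u u'"
  shows "((\<lambda>t. u (x + t *\<^sub>R e)) has_real_derivative u' (x + s *\<^sub>R e)) (at s)"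
proof -
  have "((\<lambda>t. u ((x + s *\<^sub>R e) + t *\<^sub>R e)) has_real_derivative u' (x + s *\<^sub>R e)) (at 0)"
    using assms unfolding C1_along_def by blast
  then have "((\<lambda>t. u (x + (t + s) *\<^sub>R e)) has_real_derivative u' (x + s *\<^sub>R e)) (at 0)"
    by (simp add: scaleR_add_left add_ac)
  then show ?thesis
    using DERIV_shift[of "\<lambda>t. u (x + t *\<^sub>R e)" _ 0 s] by simp
qed

lemma C1_along_mult:
  assumes "C1_along e u u'" "C1_along e w w'"
  shows "C1_along e (\<lambda>x. u x * w x) (\<lambda>x. u' x * w x + u x * w' x)"
  unfolding C1_along_def
proof (intro conjI allI)
  fix x
  show "((\<lambda>t. u (x + t *\<^sub>R e) * w (x + t *\<^sub>R e)) has_real_derivative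
      u' x * w x + u x * w' x) (at 0)"
    using DERIV_mult[OF C1_along_DERIV[OF assms(1), of x 0] C1_along_DERIV[OF assms(2), of x 0]]
    by (simp add: algebra_simps)
qed (use assms in \<open>auto simp: C1_along_def intro!: continuous_intros\<close>)

lemma C1_along_support:
  assumes u: "C1_along e u u'" and supp: "\<And>x. norm x > B \<Longrightarrow> u x = 0" and x: "norm x > B"
  shows "u' x = 0"
proof -
  have "((\<lambda>t. norm (x + t *\<^sub>R e)) \<longlongrightarrow> norm (x + 0 *\<^sub>R e)) (nhds 0)"
    by (intro tendsto_intros filterlim_ident)
  then have "\<forall>\<^sub>F t in nhds 0. norm (x + t *\<^sub>R e) > B"
    using x by (auto dest: order_tendstoD(1))
  then have "\<forall>\<^sub>F t in nhds 0. u (x + t *\<^sub>R e) = 0"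
    by eventually_elim (rule supp)
  moreover have "((\<lambda>t. u (x + t *\<^sub>R e)) has_real_derivative u' x) (at 0)"
    using u unfolding C1_along_def by blast
  ultimately have "((\<lambda>t. 0) has_real_derivative u' x) (at (0::real))"
    using DERIV_cong_ev[OF refl _ refl, of "\<lambda>t. u (x + t *\<^sub>R e)" "\<lambda>_. 0"] by blast
  then show ?thesis
    using DERIV_unique[OF _ DERIV_const] by blast
qed

lemma C1_along_increment_le:
  assumes u: "C1_along e u u'" and M: "\<And>x. \<bar>u' x\<bar> \<le> M" and h: "0 < h"
  shows "\<bar>u (x + h *\<^sub>R e) - u x\<bar> \<le> h * M"
proof -
  obtain z where "u (x + h *\<^sub>R e) - u (x + 0 *\<^sub>R e) = (h - 0) * u' (x + z *\<^sub>R e)"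
    using MVT2[OF h, of "\<lambda>t. u (x + t *\<^sub>R e)" "\<lambda>t. u' (x + t *\<^sub>R e)"] C1_along_DERIV[OF u]
    by blast
  then show ?thesis
    using M[of "x + z *\<^sub>R e"] h by (simp add: abs_mult)
qed

lemma C1_along_difference_quotient_le:
  fixes u :: "'a::real_normed_vector \<Rightarrow> real"
  assumes u: "C1_along e u u'" and supp: "\<And>x. norm x > B \<Longrightarrow> u x = 0"
    and M: "\<And>x. \<bar>u' x\<bar> \<le> M" and h: "0 < h" "h \<le> 1"
  shows "\<bar>(u (h *\<^sub>R e + x) - u x) / h\<bar> \<le> indicator (cball 0 (B + norm e)) x * M"
proof (cases "norm x \<le> B + norm e")
  case True
  then show ?thesis
    using C1_along_increment_le[OF u M h(1), of x] h(1)
    by (simp add: add.commute divide_le_eq mult.commute)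
next
  case False
  have "norm x - norm e \<le> norm x - h * norm e"
    using mult_right_mono[OF h(2) norm_ge_zero[of e]] by simp
  also have "\<dots> \<le> norm (h *\<^sub>R e + x)"
    using norm_triangle_ineq4[of "h *\<^sub>R e + x" "h *\<^sub>R e"] h(1) by simp
  finally have "B < norm (h *\<^sub>R e + x)" "B < norm x"
    using False norm_ge_zero[of e] by linarith+
  then show ?thesis
    using False supp by simp
qed

text \<open>By translation invariance the difference quotients of \<open>u\<close> integrate to zero.\<close>

lemma integral_C1_along_zero:
  fixes u :: "'a::euclidean_space \<Rightarrow> real"
  assumes u: "C1_along e u u'" and supp: "\<And>x. norm x > B \<Longrightarrow> u x = 0"
  shows "(LINT x|lborel. u' x) = 0"
proof -
  define h where "h n = 1 / real (Suc n)" for n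
  have h: "0 < h n" "h n \<le> 1" for n
    unfolding h_def by auto
  have "h \<longlonglongrightarrow> 0"
    unfolding h_def by (rule lim_1_over_n[THEN LIMSEQ_Suc])
  then have h0: "filterlim h (at 0) sequentially"
    using h by (auto simp: filterlim_at less_imp_neq[symmetric] intro!: always_eventually)
  note [measurable] = C1_along_continuous[OF u, THEN borel_measurable_continuous_onI]
  obtain M where M: "\<And>x. \<bar>u' x\<bar> \<le> M"
    using bounded_continuous_bounded_support[OF C1_along_continuous(2)[OF u], of B]
      C1_along_support[OF u supp] by blast
  define s where "s n x = (u (h n *\<^sub>R e + x) - u x) / h n" for n x
  have "integrable lborel u"
    by (rule integrable_continuous_bounded_support[OF C1_along_continuous(1)[OF u] supp])
  then have s0: "(LINT x|lborel. s n x) = 0" for n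
    unfolding s_def by (simp add: integrable_translate integral_translate)
  have "(\<lambda>n. LINT x|lborel. s n x) \<longlonglongrightarrow> (LINT x|lborel. u' x)"
  proof (rule integral_dominated_convergence)
    show "integrable lborel (\<lambda>x::'a. indicator (cball 0 (B + norm e)) x * M)"
      using borel_integrable_compact[of "cball 0 (B + norm e)" "\<lambda>_::'a. M"] by simp
    have "(\<lambda>n. s n x) \<longlonglongrightarrow> u' x" for x
    proof -
      have "((\<lambda>t. (u (x + t *\<^sub>R e) - u x) / t) \<longlongrightarrow> u' x) (at 0)"
        using u unfolding C1_along_def DERIV_def by simp
      then show ?thesis
        unfolding s_def using filterlim_compose[OF _ h0] by (force simp: add.commute)
    qed
    then show "AE x in lborel. (\<lambda>n. s n x) \<longlonglongrightarrow> u' x"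
      by blast
    show "AE x in lborel. norm (s n x) \<le> indicator (cball 0 (B + norm e)) x * M" for n
      unfolding s_def using C1_along_difference_quotient_le[OF u supp M h] by simp
  qed (auto simp: s_def[abs_def])
  then show ?thesis
    unfolding s0 using LIMSEQ_unique[OF tendsto_const] by metis
qed

lemma integral_by_parts_along:
  fixes u w :: "'a::euclidean_space \<Rightarrow> real"
  assumes u: "C1_along e u u'" and w: "C1_along e w w'"
    and supp: "\<And>x. norm x > B \<Longrightarrow> w x = 0"
  shows "(LINT x|lborel. u x * w' x) = - (LINT x|lborel. u' x * w x)"
proof -
  note supp' = C1_along_support[OF w supp]
  have "integrable lborel (\<lambda>x. u' x * w x)" "integrable lborel (\<lambda>x. u x * w' x)"
    using C1_along_continuous[OF u] C1_along_continuous[OF w] supp supp'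
    by (auto intro!: integrable_continuous_bounded_support[of _ B] continuous_intros)
  moreover have "(LINT x|lborel. u' x * w x + u x * w' x) = 0"
    by (rule integral_C1_along_zero[OF C1_along_mult[OF u w], of B]) (simp add: supp)
  ultimately show ?thesis
    by simp
qed

definition reg_sq_dist :: "real \<Rightarrow> 'a::real_inner \<Rightarrow> 'a \<Rightarrow> real" where
  "reg_sq_dist \<epsilon> y x = (norm (x - y))\<^sup>2 + \<epsilon>\<^sup>2"

lemma reg_sq_dist_pos: "\<epsilon> \<noteq> 0 \<Longrightarrow> 0 < reg_sq_dist \<epsilon> y x"
  unfolding reg_sq_dist_def by (simp add: add_nonneg_pos)

lemma continuous_on_reg_sq_dist_powr [continuous_intros]:
  "\<epsilon> \<noteq> 0 \<Longrightarrow> continuous_on S (\<lambda>x. reg_sq_dist \<epsilon> y x powr b)"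
  using reg_sq_dist_pos[of \<epsilon> y] unfolding reg_sq_dist_def
  by (intro continuous_intros ballI) (auto simp: less_le)

lemma reg_sq_dist_line:
  "reg_sq_dist \<epsilon> y (x + t *\<^sub>R e) = reg_sq_dist \<epsilon> y x + 2 * t * ((x - y) \<bullet> e) + t\<^sup>2 * (e \<bullet> e)"
  unfolding reg_sq_dist_def power2_norm_eq_inner
  by (simp add: inner_simps inner_commute power2_eq_square algebra_simps)

lemma C1_along_reg_sq_dist_powr:
  assumes "\<epsilon> \<noteq> 0"
  shows "C1_along e (\<lambda>x. reg_sq_dist \<epsilon> y x powr b)
    (\<lambda>x. 2 * b * (((x - y) \<bullet> e) * reg_sq_dist \<epsilon> y x powr (b - 1)))"
  unfolding C1_along_def
proof (intro conjI allI)
  fix x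
  show "((\<lambda>t. reg_sq_dist \<epsilon> y (x + t *\<^sub>R e) powr b) has_real_derivative
      2 * b * (((x - y) \<bullet> e) * reg_sq_dist \<epsilon> y x powr (b - 1))) (at 0)"
    unfolding reg_sq_dist_line using reg_sq_dist_pos[OF assms, of y x]
    by (auto intro!: derivative_eq_intros)
qed (use assms in \<open>auto intro!: continuous_intros\<close>)

lemma C1_along_inner_mult_reg_sq_dist_powr:
  assumes "\<epsilon> \<noteq> 0"
  shows "C1_along e (\<lambda>x. ((x - y) \<bullet> e) * reg_sq_dist \<epsilon> y x powr c)
    (\<lambda>x. (e \<bullet> e) * reg_sq_dist \<epsilon> y x powr c
      + 2 * c * (((x - y) \<bullet> e)\<^sup>2 * reg_sq_dist \<epsilon> y x powr (c - 1)))"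
  unfolding C1_along_def
proof (intro conjI allI)
  fix x
  have "(x + t *\<^sub>R e - y) \<bullet> e = (x - y) \<bullet> e + t * (e \<bullet> e)" for t
    by (simp add: inner_simps)
  then show "((\<lambda>t. ((x + t *\<^sub>R e - y) \<bullet> e) * reg_sq_dist \<epsilon> y (x + t *\<^sub>R e) powr c)
      has_real_derivative (e \<bullet> e) * reg_sq_dist \<epsilon> y x powr c
        + 2 * c * (((x - y) \<bullet> e)\<^sup>2 * reg_sq_dist \<epsilon> y x powr (c - 1))) (at 0)"
    unfolding reg_sq_dist_line using reg_sq_dist_pos[OF assms, of y x]
    by (auto intro!: derivative_eq_intros simp: power2_eq_square)
qed (use assms in \<open>auto intro!: continuous_intros\<close>)

lemma integral_reg_sq_dist_powr_second_derivative:
  fixes u :: "'a::euclidean_space \<Rightarrow> real"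
  assumes \<epsilon>: "\<epsilon> \<noteq> 0" and u: "C1_along e u u'" and u': "C1_along e u' u''"
    and supp: "\<And>x. norm x > B \<Longrightarrow> u x = 0"
  shows "(LINT x|lborel. reg_sq_dist \<epsilon> y x powr b * u'' x) =
    (LINT x|lborel. 2 * b * ((e \<bullet> e) * reg_sq_dist \<epsilon> y x powr (b - 1)
      + 2 * (b - 1) * (((x - y) \<bullet> e)\<^sup>2 * reg_sq_dist \<epsilon> y x powr (b - 2))) * u x)"
proof -
  let ?W = "reg_sq_dist \<epsilon> y"
  have "(LINT x|lborel. ?W x powr b * u'' x)
      = - (LINT x|lborel. 2 * b * (((x - y) \<bullet> e) * ?W x powr (b - 1)) * u' x)"
    by (rule integral_by_parts_along[OF C1_along_reg_sq_dist_powr[OF \<epsilon>] u'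
          C1_along_support[OF u supp]])
  also have "\<dots> = - (2 * b * (LINT x|lborel. (((x - y) \<bullet> e) * ?W x powr (b - 1)) * u' x))"
    by (simp only: mult.assoc integral_mult_right_zero)
  also have "(LINT x|lborel. (((x - y) \<bullet> e) * ?W x powr (b - 1)) * u' x)
      = - (LINT x|lborel. ((e \<bullet> e) * ?W x powr (b - 1)
          + 2 * (b - 1) * (((x - y) \<bullet> e)\<^sup>2 * ?W x powr (b - 1 - 1))) * u x)"
    by (rule integral_by_parts_along[OF C1_along_inner_mult_reg_sq_dist_powr[OF \<epsilon>] u supp])
  finally show ?thesis
    by (simp add: mult.assoc)
qed

lemma sum_square_eq_norm_square: "(\<Sum>i\<in>UNIV. (z $ i)\<^sup>2) = (norm (z::real^'n))\<^sup>2"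
  unfolding power2_norm_eq_inner by (simp add: inner_vec_def power2_eq_square)

lemma inner_eq_sum_nth: "(x::real^'n) \<bullet> y = (\<Sum>j\<in>UNIV. x $ j * y $ j)"
  by (simp add: inner_vec_def)

lemma sum_second_derivatives_reg_sq_dist_powr:
  fixes x y :: "real^'n"
  assumes "\<epsilon> \<noteq> 0"
  shows "(\<Sum>i\<in>UNIV. 2 * b * (reg_sq_dist \<epsilon> y x powr (b - 1)
      + 2 * (b - 1) * (((x - y) $ i)\<^sup>2 * reg_sq_dist \<epsilon> y x powr (b - 2))))
    = 2 * b * (2 * b + CARD('n) - 2) * reg_sq_dist \<epsilon> y x powr (b - 1)
      - 4 * b * (b - 1) * \<epsilon>\<^sup>2 * reg_sq_dist \<epsilon> y x powr (b - 2)"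
proof -
  let ?W = "reg_sq_dist \<epsilon> y x"
  define p where "p = ?W powr (b - 2)"
  have powr: "?W powr (b - 1) = p * ?W"
    using powr_add[of ?W "b - 2" 1] reg_sq_dist_pos[OF assms, of y x] unfolding p_def by simp
  have "(\<Sum>i\<in>UNIV. 2 * b * (p * ?W + 2 * (b - 1) * (((x - y) $ i)\<^sup>2 * p)))
      = 2 * b * (CARD('n) * (p * ?W) + 2 * (b - 1) * ((\<Sum>i\<in>UNIV. ((x - y) $ i)\<^sup>2) * p))"
    by (simp add: sum_distrib_left sum_distrib_right sum.distrib sum_subtractf algebra_simps)
  also have "(\<Sum>i\<in>UNIV. ((x - y) $ i)\<^sup>2) = ?W - \<epsilon>\<^sup>2"
    unfolding sum_square_eq_norm_square reg_sq_dist_def by simp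
  finally show ?thesis
    unfolding powr p_def[symmetric] by (simp add: algebra_simps)
qed

lemma integral_reg_sq_dist_powr_laplacian:
  fixes u :: "real^'n \<Rightarrow> real"
  assumes \<epsilon>: "\<epsilon> \<noteq> 0"
    and u: "\<And>i. C1_along (axis i 1) u (u' i)" and u': "\<And>i. C1_along (axis i 1) (u' i) (u'' i)"
    and supp: "\<And>x. norm x > B \<Longrightarrow> u x = 0"
  shows "(\<Sum>i\<in>UNIV. LINT x|lborel. reg_sq_dist \<epsilon> y x powr b * u'' i x) =
    2 * b * (2 * b + CARD('n) - 2) * (LINT x|lborel. reg_sq_dist \<epsilon> y x powr (b - 1) * u x)
    - 4 * b * (b - 1) * \<epsilon>\<^sup>2 * (LINT x|lborel. reg_sq_dist \<epsilon> y x powr (b - 2) * u x)"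
proof -
  let ?W = "reg_sq_dist \<epsilon> y"
  let ?f = "\<lambda>i x. 2 * b * (?W x powr (b - 1)
    + 2 * (b - 1) * (((x - y) $ i)\<^sup>2 * ?W x powr (b - 2))) * u x"
  have cont: "continuous_on UNIV u"
    by (rule C1_along_continuous(1)[OF u])
  have int: "integrable lborel (\<lambda>x. ?W x powr c * u x)" for c
    using cont \<epsilon> supp
    by (auto intro!: integrable_continuous_bounded_support[of _ B] continuous_intros)
  have int_f: "integrable lborel (?f i)" for i
    using cont \<epsilon> supp
    by (auto intro!: integrable_continuous_bounded_support[of _ B] continuous_intros)
  have "(\<Sum>i\<in>UNIV. LINT x|lborel. ?W x powr b * u'' i x) = (\<Sum>i\<in>UNIV. LINT x|lborel. ?f i x)"
    using integral_reg_sq_dist_powr_second_derivative[OF \<epsilon> u u' supp]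
    by (simp add: inner_axis)
  also have "\<dots> = (LINT x|lborel. (\<Sum>i\<in>UNIV. ?f i x))"
    by (subst Bochner_Integration.integral_sum) (use int_f in auto)
  also have "\<dots> = (LINT x|lborel. 2 * b * (2 * b + CARD('n) - 2) * (?W x powr (b - 1) * u x)
      - 4 * b * (b - 1) * \<epsilon>\<^sup>2 * (?W x powr (b - 2) * u x))"
    unfolding sum_distrib_right[symmetric] sum_second_derivatives_reg_sq_dist_powr[OF \<epsilon>]
    by (simp add: left_diff_distrib mult.assoc)
  also have "\<dots> = 2 * b * (2 * b + CARD('n) - 2) * (LINT x|lborel. ?W x powr (b - 1) * u x)
      - 4 * b * (b - 1) * \<epsilon>\<^sup>2 * (LINT x|lborel. ?W x powr (b - 2) * u x)"
    using int[of "b - 1"] int[of "b - 2"] by simp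
  finally show ?thesis .
qed

lemma integral_reg_sq_dist_powr_scale:
  fixes u :: "'a::euclidean_space \<Rightarrow> real"
  assumes \<epsilon>: "0 < \<epsilon>" and [measurable]: "u \<in> borel_measurable borel"
  shows "(LINT x|lborel. reg_sq_dist \<epsilon> y x powr b * u x)
    = \<epsilon> powr (2 * b + DIM('a)) * (LINT z|lborel. (1 + (norm z)\<^sup>2) powr b * u (y + \<epsilon> *\<^sub>R z))"
proof -
  have [measurable]: "(\<lambda>x. reg_sq_dist \<epsilon> y x powr b) \<in> borel_measurable borel"
    unfolding reg_sq_dist_def by measurable
  have scale: "reg_sq_dist \<epsilon> y (y + \<epsilon> *\<^sub>R z) powr b = \<epsilon> powr (2 * b) * (1 + (norm z)\<^sup>2) powr b"
    for z
  proof -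
    have "reg_sq_dist \<epsilon> y (y + \<epsilon> *\<^sub>R z) = \<epsilon> powr 2 * (1 + (norm z)\<^sup>2)"
      unfolding reg_sq_dist_def using \<epsilon> by (simp add: power_mult_distrib powr_numeral algebra_simps)
    then show ?thesis
      by (simp add: powr_mult powr_powr)
  qed
  have "(LINT x|lborel. reg_sq_dist \<epsilon> y x powr b * u x)
      = \<epsilon> ^ DIM('a) * (LINT z|lborel. \<epsilon> powr (2 * b) * ((1 + (norm z)\<^sup>2) powr b * u (y + \<epsilon> *\<^sub>R z)))"
    by (subst integral_affine[OF _ \<epsilon>, of _ y]) (simp_all add: scale mult.assoc)
  also have "\<dots> = (\<epsilon> ^ DIM('a) * \<epsilon> powr (2 * b))
      * (LINT z|lborel. (1 + (norm z)\<^sup>2) powr b * u (y + \<epsilon> *\<^sub>R z))"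
    by simp
  also have "\<epsilon> ^ DIM('a) * \<epsilon> powr (2 * b) = \<epsilon> powr (2 * b + DIM('a))"
    using \<epsilon> by (simp add: powr_add powr_realpow)
  finally show ?thesis .
qed

lemma integral_reg_sq_dist_powr_7_2:
  fixes u :: "real^3 \<Rightarrow> real"
  assumes \<epsilon>: "0 < \<epsilon>" and u: "u \<in> borel_measurable borel"
  shows "\<epsilon> ^ 4 * (LINT x|lborel. reg_sq_dist \<epsilon> y x powr (- 7 / 2) * u x)
    = (LINT z|lborel. (1 + (norm z)\<^sup>2) powr (- 7 / 2) * u (y + \<epsilon> *\<^sub>R z))"
proof -
  have "\<epsilon> ^ 4 * \<epsilon> powr (- 4) = 1"
    using \<epsilon> by (simp add: powr_minus powr_numeral)
  then show ?thesis
    unfolding integral_reg_sq_dist_powr_scale[OF \<epsilon> u] by (simp flip: mult.assoc)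
qed

lemma tendsto_integral_reg_sq_dist_sqrt:
  fixes f :: "'a::euclidean_space \<Rightarrow> real"
  assumes f: "continuous_on UNIV f" "\<And>x. norm x > B \<Longrightarrow> f x = 0"
    and h: "h \<longlonglongrightarrow> 0" "\<And>n. \<bar>h n\<bar> \<le> 1"
  shows "(\<lambda>n. LINT x|lborel. reg_sq_dist (h n) y x powr (1 / 2) * f x)
    \<longlonglongrightarrow> (LINT x|lborel. dist x y * f x)"
proof (rule integral_dominated_convergence)
  have sqrt: "reg_sq_dist (h n) y x powr (1 / 2) = sqrt ((norm (x - y))\<^sup>2 + (h n)\<^sup>2)" for n x
    unfolding reg_sq_dist_def by (simp add: powr_half_sqrt)
  note [measurable] = borel_measurable_continuous_onI[OF f(1)]
  show "integrable lborel (\<lambda>x. (dist x y + 1) * \<bar>f x\<bar>)"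
    using f by (auto intro!: integrable_continuous_bounded_support[of _ B] continuous_intros)
  have "(\<lambda>n. sqrt ((norm (x - y))\<^sup>2 + (h n)\<^sup>2) * f x) \<longlonglongrightarrow> sqrt ((norm (x - y))\<^sup>2 + 0\<^sup>2) * f x" for x
    by (intro tendsto_intros h)
  then show "AE x in lborel. (\<lambda>n. reg_sq_dist (h n) y x powr (1 / 2) * f x) \<longlonglongrightarrow> dist x y * f x"
    unfolding sqrt by (simp add: dist_norm)
  have "sqrt ((norm (x - y))\<^sup>2 + (h n)\<^sup>2) \<le> dist x y + 1" for n x
    using sqrt_sum_squares_le_sum_abs[of "norm (x - y)" "h n"] h(2)[of n] by (simp add: dist_norm)
  then show "AE x in lborel. norm (reg_sq_dist (h n) y x powr (1 / 2) * f x)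
      \<le> (dist x y + 1) * \<bar>f x\<bar>" for n
    unfolding sqrt by (simp add: abs_mult mult_right_mono)
  show "(\<lambda>x. reg_sq_dist (h n) y x powr (1 / 2) * f x) \<in> borel_measurable lborel" for n
    unfolding sqrt by measurable
  show "(\<lambda>x. dist x y * f x) \<in> borel_measurable lborel"
    by measurable
qed

lemma tendsto_integral_dilation:
  fixes k u :: "'a::euclidean_space \<Rightarrow> real"
  assumes k: "integrable lborel k" and u: "continuous_on UNIV u" "\<And>x. \<bar>u x\<bar> \<le> M"
    and h: "h \<longlonglongrightarrow> 0"
  shows "(\<lambda>n. LINT z|lborel. k z * u (y + h n *\<^sub>R z)) \<longlonglongrightarrow> (LINT z|lborel. k z * u y)"
proof (rule integral_dominated_convergence)
  note [measurable] = borel_measurable_continuous_onI[OF u(1)] borel_measurable_integrable[OF k]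
  show "integrable lborel (\<lambda>z. \<bar>k z\<bar> * M)"
    using k by simp
  have "(\<lambda>n. y + h n *\<^sub>R z) \<longlonglongrightarrow> y + 0 *\<^sub>R z" for z
    by (intro tendsto_intros h)
  then have "(\<lambda>n. k z * u (y + h n *\<^sub>R z)) \<longlonglongrightarrow> k z * u (y + 0 *\<^sub>R z)" for z
    by (intro tendsto_mult tendsto_const continuous_on_tendsto_compose[OF u(1)]) auto
  then show "AE z in lborel. (\<lambda>n. k z * u (y + h n *\<^sub>R z)) \<longlonglongrightarrow> k z * u y"
    by simp
  show "AE z in lborel. norm (k z * u (y + h n *\<^sub>R z)) \<le> \<bar>k z\<bar> * M" for n
    using u(2) by (auto simp: abs_mult intro!: mult_left_mono)
  show "(\<lambda>z. k z * u y) \<in> borel_measurable lborel"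
    and "(\<lambda>z. k z * u (y + h n *\<^sub>R z)) \<in> borel_measurable lborel" for n
    by measurable
qed

lemma test_fun_continuous: "test_fun \<psi> \<Longrightarrow> continuous_on UNIV \<psi>"
  unfolding test_fun_def iter_pd_def by (metis foldr_Nil id_apply)

lemma test_fun_C1_along:
  assumes "test_fun \<psi>"
  shows "C1_along (axis i 1) (iter_pd js \<psi>) (iter_pd (i # js) \<psi>)"
  unfolding C1_along_def
proof (intro conjI allI)
  fix x
  have "(\<lambda>t. iter_pd js \<psi> (x + t *\<^sub>R axis i 1)) differentiable at 0"
    using assms unfolding test_fun_def by blast
  then show "((\<lambda>t. iter_pd js \<psi> (x + t *\<^sub>R axis i 1)) has_real_derivative
      iter_pd (i # js) \<psi> x) (at 0)"
    by (simp add: iter_pd_def pd_def DERIV_deriv_iff_real_differentiable)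
qed (use assms in \<open>auto simp: test_fun_def\<close>)

lemma test_fun_support:
  assumes "test_fun \<psi>"
  shows "\<exists>B. \<forall>js x. norm x > B \<longrightarrow> iter_pd js \<psi> x = 0"
proof -
  obtain K where K: "compact K" "\<And>x. x \<notin> K \<Longrightarrow> \<psi> x = 0"
    using assms unfolding test_fun_def by blast
  obtain B where B: "\<And>x. x \<in> K \<Longrightarrow> norm x \<le> B"
    using compact_imp_bounded[OF K(1)] by (auto simp: bounded_iff)
  have "iter_pd js \<psi> x = 0" if "norm x > B" for js x
    using that
  proof (induction js arbitrary: x)
    case Nil
    then show ?case
      using K(2)[of x] B[of x] by (auto simp: iter_pd_def)
  next
    case (Cons i js)
    then show ?case
      using C1_along_support[OF test_fun_C1_along[OF assms]] by blast
  qed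
  then show ?thesis
    by blast
qed

lemma lap_lap_eq:
  assumes "test_fun \<psi>"
  shows "lap (lap \<psi>) = (\<lambda>x. \<Sum>i\<in>UNIV. \<Sum>j\<in>UNIV. iter_pd [i, i, j, j] \<psi> x)"
proof -
  have pd: "pd i (\<lambda>x. \<Sum>j\<in>UNIV. iter_pd (js j) \<psi> x) = (\<lambda>x. \<Sum>j\<in>UNIV. iter_pd (i # js j) \<psi> x)"
    for i and js :: "3 \<Rightarrow> 3 list"
  proof
    fix x
    have "((\<lambda>t. \<Sum>j\<in>UNIV. iter_pd (js j) \<psi> (x + t *\<^sub>R axis i 1)) has_real_derivative
        (\<Sum>j\<in>UNIV. iter_pd (i # js j) \<psi> x)) (at 0)"
      using test_fun_C1_along[OF assms] unfolding C1_along_def by (intro DERIV_sum) blast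
    then show "pd i (\<lambda>x. \<Sum>j\<in>UNIV. iter_pd (js j) \<psi> x) x = (\<Sum>j\<in>UNIV. iter_pd (i # js j) \<psi> x)"
      unfolding pd_def by (rule DERIV_imp_deriv)
  qed
  have "lap \<psi> = (\<lambda>x. \<Sum>j\<in>UNIV. iter_pd [j, j] \<psi> x)"
    unfolding lap_def iter_pd_def by simp
  then show ?thesis
    unfolding lap_def[of "lap \<psi>"] by (simp only: pd)
qed

lemma
  assumes "test_fun \<psi>"
  shows continuous_on_lap_lap: "continuous_on UNIV (lap (lap \<psi>))"
    and lap_lap_support: "\<exists>B. \<forall>x. norm x > B \<longrightarrow> lap (lap \<psi>) x = 0"
    and integral_lap_lap: "(LINT x|lborel. lap (lap \<psi>) x) = 0"
proof -
  obtain B where B: "\<And>js x. norm x > B \<Longrightarrow> iter_pd js \<psi> x = 0"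
    using test_fun_support[OF assms] by blast
  have cont: "continuous_on UNIV (iter_pd js \<psi>)" for js
    using assms unfolding test_fun_def by blast
  show "continuous_on UNIV (lap (lap \<psi>))"
    unfolding lap_lap_eq[OF assms] by (intro continuous_intros cont)
  show "\<exists>B. \<forall>x. norm x > B \<longrightarrow> lap (lap \<psi>) x = 0"
    unfolding lap_lap_eq[OF assms] by (intro exI[of _ B]) (simp add: B)
  have "(LINT x|lborel. iter_pd [i, i, j, j] \<psi> x) = 0" for i j
    by (rule integral_C1_along_zero[OF test_fun_C1_along[OF assms] B])
  moreover have "integrable lborel (iter_pd js \<psi>)" for js
    by (rule integrable_continuous_bounded_support[OF cont B])
  ultimately show "(LINT x|lborel. lap (lap \<psi>) x) = 0"
    unfolding lap_lap_eq[OF assms] by (simp add: Bochner_Integration.integral_sum)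
qed

text \<open>With \<open>W\<close> the regularised square distance, \<open>\<Delta>\<^sup>2 W powr (1/2) = - 15 * \<epsilon> ^ 4 * W powr (- 7/2)\<close>.\<close>

lemma integral_reg_sq_dist_sqrt_lap_lap:
  assumes \<psi>: "test_fun \<psi>" and \<epsilon>: "0 < \<epsilon>"
  shows "(LINT x|lborel. reg_sq_dist \<epsilon> y x powr (1 / 2) * lap (lap \<psi>) x)
    = - 15 * (LINT z|lborel. (1 + (norm z)\<^sup>2) powr (- 7 / 2) * \<psi> (y + \<epsilon> *\<^sub>R z))"
proof -
  define I where "I b js = (LINT x|lborel. reg_sq_dist \<epsilon> y x powr b * iter_pd js \<psi> x)" for b js
  obtain B where B: "\<And>js x. norm x > B \<Longrightarrow> iter_pd js \<psi> x = 0"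
    using test_fun_support[OF \<psi>] by blast
  have "continuous_on UNIV (iter_pd js \<psi>)" for js
    using \<psi> unfolding test_fun_def by blast
  then have int: "integrable lborel (\<lambda>x. reg_sq_dist \<epsilon> y x powr b * iter_pd js \<psi> x)" for b js
    using \<epsilon> B by (auto intro!: integrable_continuous_bounded_support[of _ B] continuous_intros)
  have laplacian: "(\<Sum>i\<in>UNIV. I b (i # i # js)) = 2 * b * (2 * b + 1) * I (b - 1) js
      - 4 * b * (b - 1) * \<epsilon>\<^sup>2 * I (b - 2) js" for b js
    using integral_reg_sq_dist_powr_laplacian[of \<epsilon> "iter_pd js \<psi>", OF _ test_fun_C1_along[OF \<psi>]
        test_fun_C1_along[OF \<psi>] B] \<epsilon> unfolding I_def by simp
  have "(LINT x|lborel. reg_sq_dist \<epsilon> y x powr (1/2) * lap (lap \<psi>) x)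
      = (\<Sum>i\<in>UNIV. \<Sum>j\<in>UNIV. I (1/2) [i, i, j, j])"
    unfolding lap_lap_eq[OF \<psi>] I_def using int
    by (simp add: sum_distrib_left Bochner_Integration.integral_sum)
  also have "\<dots> = (\<Sum>j\<in>UNIV. \<Sum>i\<in>UNIV. I (1/2) [i, i, j, j])"
    by (rule sum.swap)
  also have "\<dots> = 2 * (\<Sum>j\<in>UNIV. I (-1/2) [j, j]) + \<epsilon>\<^sup>2 * (\<Sum>j\<in>UNIV. I (-3/2) [j, j])"
    using laplacian[of "1/2"] by (simp add: sum.distrib flip: sum_distrib_left)
  also have "\<dots> = 2 * (- 3 * \<epsilon>\<^sup>2 * I (-5/2) [])
      + \<epsilon>\<^sup>2 * (6 * I (-5/2) [] - 15 * \<epsilon>\<^sup>2 * I (-7/2) [])"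
    using laplacian[of "-1/2" "[]"] laplacian[of "-3/2" "[]"]
    by (simp only: minus_divide_left) simp
  also have "\<dots> = - 15 * (\<epsilon> ^ 4 * I (-7/2) [])"
    by (simp add: algebra_simps)
  also have "\<epsilon> ^ 4 * I (-7/2) []
      = (LINT z|lborel. (1 + (norm z)\<^sup>2) powr (- 7 / 2) * \<psi> (y + \<epsilon> *\<^sub>R z))"
    unfolding I_def iter_pd_def
    using integral_reg_sq_dist_powr_7_2[OF \<epsilon>]
      borel_measurable_continuous_onI[OF test_fun_continuous[OF \<psi>]] by simp
  finally show ?thesis .
qed

theorem bilaplacian_fundamental_solution:
  assumes \<psi>: "test_fun \<psi>"
  shows "(LINT x|lborel. dist x y * lap (lap \<psi>) x) = - 8 * pi * \<psi> y"
proof -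
  define h where "h n = 1 / real (Suc n)" for n
  have h: "0 < h n" "\<bar>h n\<bar> \<le> 1" for n
    unfolding h_def by auto
  have h0: "h \<longlonglongrightarrow> 0"
    unfolding h_def by (rule lim_1_over_n[THEN LIMSEQ_Suc])
  let ?k = "\<lambda>z::real^3. (1 + (norm z)\<^sup>2) powr (- 7 / 2)"
  obtain B where "\<And>x. norm x > B \<Longrightarrow> lap (lap \<psi>) x = 0"
    using lap_lap_support[OF \<psi>] by blast
  then have "(\<lambda>n. LINT x|lborel. reg_sq_dist (h n) y x powr (1 / 2) * lap (lap \<psi>) x)
      \<longlonglongrightarrow> (LINT x|lborel. dist x y * lap (lap \<psi>) x)"
    by (rule tendsto_integral_reg_sq_dist_sqrt[OF continuous_on_lap_lap[OF \<psi>] _ h0 h(2)])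
  moreover
  obtain B' where "\<And>x. norm x > B' \<Longrightarrow> iter_pd [] \<psi> x = 0"
    using test_fun_support[OF \<psi>] by blast
  then obtain M where "\<And>x. \<bar>\<psi> x\<bar> \<le> M"
    using bounded_continuous_bounded_support[OF test_fun_continuous[OF \<psi>], of B']
    by (auto simp: iter_pd_def)
  then have "(\<lambda>n. LINT z|lborel. ?k z * \<psi> (y + h n *\<^sub>R z)) \<longlonglongrightarrow> (LINT z|lborel. ?k z * \<psi> y)"
    by (rule tendsto_integral_dilation[OF integrable_one_plus_norm_square_powr_7_2
          test_fun_continuous[OF \<psi>] _ h0])
  then have "(\<lambda>n. - 15 * (LINT z|lborel. ?k z * \<psi> (y + h n *\<^sub>R z)))
      \<longlonglongrightarrow> - 15 * (LINT z|lborel. ?k z * \<psi> y)"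
    by (intro tendsto_intros)
  ultimately have "(LINT x|lborel. dist x y * lap (lap \<psi>) x) = - 15 * (LINT z|lborel. ?k z * \<psi> y)"
    unfolding integral_reg_sq_dist_sqrt_lap_lap[OF \<psi> h(1)] by (rule LIMSEQ_unique)
  also have "\<dots> = - 8 * pi * \<psi> y"
    using integral_one_plus_norm_square_powr_7_2 by simp
  finally show ?thesis .
qed

section \<open>Weighted spaces and asymptotic expansions\<close>

lemma dist_square_expand:
  fixes x y :: "'a::real_inner"
  shows "(dist x y)\<^sup>2 = (norm x)\<^sup>2 + (norm y)\<^sup>2 - 2 * (x \<bullet> y)"
  unfolding dist_norm power2_norm_eq_inner by (simp add: inner_simps inner_commute)

lemma dist_first_order: "\<bar>dist x y - norm x\<bar> \<le> norm (y::'a::real_normed_vector)"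
  using norm_triangle_ineq3[of x "x - y"] by (simp add: dist_norm abs_minus_commute)

lemma dist_second_order_remainder:
  fixes x y :: "'a::real_inner"
  assumes "x \<noteq> 0"
  shows "dist x y - (norm x - (x \<bullet> y) / norm x)
    = ((norm y)\<^sup>2 - (dist x y - norm x)\<^sup>2) / (2 * norm x)"
proof -
  have "x \<bullet> y = ((norm x)\<^sup>2 + (norm y)\<^sup>2 - (dist x y)\<^sup>2) / 2"
    using dist_square_expand[of x y] by simp
  then show ?thesis
    using assms by (simp only:) (simp add: field_simps power2_eq_square)
qed

lemma dist_second_order:
  fixes x y :: "'a::real_inner"
  assumes "x \<noteq> 0"
  shows "\<bar>dist x y - (norm x - (x \<bullet> y) / norm x)\<bar> \<le> (norm y)\<^sup>2 / (2 * norm x)"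
proof -
  have "(dist x y - norm x)\<^sup>2 \<le> (norm y)\<^sup>2"
    using dist_first_order[of x y] by (simp add: power2_le_iff_abs_le)
  then have "\<bar>(norm y)\<^sup>2 - (dist x y - norm x)\<^sup>2\<bar> \<le> (norm y)\<^sup>2"
    using zero_le_power2[of "dist x y - norm x"] by linarith
  then show ?thesis
    unfolding dist_second_order_remainder[OF assms] by (simp add: abs_divide divide_right_mono)
qed

lemma dist_third_order:
  fixes x y :: "'a::real_inner"
  assumes "x \<noteq> 0"
  shows "\<bar>dist x y - (norm x - (x \<bullet> y) / norm x
      + ((norm y)\<^sup>2 - (x \<bullet> y)\<^sup>2 / (norm x)\<^sup>2) / (2 * norm x))\<bar> \<le> norm y ^ 3 / (2 * (norm x)\<^sup>2)"
proof -
  define a where "a = norm x"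
  define d where "d = dist x y - a"
  define q where "q = (x \<bullet> y) / a"
  have a: "a > 0"
    using assms unfolding a_def by simp
  have q: "\<bar>q\<bar> \<le> norm y"
    using Cauchy_Schwarz_ineq2[of x y] a unfolding q_def a_def by (simp add: abs_divide field_simps)
  have d: "\<bar>d\<bar> \<le> norm y"
    using dist_first_order[of x y] unfolding d_def a_def by simp
  have dq: "\<bar>d + q\<bar> \<le> (norm y)\<^sup>2 / (2 * a)"
    using dist_second_order[OF assms, of y] unfolding d_def q_def a_def by (simp add: algebra_simps)
  have "d + q = ((norm y)\<^sup>2 - d\<^sup>2) / (2 * a)"
    using dist_second_order_remainder[OF assms, of y] unfolding d_def q_def a_def
    by (simp add: algebra_simps)
  then have "d + q - ((norm y)\<^sup>2 - q\<^sup>2) / (2 * a)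
      = ((norm y)\<^sup>2 - d\<^sup>2) / (2 * a) - ((norm y)\<^sup>2 - q\<^sup>2) / (2 * a)"
    by (simp only:)
  also have "\<dots> = (d + q) * (q - d) / (2 * a)"
    by (simp add: diff_divide_distrib[symmetric] power2_eq_square algebra_simps)
  finally have "\<bar>d + q - ((norm y)\<^sup>2 - q\<^sup>2) / (2 * a)\<bar> = \<bar>d + q\<bar> * \<bar>q - d\<bar> / (2 * a)"
    using a by (simp add: abs_mult abs_divide)
  also have "\<dots> \<le> ((norm y)\<^sup>2 / (2 * a)) * (2 * norm y) / (2 * a)"
    using dq d q a by (intro divide_right_mono mult_mono) auto
  also have "\<dots> = norm y ^ 3 / (2 * a\<^sup>2)"
    using a by (simp add: field_simps power2_eq_square power3_eq_cube)
  finally show ?thesis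
    unfolding d_def q_def a_def by (simp add: power_divide algebra_simps)
qed

lemma powr_square: "(a powr p)\<^sup>2 = a powr (2 * p)" for a :: real
  by (simp add: power2_eq_square powr_add[symmetric])

lemma one_plus_square_powr_ge:
  fixes a s :: real
  assumes "0 \<le> a" "0 \<le> s"
  shows "(1 + a) powr (- s) \<le> (1 + a\<^sup>2) powr (- s / 2)"
proof -
  have "(1 + a) powr (- s) = ((1 + a)\<^sup>2) powr (- s / 2)"
    using assms(1) powr_powr[of "1 + a" 2 "- s / 2"] by (simp add: powr_numeral)
  also have "\<dots> \<le> (1 + a\<^sup>2) powr (- s / 2)"
    using assms one_plus_square_pos[of a] by (intro powr_mono2') (auto simp: power2_sum)
  finally show ?thesis .
qed

lemma one_plus_square_powr_le:
  fixes a s :: real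
  assumes "0 \<le> a" "0 \<le> s"
  shows "(1 + a\<^sup>2) powr (- s / 2) \<le> 2 powr (s / 2) * (1 + a) powr (- s)"
proof -
  have "(1 + a)\<^sup>2 / 2 \<le> 1 + a\<^sup>2"
    using sum_squares_bound[of 1 a] by (simp add: power2_sum)
  then have "(1 + a\<^sup>2) powr (- s / 2) \<le> ((1 + a)\<^sup>2 / 2) powr (- s / 2)"
    using assms by (intro powr_mono2') auto
  also have "\<dots> = 2 powr (s / 2) * ((1 + a)\<^sup>2) powr (- s / 2)"
    by (simp add: powr_divide powr_minus_divide)
  also have "((1 + a)\<^sup>2) powr (- s / 2) = (1 + a) powr (- s)"
    using assms(1) powr_powr[of "1 + a" 2 "- s / 2"] by (simp add: powr_numeral)
  finally show ?thesis .
qed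

lemma wL2_0_iff: "wL2 0 f \<longleftrightarrow> sq_int f"
  unfolding wL2_def using one_plus_square_pos by (simp add: less_imp_neq[symmetric])

lemma wL2_aeq:
  assumes "wL2 s f" "aeq f g" and [measurable]: "g \<in> borel_measurable borel"
  shows "wL2 s g"
  unfolding wL2_def
  by (rule sq_int_aeq[OF assms(1)[unfolded wL2_def]])
    (use assms(2) in \<open>auto simp: aeq_def elim: AE_mp\<close>)

definition aeq_closed :: "fn set \<Rightarrow> bool" where
  "aeq_closed X \<longleftrightarrow> (\<forall>f\<in>X. \<forall>g. aeq f g \<longrightarrow> g \<in> borel_measurable borel \<longrightarrow> g \<in> X)"

lemma aeq_closed_sq_int: "aeq_closed {f. sq_int f}"
  unfolding aeq_closed_def using sq_int_aeq by blast

lemma aeq_closed_Wsp: "aeq_closed (Wsp \<sigma>)"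
  unfolding aeq_closed_def Wsp_def using wL2_aeq by blast

lemma wL2_if_norm_le_powr:
  assumes [measurable]: "\<phi> \<in> borel_measurable borel"
    and bound: "\<And>x. cmod (\<phi> x) \<le> C * (1 + norm x) powr (- k)"
    and s: "0 \<le> s" "3 / 2 - k < s"
  shows "wL2 s \<phi>"
  unfolding wL2_def
proof (rule sq_intI_AE_bound)
  show "integrable lborel
      (\<lambda>x::real^3. (2 powr (s / 2) * C)\<^sup>2 * (1 + norm x) powr (- (2 * (s + k))))"
    by (intro integrable_mult_right integrable_one_plus_norm_powr) (use s in auto)
  have "cmod (complex_of_real ((1 + (norm x)\<^sup>2) powr (- s / 2)) * \<phi> x)
      \<le> 2 powr (s / 2) * C * (1 + norm x) powr (- (s + k))" for x
  proof -
    have "cmod (complex_of_real ((1 + (norm x)\<^sup>2) powr (- s / 2)) * \<phi> x)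
        \<le> (2 powr (s / 2) * (1 + norm x) powr (- s)) * (C * (1 + norm x) powr (- k))"
      unfolding norm_mult using one_plus_square_powr_le[OF norm_ge_zero s(1), of x] bound[of x]
      by (intro mult_mono) auto
    then show ?thesis
      using powr_add[of "1 + norm x" "- s" "- k"] by (simp add: mult_ac)
  qed
  then have "(cmod (complex_of_real ((1 + (norm x)\<^sup>2) powr (- s / 2)) * \<phi> x))\<^sup>2
      \<le> (2 powr (s / 2) * C * (1 + norm x) powr (- (s + k)))\<^sup>2" for x
    by (intro power_mono) auto
  then show "AE x in lborel. (cmod (complex_of_real ((1 + (norm x)\<^sup>2) powr (- s / 2)) * \<phi> x))\<^sup>2
      \<le> (2 powr (s / 2) * C)\<^sup>2 * (1 + norm x) powr (- (2 * (s + k)))"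
    by (intro AE_I2) (simp add: power_mult_distrib powr_square)
qed measurable

lemma powr_ge_if_comparable:
  fixes a R q :: real
  assumes "0 < R" "R / 2 \<le> a" "a \<le> 2 * R"
  shows "2 powr (- \<bar>q\<bar>) * R powr q \<le> a powr q"
proof (cases "0 \<le> q")
  case True
  have "2 powr (- \<bar>q\<bar>) * R powr q = (R / 2) powr q"
    using True assms(1) by (simp add: powr_divide powr_minus_divide)
  also have "\<dots> \<le> a powr q"
    using True assms by (intro powr_mono2) auto
  finally show ?thesis .
next
  case False
  have "2 powr (- \<bar>q\<bar>) * R powr q = (2 * R) powr q"
    using False assms(1) by (simp add: powr_mult)
  also have "\<dots> \<le> a powr q"
    using False assms by (intro powr_mono2') auto
  finally show ?thesis .
qed

lemma ball_near_ray:
  fixes e :: "'a::real_normed_vector"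
  assumes e: "norm e = 1" and R: "0 < R" and \<delta>: "\<delta> \<le> 1 / 2" and x: "x \<in> ball (R *\<^sub>R e) (\<delta> * R)"
  shows "R / 2 \<le> norm x" "norm x \<le> 2 * R" "dist ((1 / R) *\<^sub>R x) e < \<delta>"
proof -
  have dx: "norm (x - R *\<^sub>R e) < \<delta> * R"
    using x by (simp add: dist_norm norm_minus_commute)
  have "(1 / R) *\<^sub>R x - e = (1 / R) *\<^sub>R (x - R *\<^sub>R e)"
    using R by (simp add: scaleR_diff_right)
  then show "dist ((1 / R) *\<^sub>R x) e < \<delta>"
    using dx R by (simp add: dist_norm divide_less_eq)
  have "norm (x - R *\<^sub>R e) \<le> R / 2"
    using dx mult_right_mono[OF \<delta>, of R] R by linarith
  then show "R / 2 \<le> norm x" "norm x \<le> 2 * R"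
    using norm_triangle_sub[of "R *\<^sub>R e" x] norm_triangle_sub[of x "R *\<^sub>R e"] e R
    by (auto simp: norm_minus_commute)
qed

lemma norm_ge_powr_if_leading_term:
  fixes w z :: "'b::real_normed_vector"
  assumes a: "0 < a" and lead: "norm (w - (a powr k) *\<^sub>R z) \<le> C * a powr (k - 1)"
    and c: "c \<le> norm z" "2 * C \<le> a * c"
  shows "c / 2 * a powr k \<le> norm w"
proof -
  have "a powr k * c \<le> norm ((a powr k) *\<^sub>R z)"
    using c(1) by (simp add: mult_left_mono)
  also have "\<dots> \<le> norm w + C * a powr (k - 1)"
    using lead norm_triangle_sub[of "(a powr k) *\<^sub>R z" w] by (simp add: norm_minus_commute)
  also have "C * a powr (k - 1) = a powr k * (C / a)"
    using a by (simp add: powr_diff)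
  also have "\<dots> \<le> a powr k * (c / 2)"
    using c(2) a by (intro mult_left_mono) (auto simp: divide_le_eq algebra_simps)
  finally show ?thesis
    by (simp add: algebra_simps)
qed

lemma norm_ge_powr_near_ray:
  fixes \<phi> L :: "'a::real_normed_vector \<Rightarrow> 'b::real_normed_algebra_1"
  assumes cont: "isCont L e" and e: "norm e = 1" "L e \<noteq> 0"
    and hom: "\<And>t x. 0 < t \<Longrightarrow> L (t *\<^sub>R x) = L x"
    and lead: "\<And>x. 1 \<le> norm x \<Longrightarrow>
      norm (\<phi> x - (norm x powr k) *\<^sub>R L x) \<le> C * norm x powr (k - 1)"
  shows "\<exists>\<delta>>0. \<exists>c>0. \<exists>R\<^sub>0\<ge>2. \<forall>R\<ge>R\<^sub>0. \<forall>x\<in>ball (R *\<^sub>R e) (\<delta> * R).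
    R / 2 \<le> norm x \<and> norm x \<le> 2 * R \<and> c * norm x powr k \<le> norm (\<phi> x)"
proof -
  define c where "c = norm (L e) / 2"
  have c: "0 < c"
    unfolding c_def using e by simp
  obtain d where d: "0 < d" "\<And>x. dist x e < d \<Longrightarrow> dist (L x) (L e) < c"
    using cont c unfolding continuous_at_eps_delta by blast
  define \<delta> where "\<delta> = min d (1 / 2)"
  have \<delta>: "0 < \<delta>" "\<delta> \<le> 1 / 2" "\<delta> \<le> d"
    unfolding \<delta>_def using d by auto
  define R\<^sub>0 where "R\<^sub>0 = max 2 (4 * \<bar>C\<bar> / c)"
  have "R / 2 \<le> norm x \<and> norm x \<le> 2 * R \<and> c / 2 * norm x powr k \<le> norm (\<phi> x)"
    if R: "R \<ge> R\<^sub>0" and x: "x \<in> ball (R *\<^sub>R e) (\<delta> * R)" for R x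
  proof -
    have R2: "2 \<le> R" "0 < R"
      using R unfolding R\<^sub>0_def by auto
    note near = ball_near_ray[OF e(1) R2(2) \<delta>(2) x]
    have x1: "1 \<le> norm x" "0 < norm x"
      using near(1) R2 by auto
    have "dist (L x) (L e) < c"
      using d(2)[of "(1 / R) *\<^sub>R x"] hom[of "1 / R" x] near(3) R2 \<delta>(3) by simp
    then have "c \<le> norm (L x)"
      using norm_triangle_sub[of "L e" "L x"] unfolding c_def
      by (simp add: dist_norm norm_minus_commute)
    moreover have "4 * \<bar>C\<bar> \<le> R * c"
      using R c unfolding R\<^sub>0_def by (simp add: divide_le_eq)
    moreover have "R * c \<le> 2 * norm x * c"
      using near c by simp
    ultimately have "c / 2 * norm x powr k \<le> norm (\<phi> x)"
      by (intro norm_ge_powr_if_leading_term[OF x1(2) lead[OF x1(1)]]) linarith+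
    then show ?thesis
      using near by blast
  qed
  moreover have "0 < c / 2" "2 \<le> R\<^sub>0"
    using c unfolding R\<^sub>0_def by auto
  ultimately show ?thesis
    using \<delta>(1) by blast
qed

lemma measure_ball_mult_le_integral:
  fixes h :: "'a::euclidean_space \<Rightarrow> real"
  assumes h: "integrable lborel h" "\<And>x. 0 \<le> h x" and c: "\<And>x. x \<in> ball a r \<Longrightarrow> c \<le> h x"
  shows "c * measure lborel (ball a r) \<le> (LINT x|lborel. h x)"
proof -
  have "c * measure lborel (ball a r) = (LINT x|lborel. indicator (ball a r) x * c)"
    by simp
  also have "\<dots> \<le> (LINT x|lborel. h x)"
  proof (rule integral_mono[OF _ h(1)])
    show "integrable lborel (\<lambda>x. indicator (ball a r) x * c)"
      by (intro integrable_mult_left integrable_real_indicator)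
        (auto intro: emeasure_bounded_finite[unfolded infinity_ennreal_def])
    show "indicator (ball a r) x * c \<le> h x" for x
      using c[of x] h(2)[of x] by (auto simp: indicator_def)
  qed
  finally show ?thesis .
qed

lemma integrable_imp_growth_on_balls_le:
  fixes h :: "'a::euclidean_space \<Rightarrow> real"
  assumes h: "integrable lborel h" "\<And>x. 0 \<le> h x" and b: "0 < b" "0 < \<delta>" "0 < R\<^sub>0"
    and ge: "\<And>R x. R\<^sub>0 \<le> R \<Longrightarrow> x \<in> ball (R *\<^sub>R e) (\<delta> * R) \<Longrightarrow> b * R powr p \<le> h x"
  shows "p + DIM('a) \<le> 0"
proof (rule ccontr)
  assume "\<not> p + DIM('a) \<le> 0"
  define B where "B = b * (unit_ball_vol (DIM('a)) * \<delta> ^ DIM('a))"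
  have "0 < B"
    unfolding B_def using b by simp
  have le: "B * R powr (p + DIM('a)) \<le> (LINT x|lborel. h x)" if R: "R\<^sub>0 \<le> R" for R
  proof -
    have "0 < R"
      using R b by simp
    then have "B * R powr (p + DIM('a)) = b * R powr p * measure lborel (ball (R *\<^sub>R e) (\<delta> * R))"
      using b unfolding B_def
      by (simp add: content_ball power_mult_distrib powr_add powr_realpow)
    also have "\<dots> \<le> (LINT x|lborel. h x)"
      by (rule measure_ball_mult_le_integral[OF h ge[OF R]])
    finally show ?thesis .
  qed
  have "filterlim (\<lambda>R. B * R powr (p + DIM('a))) at_top at_top"
    using \<open>0 < B\<close> \<open>\<not> p + DIM('a) \<le> 0\<close> by real_asymp
  then have "\<forall>\<^sub>F R in at_top. (LINT x|lborel. h x) < B * R powr (p + DIM('a))"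
    unfolding filterlim_at_top_dense by blast
  then have "\<forall>\<^sub>F R::real in at_top. False"
    using eventually_ge_at_top[of R\<^sub>0]
  proof eventually_elim
    case (elim R)
    then show False
      using le[of R] by linarith
  qed
  then show False
    by simp
qed

lemma weighted_powr_ge_if_comparable:
  fixes a R c y :: real
  assumes a: "1 \<le> a" "R / 2 \<le> a" "a \<le> 2 * R" and y: "c * a powr k \<le> y" and "0 \<le> c" "0 \<le> s"
  shows "c * 2 powr (- s) * 2 powr (- \<bar>k - s\<bar>) * R powr (k - s) \<le> (1 + a\<^sup>2) powr (- s / 2) * y"
proof -
  have "c * 2 powr (- s) * 2 powr (- \<bar>k - s\<bar>) * R powr (k - s)
      \<le> c * 2 powr (- s) * a powr (k - s)"
    using mult_left_mono[OF powr_ge_if_comparable[OF _ a(2,3), of "k - s"], of "c * 2 powr (- s)"]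
      assms by simp
  also have "\<dots> = (2 * a) powr (- s) * (c * a powr k)"
    by (simp add: powr_mult powr_diff powr_minus_divide)
  also have "\<dots> \<le> (1 + a) powr (- s) * y"
    using assms by (intro mult_mono powr_mono2') auto
  also have "\<dots> \<le> (1 + a\<^sup>2) powr (- s / 2) * y"
    using a y \<open>0 \<le> c\<close> \<open>0 \<le> s\<close>
    by (intro mult_right_mono one_plus_square_powr_ge order_trans[OF _ y]) auto
  finally show ?thesis .
qed

lemma wL2_leading_coefficient_zero:
  fixes L :: "real^3 \<Rightarrow> complex"
  assumes \<phi>: "wL2 s \<phi>" and s: "0 \<le> s" "s < k + 3 / 2"
    and cont: "continuous_on (UNIV - {0}) L"
    and hom: "\<And>t x. 0 < t \<Longrightarrow> L (t *\<^sub>R x) = L x"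
    and lead: "\<And>x. 1 \<le> norm x \<Longrightarrow>
      cmod (\<phi> x - complex_of_real (norm x powr k) * L x) \<le> C * norm x powr (k - 1)"
    and "x \<noteq> 0"
  shows "L x = 0"
proof (rule ccontr)
  assume "L x \<noteq> 0"
  define e where "e = (1 / norm x) *\<^sub>R x"
  have e: "norm e = 1" "L e \<noteq> 0"
    unfolding e_def using hom \<open>x \<noteq> 0\<close> \<open>L x \<noteq> 0\<close> by simp_all
  have "isCont L e"
    using cont e(1) by (subst (asm) continuous_on_eq_continuous_at) (auto intro: open_delete)
  then obtain \<delta> c R\<^sub>0 where pos: "0 < \<delta>" "0 < c" "2 \<le> R\<^sub>0"
    and near: "\<And>R x. R\<^sub>0 \<le> R \<Longrightarrow> x \<in> ball (R *\<^sub>R e) (\<delta> * R) \<Longrightarrow>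
      R / 2 \<le> norm x \<and> norm x \<le> 2 * R \<and> c * norm x powr k \<le> cmod (\<phi> x)"
    using norm_ge_powr_near_ray[where \<phi> = \<phi> and k = k and C = C, OF _ e hom] lead
    unfolding scaleR_conv_of_real by blast
  define h where "h x = (cmod (complex_of_real ((1 + (norm x)\<^sup>2) powr (- s / 2)) * \<phi> x))\<^sup>2" for x
  define b where "b = c * 2 powr (- s) * 2 powr (- \<bar>k - s\<bar>)"
  have low: "b\<^sup>2 * R powr (2 * (k - s)) \<le> h x"
    if R: "R\<^sub>0 \<le> R" and x: "x \<in> ball (R *\<^sub>R e) (\<delta> * R)" for R x
  proof -
    have "b * R powr (k - s) \<le> (1 + (norm x)\<^sup>2) powr (- s / 2) * cmod (\<phi> x)"
      unfolding b_def using near[OF R x] R pos s by (intro weighted_powr_ge_if_comparable) auto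
    then have "(b * R powr (k - s))\<^sup>2 \<le> h x"
      unfolding h_def norm_mult norm_of_real using pos by (intro power_mono) (auto simp: b_def)
    then show ?thesis
      by (simp only: power_mult_distrib powr_square)
  qed
  have "2 * (k - s) + DIM(real^3) \<le> 0"
  proof (rule integrable_imp_growth_on_balls_le[OF _ _ _ pos(1) _ low])
    show "integrable lborel h"
      unfolding h_def using \<phi>[unfolded wL2_def] by (rule sq_int_integrable)
    show "0 < b\<^sup>2"
      using pos unfolding b_def by simp
  qed (use pos in \<open>auto simp: h_def\<close>)
  then show False
    using s by simp
qed

section \<open>Moments of a density and integral operators with a weight\<close>

lemma (in pair_sigma_finite) integrable_if_norm_le_mult:
  fixes H :: "'a \<times> 'b \<Rightarrow> 'c::{banach, second_countable_topology}" and F G :: "_ \<Rightarrow> real"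
  assumes H: "H \<in> borel_measurable (M1 \<Otimes>\<^sub>M M2)"
    and F: "integrable M1 F" and G: "integrable M2 G"
    and bound: "\<And>x y. norm (H (x, y)) \<le> F x * G y"
  shows "integrable (M1 \<Otimes>\<^sub>M M2) H"
proof (rule Bochner_Integration.integrable_bound)
  note [measurable] = F[THEN borel_measurable_integrable] G[THEN borel_measurable_integrable]
  show "integrable (M1 \<Otimes>\<^sub>M M2) (\<lambda>(x, y). F x * G y)"
  proof (rule Fubini_integrable)
    show "(\<lambda>(x, y). F x * G y) \<in> borel_measurable (M1 \<Otimes>\<^sub>M M2)"
      by measurable
  qed (use F G in \<open>auto simp: abs_mult\<close>)
  show "AE z in M1 \<Otimes>\<^sub>M M2. norm (H z) \<le> norm (case z of (x, y) \<Rightarrow> F x * G y)"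
    using bound by (auto intro!: AE_I2 order_trans[OF bound])
qed (rule H)

definition quartic_growth :: "(real^3 \<Rightarrow> real) \<Rightarrow> bool" where
  "quartic_growth p \<longleftrightarrow>
     p \<in> borel_measurable borel \<and> (\<exists>c. \<forall>y. \<bar>p y\<bar> \<le> c * (1 + norm y) ^ 4)"

lemma norm_power_le_weight: "n \<le> m \<Longrightarrow> norm y ^ n \<le> (1 + norm y) ^ m"
  using power_mono[of "norm y" "1 + norm y" n] power_increasing[of n m "1 + norm y"]
  by (simp add: order_trans)

lemma quartic_growth_if_le_norm_power:
  assumes "p \<in> borel_measurable borel" "\<And>y. \<bar>p y\<bar> \<le> c * norm y ^ n" "n \<le> 4" "0 \<le> c"
  shows "quartic_growth p"
  unfolding quartic_growth_def
proof (intro conjI exI allI)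
  show "\<bar>p y\<bar> \<le> c * (1 + norm y) ^ 4" for y
    using order_trans[OF assms(2) mult_left_mono[OF norm_power_le_weight[OF assms(3)] assms(4)]] .
qed (rule assms(1))

lemma quartic_growth_const: "quartic_growth (\<lambda>_. c)"
  by (rule quartic_growth_if_le_norm_power[of _ "\<bar>c\<bar>" 0]) auto

lemma quartic_growth_norm_square: "quartic_growth (\<lambda>y. (norm y)\<^sup>2)"
  by (rule quartic_growth_if_le_norm_power[of _ 1 2]) auto

lemma quartic_growth_norm_power4: "quartic_growth (\<lambda>y. norm y ^ 4)"
  by (rule quartic_growth_if_le_norm_power[of _ 1 4]) auto

lemma quartic_growth_inner: "quartic_growth (\<lambda>y. x \<bullet> y)"
  by (rule quartic_growth_if_le_norm_power[of _ "norm x" 1]) (auto simp: Cauchy_Schwarz_ineq2)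

lemma quartic_growth_inner_square: "quartic_growth (\<lambda>y. (x \<bullet> y)\<^sup>2)"
proof (rule quartic_growth_if_le_norm_power[of _ "(norm x)\<^sup>2" 2])
  show "\<bar>(x \<bullet> y)\<^sup>2\<bar> \<le> (norm x)\<^sup>2 * (norm y)\<^sup>2" for y
    using power_mono[OF Cauchy_Schwarz_ineq2[of x y], of 2] by (simp add: power_mult_distrib)
qed auto

lemma quartic_growth_norm_square_inner: "quartic_growth (\<lambda>y. (norm y)\<^sup>2 * (x \<bullet> y))"
proof (rule quartic_growth_if_le_norm_power[of _ "norm x" 3])
  show "\<bar>(norm y)\<^sup>2 * (x \<bullet> y)\<bar> \<le> norm x * norm y ^ 3" for y
    using mult_left_mono[OF Cauchy_Schwarz_ineq2[of x y], of "(norm y)\<^sup>2"]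
    by (simp add: abs_mult power2_eq_square power3_eq_cube mult_ac)
qed auto

lemma quartic_growth_nth: "quartic_growth (\<lambda>y. y $ i)"
  using quartic_growth_inner[of "axis i 1"] by (simp add: inner_axis')

lemma quartic_growth_norm_square_nth: "quartic_growth (\<lambda>y. (norm y)\<^sup>2 * y $ i)"
  using quartic_growth_norm_square_inner[of "axis i 1"] by (simp add: inner_axis')

lemma quartic_growth_nth_mult_nth: "quartic_growth (\<lambda>y. y $ i * y $ j)"
proof (rule quartic_growth_if_le_norm_power[of _ 1 2])
  show "\<bar>y $ i * y $ j\<bar> \<le> 1 * (norm y)\<^sup>2" for y :: "real^3"
    using mult_mono[OF component_le_norm_cart[of y i] component_le_norm_cart[of y j]]
    by (simp add: abs_mult power2_eq_square)
qed auto

lemma quartic_growth_cmult: "quartic_growth p \<Longrightarrow> quartic_growth (\<lambda>y. c * p y)"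
  unfolding quartic_growth_def
proof (elim conjE exE, intro conjI)
  fix d assume d: "\<forall>y. \<bar>p y\<bar> \<le> d * (1 + norm y) ^ 4"
  have "\<bar>c * p y\<bar> \<le> (\<bar>c\<bar> * d) * (1 + norm y) ^ 4" for y
    using mult_left_mono[OF d[rule_format, of y], of "\<bar>c\<bar>"] by (simp add: abs_mult mult.assoc)
  then show "\<exists>d. \<forall>y. \<bar>c * p y\<bar> \<le> d * (1 + norm y) ^ 4"
    by blast
qed auto

lemma quartic_growth_add:
  "quartic_growth p \<Longrightarrow> quartic_growth q \<Longrightarrow> quartic_growth (\<lambda>y. p y + q y)"
  unfolding quartic_growth_def
proof (elim conjE exE, intro conjI)
  fix c d
  assume c: "\<forall>y. \<bar>p y\<bar> \<le> c * (1 + norm y) ^ 4" and d: "\<forall>y. \<bar>q y\<bar> \<le> d * (1 + norm y) ^ 4"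
  have "\<bar>p y + q y\<bar> \<le> (c + d) * (1 + norm y) ^ 4" for y
    using abs_triangle_ineq[of "p y" "q y"] c[rule_format, of y] d[rule_format, of y]
    by (simp add: distrib_right)
  then show "\<exists>c. \<forall>y. \<bar>p y + q y\<bar> \<le> c * (1 + norm y) ^ 4"
    by blast
qed auto

lemma quartic_growth_diff:
  "quartic_growth p \<Longrightarrow> quartic_growth q \<Longrightarrow> quartic_growth (\<lambda>y. p y - q y)"
  using quartic_growth_add[of p "\<lambda>y. (-1) * q y"] quartic_growth_cmult[of q "-1"] by simp

lemma quartic_growth_sum:
  "finite I \<Longrightarrow> (\<And>i. i \<in> I \<Longrightarrow> quartic_growth (p i)) \<Longrightarrow> quartic_growth (\<lambda>y. \<Sum>i\<in>I. p i y)"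
  by (induction I rule: finite_induct) (auto intro: quartic_growth_const quartic_growth_add)

lemmas quartic_growth_intros = quartic_growth_const quartic_growth_norm_square
  quartic_growth_norm_power4 quartic_growth_inner quartic_growth_inner_square
  quartic_growth_norm_square_inner quartic_growth_nth quartic_growth_norm_square_nth
  quartic_growth_nth_mult_nth quartic_growth_cmult quartic_growth_add quartic_growth_diff
  quartic_growth_sum

definition quartic_kernel :: "real \<Rightarrow> (real^3 \<Rightarrow> real^3 \<Rightarrow> real) \<Rightarrow> bool" where
  "quartic_kernel c K \<longleftrightarrow> (\<lambda>(x, y). K x y) \<in> borel_measurable (borel \<Otimes>\<^sub>M borel) \<and>
     (\<forall>x y. \<bar>K x y\<bar> \<le> c * (1 + norm x) ^ 4 * (1 + norm y) ^ 4)"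

lemma quartic_kernel_measurable:
  "quartic_kernel c K \<Longrightarrow> (\<lambda>(x, y). K x y) \<in> borel_measurable (borel \<Otimes>\<^sub>M borel)"
  unfolding quartic_kernel_def by blast

lemma quartic_kernel_bound:
  "quartic_kernel c K \<Longrightarrow> \<bar>K x y\<bar> \<le> c * (1 + norm x) ^ 4 * (1 + norm y) ^ 4"
  unfolding quartic_kernel_def by blast

lemma quartic_kernel_quartic_growth:
  assumes "quartic_kernel c K"
  shows "quartic_growth (K x)"
  unfolding quartic_growth_def
proof (intro conjI exI[of _ "c * (1 + norm x) ^ 4"] allI)
  show "K x \<in> borel_measurable borel"
    using measurable_compose[OF measurable_Pair1' quartic_kernel_measurable[OF assms], of x] by simp
qed (rule quartic_kernel_bound[OF assms])

lemma dist_power_le_weight: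
  assumes "n \<le> m"
  shows "dist x y ^ n \<le> (1 + norm x) ^ m * (1 + norm y) ^ m"
proof -
  have "dist x y \<le> norm x + norm y"
    using norm_triangle_ineq4[of x y] by (simp add: dist_norm)
  also have "\<dots> \<le> (1 + norm x) * (1 + norm y)"
    by (simp add: algebra_simps)
  finally have "dist x y ^ n \<le> ((1 + norm x) * (1 + norm y)) ^ n"
    by (intro power_mono) auto
  also have "\<dots> \<le> ((1 + norm x) * (1 + norm y)) ^ m"
    using assms mult_mono[of 1 "1 + norm x" 1 "1 + norm y"] by (intro power_increasing) auto
  finally show ?thesis
    by (simp add: power_mult_distrib)
qed

lemma quartic_kernel_dist_power:
  assumes "n \<le> 4"
  shows "quartic_kernel \<bar>a\<bar> (\<lambda>x y. a * dist x y ^ n)"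
  unfolding quartic_kernel_def
proof (intro conjI allI)
  show "\<bar>a * dist x y ^ n\<bar> \<le> \<bar>a\<bar> * (1 + norm x) ^ 4 * (1 + norm y) ^ 4" for x y :: "real^3"
    using mult_left_mono[OF dist_power_le_weight[OF assms, of x y], of "\<bar>a\<bar>"]
    by (simp add: abs_mult mult.assoc)
qed measurable

lemma quartic_kernel_G0k: "quartic_kernel (1 / (8 * pi)) G0k"
  using quartic_kernel_dist_power[of 1 "- 1 / (8 * pi)"] by (simp add: G0k_def[abs_def])

lemma quartic_kernel_G1k: "quartic_kernel 1 G1k"
  using quartic_kernel_dist_power[of 2 1] by (simp add: G1k_def[abs_def])

lemma quartic_kernel_G3k: "quartic_kernel 1 G3k"
  using quartic_kernel_dist_power[of 4 1] by (simp add: G3k_def[abs_def])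

lemma quartic_kernel_dist: "quartic_kernel 1 dist"
  using quartic_kernel_dist_power[of 1 1] by simp

lemma G0k_commute: "G0k x y = G0k y x"
  unfolding G0k_def by (simp add: dist_commute)

lemma G1k_commute: "G1k x y = G1k y x"
  unfolding G1k_def by (simp add: dist_commute)

lemma real_multiple_if_mult_cnj_ge:
  assumes mw: "m * cnj w = complex_of_real \<rho>" and \<rho>: "(cmod w)\<^sup>2 / n \<le> \<rho>" and n: "0 < n"
  shows "\<exists>t\<le>n. w = complex_of_real t * m"
proof (cases "w = 0")
  case True
  then show ?thesis
    using n by (intro exI[of _ 0]) simp
next
  case False
  then have "0 < (cmod w)\<^sup>2 / n"
    using n by simp
  then have "0 < \<rho>"
    using \<rho> by linarith
  have "complex_of_real ((cmod w)\<^sup>2) * m = complex_of_real \<rho> * w"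
    unfolding complex_norm_square mw[symmetric] by (simp add: mult_ac)
  then have "w = complex_of_real ((cmod w)\<^sup>2 / \<rho>) * m"
    using \<open>0 < \<rho>\<close> by (simp add: field_simps)
  moreover have "(cmod w)\<^sup>2 / \<rho> \<le> n"
    using \<rho> n \<open>0 < \<rho>\<close> by (simp add: field_simps)
  ultimately show ?thesis
    by blast
qed

locale decaying_potential =
  fixes V :: "real^3 \<Rightarrow> real" and \<beta> :: real
  assumes V_measurable: "V \<in> borel_measurable lborel"
    and V_decay: "\<exists>C. \<forall>x. \<bar>V x\<bar> \<le> C * (1 + norm x) powr (- \<beta>)"
    and V_nonzero: "L1norm V \<noteq> 0"
    and beta: "\<beta> > 11"
begin

abbreviation "v \<equiv> vfun V"
abbreviation "U \<equiv> sgnU V"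
abbreviation "vc \<equiv> \<lambda>x. complex_of_real (v x)"

lemma V_borel [measurable]: "V \<in> borel_measurable borel"
  using V_measurable by simp

lemma v_borel [measurable]: "v \<in> borel_measurable borel"
  unfolding vfun_def by measurable

lemma U_borel [measurable]: "U \<in> borel_measurable borel"
  unfolding sgnU_def by measurable

lemma v_nonneg [simp]: "0 \<le> v x"
  unfolding vfun_def by simp

lemma v_square: "(v x)\<^sup>2 = \<bar>V x\<bar>"
  unfolding vfun_def by simp

lemma U_mult_U [simp]: "complex_of_real (U x) * (complex_of_real (U x) * z) = z"
  unfolding sgnU_def by auto

lemma abs_U [simp]: "\<bar>U x\<bar> = 1"
  unfolding sgnU_def by auto

lemma V_eq: "V x = v x * (U x * v x)"
  using v_square[of x] unfolding sgnU_def
  by (auto simp: power2_eq_square abs_if split: if_splits)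

definition weight :: fn where
  "weight x = complex_of_real ((1 + norm x) ^ 4 * v x)"

lemma cmod_weight: "cmod (weight x) = (1 + norm x) ^ 4 * v x"
  unfolding weight_def norm_of_real by simp

lemma v_le_weight: "v x \<le> cmod (weight x)"
  using mult_right_mono[OF one_le_power[of "1 + norm x" 4] v_nonneg[of x]]
  by (simp add: cmod_weight)

lemma sq_int_weight: "sq_int weight"
proof -
  obtain C where C: "\<And>x. \<bar>V x\<bar> \<le> C * (1 + norm x) powr (- \<beta>)"
    using V_decay by blast
  have bound: "(cmod (weight x))\<^sup>2 \<le> C * (1 + norm x) powr (- (\<beta> - 8))" for x
  proof -
    have "(cmod (weight x))\<^sup>2 = (1 + norm x) ^ 8 * \<bar>V x\<bar>"
      unfolding cmod_weight power_mult_distrib v_square by (simp add: power_mult[symmetric])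
    also have "\<dots> \<le> (1 + norm x) ^ 8 * (C * (1 + norm x) powr (- \<beta>))"
      by (intro mult_left_mono C) auto
    also have "\<dots> = C * ((1 + norm x) powr 8 * (1 + norm x) powr (- \<beta>))"
      by (simp add: powr_numeral add_pos_nonneg)
    also have "\<dots> = C * (1 + norm x) powr (- (\<beta> - 8))"
      using powr_add[of "1 + norm x" 8 "- \<beta>"] by simp
    finally show ?thesis .
  qed
  have int: "integrable lborel (\<lambda>x::real^3. C * (1 + norm x) powr (- (\<beta> - 8)))"
    by (intro integrable_mult_right integrable_one_plus_norm_powr) (use beta in auto)
  have meas: "weight \<in> borel_measurable borel"
    unfolding weight_def[abs_def] by measurable
  show ?thesis
    by (rule sq_intI_AE_bound[OF meas int AE_I2[OF bound]])
qed

lemma sq_int_mult_v: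
  assumes "quartic_growth p"
  shows "sq_int (\<lambda>x. complex_of_real (p x * v x))"
proof -
  obtain c where c: "\<And>y. \<bar>p y\<bar> \<le> c * (1 + norm y) ^ 4"
    and [measurable]: "p \<in> borel_measurable borel"
    using assms unfolding quartic_growth_def by blast
  have "cmod (complex_of_real (p x * v x)) \<le> c * cmod (weight x)" for x
    using mult_right_mono[OF c[of x] v_nonneg[of x]]
    unfolding norm_of_real cmod_weight by (simp add: abs_mult mult.assoc)
  then show ?thesis
    by (intro sq_int_dominated[OF _ sq_int_weight]) measurable
qed

lemma L2norm_mult_v_le:
  assumes "quartic_growth p" and c: "\<And>y. \<bar>p y\<bar> \<le> c * (1 + norm y) ^ 4"
  shows "L2norm (\<lambda>x. complex_of_real (p x * v x)) \<le> c * L2norm weight"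
proof -
  have "0 \<le> c"
    using c[of 0] by simp
  have "L2norm (\<lambda>x. complex_of_real (p x * v x)) \<le> L2norm (\<lambda>x. complex_of_real c * weight x)"
  proof (intro L2norm_mono sq_int_mult_v sq_int_cmult sq_int_weight assms(1))
    show "cmod (complex_of_real (p x * v x)) \<le> cmod (complex_of_real c * weight x)" for x
      using mult_right_mono[OF c[of x] v_nonneg[of x]] \<open>0 \<le> c\<close>
      unfolding norm_mult norm_of_real cmod_weight by (simp add: abs_mult mult.assoc)
  qed
  then show ?thesis
    using \<open>0 \<le> c\<close> by (simp add: L2norm_cmult)
qed

lemma sq_int_vc: "sq_int vc"
  using sq_int_mult_v[OF quartic_growth_const[of 1]] by simp

lemma L1norm_eq: "L1norm V = (L2norm vc)\<^sup>2"
  unfolding L1norm_def L2norm_square by (simp add: v_square)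

lemma L1norm_pos: "0 < L1norm V"
  using V_nonzero L1norm_eq zero_le_power2[of "L2norm vc"] by linarith

lemma zero_if_aeq_vc_mult:
  assumes "aeq (\<lambda>x. vc x * c) (\<lambda>_. 0)"
  shows "c = 0"
proof (rule ccontr)
  assume "c \<noteq> 0"
  then have "AE x in lborel. \<bar>V x\<bar> = 0"
    using assms unfolding aeq_def by (auto simp: v_square[symmetric] elim: AE_mp)
  then have "L1norm V = 0"
    unfolding L1norm_def by (rule integral_eq_zero_AE)
  then show False
    using V_nonzero by simp
qed

definition moment :: "(real^3 \<Rightarrow> real) \<Rightarrow> fn \<Rightarrow> complex" where
  "moment p f = L2_inner (\<lambda>x. complex_of_real (p x * v x)) f"

lemma moment_eq_integral: "moment p f = (LINT y|lborel. complex_of_real (p y) * mult v f y)"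
  unfolding moment_def L2_inner_def mult_def by (simp add: mult.assoc)

lemma vpair_eq_moment: "vpair V f = moment (\<lambda>_. 1) f"
  unfolding vpair_def moment_def L2_inner_def by simp

lemma vpair_eq_L2_inner: "vpair V f = L2_inner vc f"
  unfolding vpair_eq_moment moment_def by simp

lemma intop_eq_moment: "intop K (mult v f) x = moment (K x) f"
  unfolding intop_def moment_eq_integral ..

lemma vGv_eq: "vGv K V f x = vc x * moment (K x) f"
  unfolding vGv_def mult_def[of v "intop K (mult v f)"] intop_eq_moment ..

lemma L2_inner_mult_v: "L2_inner f (\<lambda>x. complex_of_real (p x * v x)) = cnj (moment p f)"
  unfolding moment_def by (rule L2_inner_commute)

lemma moment_add:
  "quartic_growth p \<Longrightarrow> quartic_growth q \<Longrightarrow> sq_int f \<Longrightarrow>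
    moment (\<lambda>y. p y + q y) f = moment p f + moment q f"
  unfolding moment_def distrib_right of_real_add by (intro L2_inner_add_left sq_int_mult_v)

lemma moment_cmult: "moment (\<lambda>y. c * p y) f = complex_of_real c * moment p f"
  unfolding moment_def using L2_inner_cmult_left[of "complex_of_real c"] by (simp add: mult.assoc)

lemma moment_diff:
  "quartic_growth p \<Longrightarrow> quartic_growth q \<Longrightarrow> sq_int f \<Longrightarrow>
    moment (\<lambda>y. p y - q y) f = moment p f - moment q f"
  using moment_add[of p "\<lambda>y. (-1) * q y" f] moment_cmult[of "-1" q f]
    quartic_growth_cmult[of q "-1"] by simp

lemma moment_sum:
  "finite I \<Longrightarrow> (\<And>i. i \<in> I \<Longrightarrow> quartic_growth (p i)) \<Longrightarrow> sq_int f \<Longrightarrow>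
    moment (\<lambda>y. \<Sum>i\<in>I. p i y) f = (\<Sum>i\<in>I. moment (p i) f)"
proof (induction I rule: finite_induct)
  case empty
  then show ?case
    by (simp add: moment_eq_integral)
next
  case (insert j I)
  then show ?case
    using moment_add[of "p j" "\<lambda>y. \<Sum>i\<in>I. p i y" f] quartic_growth_sum[of I p] by simp
qed

lemma moment_density_add:
  "quartic_growth p \<Longrightarrow> sq_int f \<Longrightarrow> sq_int g \<Longrightarrow>
    moment p (\<lambda>x. f x + g x) = moment p f + moment p g"
  unfolding moment_def by (intro L2_inner_add_right sq_int_mult_v)

lemma moment_density_cmult: "moment p (\<lambda>x. c * f x) = c * moment p f"
  unfolding moment_def by (rule L2_inner_cmult_right)

lemma vpair_add: "sq_int f \<Longrightarrow> sq_int g \<Longrightarrow> vpair V (\<lambda>x. f x + g x) = vpair V f + vpair V g"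
  unfolding vpair_eq_moment by (rule moment_density_add[OF quartic_growth_const])

lemma vpair_cmult: "vpair V (\<lambda>x. c * f x) = c * vpair V f"
  unfolding vpair_eq_moment by (rule moment_density_cmult)

lemma moment_le_L2norm:
  assumes "quartic_growth p" "\<And>y. \<bar>p y\<bar> \<le> c * (1 + norm y) ^ 4" "sq_int f"
  shows "cmod (moment p f) \<le> c * (L2norm weight * L2norm f)"
proof -
  have "cmod (moment p f) \<le> L2norm (\<lambda>x. complex_of_real (p x * v x)) * L2norm f"
    unfolding moment_def by (intro L2_inner_le_L2norm sq_int_mult_v assms)
  also have "\<dots> \<le> c * L2norm weight * L2norm f"
    by (intro mult_right_mono L2norm_mult_v_le assms) simp
  finally show ?thesis
    by (simp add: mult.assoc)
qed

lemma borel_measurable_moment_kernel: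
  assumes "quartic_kernel c K" "sq_int f"
  shows "(\<lambda>x. moment (K x) f) \<in> borel_measurable borel"
proof -
  note [measurable] = quartic_kernel_measurable[OF assms(1)] sq_int_borel[OF assms(2)]
  have "(\<lambda>x. LINT y|lborel. complex_of_real (K x y) * mult v f y) \<in> borel_measurable lborel"
    unfolding mult_def by measurable
  then show ?thesis
    unfolding moment_eq_integral by simp
qed

lemma sq_int_vGv:
  assumes K: "quartic_kernel c K" and f: "sq_int f"
  shows "sq_int (vGv K V f)"
proof (rule sq_int_dominated[OF _ sq_int_weight])
  note [measurable] = borel_measurable_moment_kernel[OF assms]
  show "vGv K V f \<in> borel_measurable borel"
    unfolding vGv_eq[abs_def] by measurable
  fix x
  have "cmod (moment (K x) f) \<le> c * (1 + norm x) ^ 4 * (L2norm weight * L2norm f)"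
    by (rule moment_le_L2norm[OF quartic_kernel_quartic_growth[OF K] quartic_kernel_bound[OF K] f])
  from mult_left_mono[OF this v_nonneg[of x]]
  show "cmod (vGv K V f x) \<le> c * (L2norm weight * L2norm f) * cmod (weight x)"
    unfolding vGv_eq by (simp add: norm_mult cmod_weight mult_ac)
qed

lemma vGv_add:
  "quartic_kernel c K \<Longrightarrow> sq_int f \<Longrightarrow> sq_int g \<Longrightarrow>
    vGv K V (\<lambda>x. f x + g x) = (\<lambda>x. vGv K V f x + vGv K V g x)"
  unfolding vGv_eq by (simp add: moment_density_add quartic_kernel_quartic_growth distrib_left)

lemma vGv_cmult: "vGv K V (\<lambda>x. c * f x) = (\<lambda>x. c * vGv K V f x)"
  unfolding vGv_eq by (simp add: moment_density_cmult mult.left_commute)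

lemma
  assumes K: "quartic_kernel c K" and f: "sq_int f"
    and g: "g \<in> borel_measurable borel" "integrable lborel (\<lambda>x. (1 + norm x) ^ 4 * cmod (g x))"
  shows integrable_mult_moment: "integrable lborel (\<lambda>x. g x * moment (K x) f)"
    and integral_mult_moment: "(LINT x|lborel. g x * moment (K x) f)
      = (LINT y|lborel. (LINT x|lborel. complex_of_real (K x y) * g x) * mult v f y)"
proof -
  define H where "H x y = g x * (complex_of_real (K x y) * mult v f y)" for x y
  note [measurable] = quartic_kernel_measurable[OF K] g(1) sq_int_borel[OF f]
  have "integrable (lborel \<Otimes>\<^sub>M lborel) (\<lambda>(x, y). H x y)"
  proof (rule lborel_pair.integrable_if_norm_le_mult)
    show "(\<lambda>(x, y). H x y) \<in> borel_measurable (lborel \<Otimes>\<^sub>M lborel)"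
      unfolding H_def mult_def by measurable
    show "integrable lborel (\<lambda>x. c * ((1 + norm x) ^ 4 * cmod (g x)))"
      using g(2) by simp
    show "integrable lborel (\<lambda>y. cmod (weight y) * cmod (f y))"
      by (rule integrable_sq_int_norm_mult[OF sq_int_weight f])
    fix x y
    have "\<bar>K x y\<bar> * (cmod (g x) * (v y * cmod (f y)))
        \<le> c * (1 + norm x) ^ 4 * (1 + norm y) ^ 4 * (cmod (g x) * (v y * cmod (f y)))"
      by (intro mult_right_mono quartic_kernel_bound[OF K]) auto
    then show "cmod (case (x, y) of (x, y) \<Rightarrow> H x y)
        \<le> c * ((1 + norm x) ^ 4 * cmod (g x)) * (cmod (weight y) * cmod (f y))"
      by (simp add: H_def mult_def cmod_weight norm_mult mult_ac)
  qed
  note Fubini = lborel_pair.integrable_fst[OF this] lborel_pair.Fubini_integral[OF this]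
  have inner: "(LINT y|lborel. H x y) = g x * moment (K x) f" for x
    unfolding H_def moment_eq_integral by simp
  show "integrable lborel (\<lambda>x. g x * moment (K x) f)"
    using Fubini(1) unfolding inner .
  have "(LINT x|lborel. H x y)
      = (LINT x|lborel. (complex_of_real (K x y) * g x) * mult v f y)" for y
    unfolding H_def by (simp add: mult_ac)
  then have "(LINT x|lborel. H x y)
      = (LINT x|lborel. complex_of_real (K x y) * g x) * mult v f y" for y
    by simp
  then show "(LINT x|lborel. g x * moment (K x) f)
      = (LINT y|lborel. (LINT x|lborel. complex_of_real (K x y) * g x) * mult v f y)"
    using Fubini(2) unfolding inner by simp
qed

lemma vGv_symmetric:
  assumes K: "quartic_kernel c K" "\<And>x y. K x y = K y x" and f: "sq_int f" and g: "sq_int g"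
  shows "L2_inner g (vGv K V f) = L2_inner (vGv K V g) f"
proof -
  note [measurable] = sq_int_borel[OF g]
  have "integrable lborel (\<lambda>x. (1 + norm x) ^ 4 * cmod (cnj (g x) * vc x))"
    using integrable_sq_int_norm_mult[OF sq_int_weight g]
    by (simp add: norm_mult cmod_weight mult_ac)
  note swap = integral_mult_moment[OF K(1) f _ this]
  have conj: "(LINT x|lborel. complex_of_real (K x y) * (cnj (g x) * vc x))
      = cnj (moment (K y) g)" for y
    unfolding moment_eq_integral Bochner_Integration.integral_cnj[symmetric] mult_def
    by (simp add: K(2)[of _ y] mult_ac)
  have "L2_inner g (vGv K V f) = (LINT x|lborel. cnj (g x) * vc x * moment (K x) f)"
    unfolding L2_inner_def vGv_eq by (simp add: mult_ac)
  also have "\<dots> = (LINT y|lborel. cnj (moment (K y) g) * mult v f y)"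
    by (subst swap) (simp_all add: conj)
  also have "\<dots> = L2_inner (vGv K V g) f"
    unfolding L2_inner_def vGv_eq mult_def by (simp add: mult_ac)
  finally show ?thesis .
qed

lemma sq_int_U_mult: "sq_int f \<Longrightarrow> sq_int (\<lambda>x. complex_of_real (U x) * f x)"
  by (rule sq_int_dominated[of _ f 1]) (auto simp: norm_mult dest: sq_int_borel)

lemma sq_int_Top: "sq_int f \<Longrightarrow> sq_int (Top V f)"
  unfolding Top_def by (intro sq_int_add sq_int_U_mult sq_int_vGv[OF quartic_kernel_G0k])

lemma Top_add:
  "sq_int f \<Longrightarrow> sq_int g \<Longrightarrow> Top V (\<lambda>x. f x + g x) = (\<lambda>x. Top V f x + Top V g x)"
  unfolding Top_def by (simp add: vGv_add[OF quartic_kernel_G0k] algebra_simps)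

lemma Top_cmult: "Top V (\<lambda>x. c * f x) = (\<lambda>x. c * Top V f x)"
  unfolding Top_def by (simp add: vGv_cmult algebra_simps)

lemma Top_symmetric:
  assumes f: "sq_int f" and g: "sq_int g"
  shows "L2_inner g (Top V f) = L2_inner (Top V g) f"
proof -
  have "L2_inner g (\<lambda>x. complex_of_real (U x) * f x) = L2_inner (\<lambda>x. complex_of_real (U x) * g x) f"
    unfolding L2_inner_def by (simp add: mult_ac)
  then show ?thesis
    unfolding Top_def using f g
    by (simp add: L2_inner_add_right L2_inner_add_left sq_int_U_mult
        sq_int_vGv[OF quartic_kernel_G0k] vGv_symmetric[OF quartic_kernel_G0k G0k_commute])
qed

abbreviation vT :: "fn \<Rightarrow> complex" where
  "vT f \<equiv> vpair V (Top V f)"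

lemma vT_eq_L2_inner: "sq_int f \<Longrightarrow> vT f = L2_inner (Top V vc) f"
  unfolding vpair_eq_L2_inner by (rule Top_symmetric[OF _ sq_int_vc])

lemma L2_inner_Top_vc: "sq_int f \<Longrightarrow> L2_inner f (Top V vc) = cnj (vT f)"
  by (simp add: vT_eq_L2_inner L2_inner_commute[of f])

lemma vT_add: "sq_int f \<Longrightarrow> sq_int g \<Longrightarrow> vT (\<lambda>x. f x + g x) = vT f + vT g"
  by (simp add: Top_add vpair_add sq_int_Top)

lemma vT_cmult: "vT (\<lambda>x. c * f x) = c * vT f"
  by (simp add: Top_cmult vpair_cmult)

section \<open>The kernels of the three operators\<close>

lemma S1L2_iff:
  "f \<in> S1L2 V \<longleftrightarrow> sq_int f \<and> vpair V f = 0 \<and>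
     aeq (Top V f) (\<lambda>x. vT f / complex_of_real (L1norm V) * vc x)"
proof -
  have Pop: "Pop V g = (\<lambda>x. vpair V g / complex_of_real (L1norm V) * vc x)" for g
    unfolding Pop_def by (simp add: mult_ac)
  have Q: "aeq (Qop V f) f \<longleftrightarrow> vpair V f = 0"
  proof
    assume "aeq (Qop V f) f"
    then have "aeq (\<lambda>x. vc x * (vpair V f / complex_of_real (L1norm V))) (\<lambda>_. 0)"
      unfolding aeq_def Qop_def Pop by eventually_elim auto
    from zero_if_aeq_vc_mult[OF this] show "vpair V f = 0"
      using V_nonzero by simp
  qed (simp add: Qop_def Pop_def)
  have "Qop V f = f" if "vpair V f = 0"
    using that by (simp add: Qop_def Pop_def)
  moreover have "aeq (Qop V (Top V f)) (\<lambda>_. 0) \<longleftrightarrow>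
      aeq (Top V f) (\<lambda>x. vT f / complex_of_real (L1norm V) * vc x)"
    unfolding aeq_def Qop_def Pop by simp
  ultimately show ?thesis
    unfolding S1L2_def QL2_def using Q by auto
qed

lemma S1L2_sq_int: "f \<in> S1L2 V \<Longrightarrow> sq_int f" and S1L2_vpair: "f \<in> S1L2 V \<Longrightarrow> vpair V f = 0"
  unfolding S1L2_iff by blast+

lemma S1L2_subspace: "L2_subspace (S1L2 V)"
  unfolding L2_subspace_def
proof (intro conjI ballI allI)
  show "sq_int f" if "f \<in> S1L2 V" for f
    using that by (rule S1L2_sq_int)
  show "(\<lambda>x. c * f x) \<in> S1L2 V" if "f \<in> S1L2 V" for f c
    using that unfolding S1L2_iff aeq_def
    by (auto simp: sq_int_cmult vpair_cmult Top_cmult elim: AE_mp)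
  show "(\<lambda>x. f x + g x) \<in> S1L2 V" if f: "f \<in> S1L2 V" and g: "g \<in> S1L2 V" for f g
  proof -
    note sq = S1L2_sq_int[OF f] S1L2_sq_int[OF g]
    have "AE x in lborel. Top V f x = vT f / complex_of_real (L1norm V) * vc x"
      "AE x in lborel. Top V g x = vT g / complex_of_real (L1norm V) * vc x"
      using f g unfolding S1L2_iff aeq_def by auto
    then have "aeq (Top V (\<lambda>x. f x + g x))
        (\<lambda>x. vT (\<lambda>x. f x + g x) / complex_of_real (L1norm V) * vc x)"
      unfolding aeq_def vT_add[OF sq] unfolding Top_add[OF sq]
      by eventually_elim (simp add: add_divide_distrib distrib_right)
    then show ?thesis
      unfolding S1L2_iff using sq f g by (simp add: sq_int_add vpair_add S1L2_vpair)
  qed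
  have "vpair V (\<lambda>_. 0) = 0" "Top V (\<lambda>_. 0) = (\<lambda>_. 0)"
    using vpair_cmult[of 0 "\<lambda>_. 0"] Top_cmult[of 0 "\<lambda>_. 0"] by simp_all
  then show "(\<lambda>_. 0) \<in> S1L2 V"
    unfolding S1L2_iff by (simp add: sq_int_zero)
qed

text \<open>Solving \<open>T f = \<langle>v, T f\<rangle> v / L1norm V\<close> for the term \<open>U f\<close> of \<open>T f\<close> gives the kernel.\<close>

definition S1_kernel :: "real^3 \<Rightarrow> fn" where
  "S1_kernel x = (\<lambda>y. complex_of_real (U x * v x / L1norm V) * Top V vc y
     + complex_of_real (- (U x * v x)) * complex_of_real (G0k x y * v y))"

lemma quartic_growth_G0k: "quartic_growth (G0k x)"
  by (rule quartic_kernel_quartic_growth[OF quartic_kernel_G0k])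

lemma S1_kernel_summands_sq_int:
  "sq_int (\<lambda>y. c * Top V vc y)" "sq_int (\<lambda>y. c * complex_of_real (G0k x y * v y))"
  by (intro sq_int_cmult sq_int_Top sq_int_vc sq_int_mult_v quartic_growth_G0k)+

lemma sq_int_S1_kernel: "sq_int (S1_kernel x)"
  unfolding S1_kernel_def by (intro sq_int_add S1_kernel_summands_sq_int)

lemma L2_inner_S1_kernel:
  assumes "sq_int f"
  shows "L2_inner (S1_kernel x) f
    = complex_of_real (U x) * (vT f / complex_of_real (L1norm V) * vc x - vGv G0k V f x)"
proof -
  have "L2_inner (S1_kernel x) f = complex_of_real (U x * v x / L1norm V) * L2_inner (Top V vc) f
      + complex_of_real (- (U x * v x)) * moment (G0k x) f"
    unfolding S1_kernel_def moment_def
      L2_inner_add_left[OF S1_kernel_summands_sq_int assms] L2_inner_cmult_left by simp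
  then show ?thesis
    by (simp add: vGv_eq vT_eq_L2_inner[OF assms] algebra_simps)
qed

lemma L2norm_S1_kernel_le:
  "L2norm (S1_kernel x)
    \<le> (L2norm (Top V vc) / L1norm V + 1 / (8 * pi) * L2norm weight) * cmod (weight x)"
proof -
  have G0k: "L2norm (\<lambda>y. complex_of_real (G0k x y * v y))
      \<le> 1 / (8 * pi) * (1 + norm x) ^ 4 * L2norm weight"
    by (rule L2norm_mult_v_le[OF quartic_growth_G0k quartic_kernel_bound[OF quartic_kernel_G0k]])
  have "L2norm (S1_kernel x) \<le> L2norm (\<lambda>y. complex_of_real (U x * v x / L1norm V) * Top V vc y)
      + L2norm (\<lambda>y. complex_of_real (- (U x * v x)) * complex_of_real (G0k x y * v y))"
    unfolding S1_kernel_def by (rule L2norm_triangle[OF S1_kernel_summands_sq_int])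
  also have "\<dots> = v x / L1norm V * L2norm (Top V vc)
      + v x * L2norm (\<lambda>y. complex_of_real (G0k x y * v y))"
    using L1norm_pos unfolding L2norm_cmult norm_of_real by (simp add: abs_mult)
  also have "\<dots> \<le> cmod (weight x) / L1norm V * L2norm (Top V vc)
      + v x * (1 / (8 * pi) * (1 + norm x) ^ 4 * L2norm weight)"
    using v_le_weight[of x] G0k L1norm_pos
    by (intro add_mono mult_mono divide_right_mono) auto
  finally show ?thesis
    by (simp add: cmod_weight algebra_simps)
qed

lemma S1L2_finite_dim: "L2_finite_dim (S1L2 V)"
proof (rule L2_finite_dim_if_reproducing_kernel)
  let ?A = "L2norm (Top V vc) / L1norm V + 1 / (8 * pi) * L2norm weight"
  show "aeq f (\<lambda>x. L2_inner (S1_kernel x) f)" if f: "f \<in> S1L2 V" for f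
  proof -
    have "aeq (Top V f) (\<lambda>x. vT f / complex_of_real (L1norm V) * vc x)"
      using f unfolding S1L2_iff by blast
    then show ?thesis
      unfolding aeq_def L2_inner_S1_kernel[OF S1L2_sq_int[OF f]]
    proof eventually_elim
      case (elim x)
      then have "complex_of_real (U x) * f x
          = vT f / complex_of_real (L1norm V) * vc x - vGv G0k V f x"
        unfolding Top_def by (simp add: algebra_simps)
      then show ?case
        using U_mult_U[of x "f x"] by simp
    qed
  qed
  show "integrable lborel (\<lambda>x. (?A * cmod (weight x))\<^sup>2)"
    using sq_int_integrable[OF sq_int_weight] by (simp add: power_mult_distrib)
qed (rule sq_int_S1_kernel L2norm_S1_kernel_le)+

abbreviation moment1 :: "3 \<Rightarrow> fn \<Rightarrow> complex" where
  "moment1 j \<equiv> moment (\<lambda>y. y $ j)"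

abbreviation moment2 :: "3 \<Rightarrow> 3 \<Rightarrow> fn \<Rightarrow> complex" where
  "moment2 i j \<equiv> moment (\<lambda>y. y $ i * y $ j)"

abbreviation moment_sq :: "fn \<Rightarrow> complex" where
  "moment_sq \<equiv> moment (\<lambda>y. (norm y)\<^sup>2)"

lemma moment_sq_eq:
  assumes "sq_int f"
  shows "moment_sq f = (\<Sum>i\<in>UNIV. moment2 i i f)"
proof -
  have "(\<lambda>y::real^3. (norm y)\<^sup>2) = (\<lambda>y. \<Sum>i\<in>UNIV. y $ i * y $ i)"
    unfolding sum_square_eq_norm_square[symmetric] by (simp add: power2_eq_square)
  then show ?thesis
    using assms by (simp add: moment_sum quartic_growth_intros)
qed

lemma moment_inner:
  assumes "sq_int f"
  shows "moment (\<lambda>y. x \<bullet> y) f = (\<Sum>j\<in>UNIV. complex_of_real (x $ j) * moment1 j f)"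
  unfolding inner_eq_sum_nth using assms
  by (simp add: moment_sum moment_cmult quartic_growth_intros)

lemma moment_norm_square_inner:
  assumes "sq_int f"
  shows "moment (\<lambda>y. (norm y)\<^sup>2 * (x \<bullet> y)) f
    = (\<Sum>j\<in>UNIV. complex_of_real (x $ j) * moment (\<lambda>y. (norm y)\<^sup>2 * y $ j) f)"
proof -
  have "(\<lambda>y. (norm y)\<^sup>2 * (x \<bullet> y)) = (\<lambda>y. \<Sum>j\<in>UNIV. x $ j * ((norm y)\<^sup>2 * y $ j))"
    unfolding inner_eq_sum_nth by (simp add: sum_distrib_left mult.left_commute)
  then show ?thesis
    using assms by (simp add: moment_sum moment_cmult quartic_growth_intros)
qed

lemma moment_inner_square:
  assumes "sq_int f"
  shows "moment (\<lambda>y. (x \<bullet> y)\<^sup>2) f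
    = (\<Sum>i\<in>UNIV. \<Sum>j\<in>UNIV. complex_of_real (x $ i * x $ j) * moment2 i j f)"
proof -
  have "(\<lambda>y. (x \<bullet> y)\<^sup>2) = (\<lambda>y. \<Sum>i\<in>UNIV. \<Sum>j\<in>UNIV. (x $ i * x $ j) * (y $ i * y $ j))"
    unfolding inner_eq_sum_nth power2_eq_square sum_product by (simp add: mult_ac)
  then show ?thesis
    using assms by (simp only: moment_sum moment_cmult quartic_growth_intros finite)
qed

lemma moment_G1k:
  assumes "sq_int f"
  shows "moment (G1k x) f = complex_of_real ((norm x)\<^sup>2) * vpair V f + moment_sq f
    - 2 * moment (\<lambda>y. x \<bullet> y) f"
proof -
  have "G1k x = (\<lambda>y. ((norm x)\<^sup>2 * 1 + (norm y)\<^sup>2) - 2 * (x \<bullet> y))"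
    unfolding G1k_def dist_square_expand by simp
  then show ?thesis
    using assms
    by (simp only: moment_add moment_diff moment_cmult quartic_growth_intros vpair_eq_moment) simp
qed

lemma moment_G3k:
  assumes "sq_int f"
  shows "moment (G3k x) f = complex_of_real (norm x ^ 4) * vpair V f + moment (\<lambda>y. norm y ^ 4) f
    + complex_of_real (2 * (norm x)\<^sup>2) * moment_sq f + 4 * moment (\<lambda>y. (x \<bullet> y)\<^sup>2) f
    - complex_of_real (4 * (norm x)\<^sup>2) * moment (\<lambda>y. x \<bullet> y) f
    - 4 * moment (\<lambda>y. (norm y)\<^sup>2 * (x \<bullet> y)) f"
proof -
  have "G3k x y = ((norm x)\<^sup>2 + (norm y)\<^sup>2 - 2 * (x \<bullet> y))\<^sup>2" for y
    unfolding G3k_def dist_square_expand[symmetric] by (simp add: power_mult[symmetric])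
  also have "\<dots> y = norm x ^ 4 * 1 + norm y ^ 4 + (2 * (norm x)\<^sup>2) * (norm y)\<^sup>2 + 4 * (x \<bullet> y)\<^sup>2
      - (4 * (norm x)\<^sup>2) * (x \<bullet> y) - 4 * ((norm y)\<^sup>2 * (x \<bullet> y))" for y
    by algebra
  finally have "G3k x = (\<lambda>y. norm x ^ 4 * 1 + norm y ^ 4 + (2 * (norm x)\<^sup>2) * (norm y)\<^sup>2
      + 4 * (x \<bullet> y)\<^sup>2 - (4 * (norm x)\<^sup>2) * (x \<bullet> y) - 4 * ((norm y)\<^sup>2 * (x \<bullet> y)))"
    by blast
  then show ?thesis
    using assms
    by (simp only: moment_add moment_diff moment_cmult quartic_growth_intros vpair_eq_moment) simp
qed

lemma L2_inner_vG1v: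
  assumes f: "sq_int f" "vpair V f = 0" and k: "sq_int k" "vpair V k = 0"
  shows "L2_inner k (vGv G1k V f) = - 2 * (\<Sum>j\<in>UNIV. cnj (moment1 j k) * moment1 j f)"
proof -
  have "vGv G1k V f = (\<lambda>x. moment_sq f * complex_of_real (1 * v x)
      + (\<Sum>j\<in>UNIV. (- 2 * moment1 j f) * complex_of_real (x $ j * v x)))"
    unfolding vGv_eq moment_G1k[OF f(1)] moment_inner[OF f(1)] f(2)
    by (simp add: sum_distrib_left sum_negf algebra_simps)
  then have "L2_inner k (vGv G1k V f) = moment_sq f * cnj (moment (\<lambda>_. 1) k)
      + (\<Sum>j\<in>UNIV. (- 2 * moment1 j f) * cnj (moment1 j k))"
    using k(1)
    by (simp only: L2_inner_add_right L2_inner_sum_right L2_inner_cmult_right L2_inner_mult_v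
        sq_int_mult_v quartic_growth_intros sq_int_cmult sq_int_sum finite)
  then show ?thesis
    using k(2) by (simp add: vpair_eq_moment sum_distrib_left mult_ac)
qed

lemma L2_inner_vG3v:
  assumes f: "sq_int f" "vpair V f = 0" "\<And>j. moment1 j f = 0"
    and k: "sq_int k" "vpair V k = 0" "\<And>j. moment1 j k = 0"
  shows "L2_inner k (vGv G3k V f) = 2 * (cnj (moment_sq k) * moment_sq f)
    + 4 * (\<Sum>i\<in>UNIV. \<Sum>j\<in>UNIV. cnj (moment2 i j k) * moment2 i j f)"
proof -
  have "vGv G3k V f = (\<lambda>x. moment (\<lambda>y. norm y ^ 4) f * complex_of_real (1 * v x)
      + (2 * moment_sq f) * complex_of_real ((norm x)\<^sup>2 * v x)
      + (\<Sum>i\<in>UNIV. \<Sum>j\<in>UNIV. (4 * moment2 i j f) * complex_of_real ((x $ i * x $ j) * v x))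
      + (\<Sum>j\<in>UNIV. (- 4 * moment (\<lambda>y. (norm y)\<^sup>2 * y $ j) f) * complex_of_real (x $ j * v x)))"
    unfolding vGv_eq moment_G3k[OF f(1)] moment_inner[OF f(1)] moment_inner_square[OF f(1)]
      moment_norm_square_inner[OF f(1)] f(2,3)
    by (simp add: sum_distrib_left sum_negf algebra_simps)
  then have "L2_inner k (vGv G3k V f) = moment (\<lambda>y. norm y ^ 4) f * cnj (moment (\<lambda>_. 1) k)
      + (2 * moment_sq f) * cnj (moment_sq k)
      + (\<Sum>i\<in>UNIV. \<Sum>j\<in>UNIV. (4 * moment2 i j f) * cnj (moment2 i j k))
      + (\<Sum>j\<in>UNIV. (- 4 * moment (\<lambda>y. (norm y)\<^sup>2 * y $ j) f) * cnj (moment1 j k))"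
    using k(1)
    by (simp only: L2_inner_add_right L2_inner_sum_right L2_inner_cmult_right L2_inner_mult_v
        sq_int_mult_v quartic_growth_intros sq_int_cmult sq_int_sum sq_int_add finite)
  then show ?thesis
    using k(2,3) by (simp add: vpair_eq_moment sum_distrib_left mult_ac)
qed

lemma
  assumes "sq_int g"
  shows S1_in_S1L2: "S1 V g \<in> S1L2 V"
    and L2_inner_S1: "k \<in> S1L2 V \<Longrightarrow> L2_inner k (S1 V g) = L2_inner k g"
  unfolding S1_def by (rule orth_proj[OF S1L2_subspace S1L2_finite_dim assms], assumption?)+

definition T1coef :: real where
  "T1coef = L1norm V / (3 * (8 * pi)\<^sup>2)"

lemma T1coef_pos: "0 < T1coef"
  unfolding T1coef_def using L1norm_pos by simp

definition T1form :: "fn \<Rightarrow> fn \<Rightarrow> complex" where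
  "T1form k f = cnj (vT k) * vT f / complex_of_real (L1norm V)
     + complex_of_real (2 * T1coef) * (\<Sum>j\<in>UNIV. cnj (moment1 j k) * moment1 j f)"

lemma L2_inner_T_P_T:
  assumes "sq_int f" "sq_int k"
  shows "L2_inner k (Top V (Pop V (Top V f))) = cnj (vT k) * vT f / complex_of_real (L1norm V)"
proof -
  have P: "Pop V (Top V f) = (\<lambda>x. (vT f / complex_of_real (L1norm V)) * vc x)"
    unfolding Pop_def by (simp add: mult_ac)
  show ?thesis
    unfolding P Top_cmult L2_inner_cmult_right L2_inner_Top_vc[OF assms(2)] by simp
qed

lemma
  assumes f: "f \<in> S1L2 V"
  shows T1_in_S1L2: "T1 V f \<in> S1L2 V"
    and L2_inner_T1: "k \<in> S1L2 V \<Longrightarrow> L2_inner k (T1 V f) = T1form k f"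
proof -
  note sq = S1L2_sq_int
  let ?a = "Top V (Pop V (Top V f))" and ?b = "vGv G1k V f"
  have "sq_int (Pop V (Top V f))"
    using sq_int_cmult[OF sq_int_vc, of "vT f / complex_of_real (L1norm V)"]
    unfolding Pop_def by (simp add: mult_ac)
  then have a: "sq_int ?a"
    by (rule sq_int_Top)
  have b: "sq_int ?b"
    by (rule sq_int_vGv[OF quartic_kernel_G1k sq[OF f]])
  note S1_b = L2_subspace_cmult[OF S1L2_subspace S1_in_S1L2[OF b]]
  have T1: "T1 V f = (\<lambda>x. S1 V ?a x - complex_of_real T1coef * S1 V ?b x)"
    unfolding T1_def T1coef_def ..
  show "T1 V f \<in> S1L2 V"
    unfolding T1 by (rule L2_subspace_diff[OF S1L2_subspace S1_in_S1L2[OF a] S1_b])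
  assume k: "k \<in> S1L2 V"
  have "L2_inner k (T1 V f) = L2_inner k ?a - complex_of_real T1coef * L2_inner k ?b"
    unfolding T1 L2_inner_diff_right[OF sq[OF k] sq[OF S1_in_S1L2[OF a]] sq[OF S1_b]]
      L2_inner_cmult_right L2_inner_S1[OF a k] L2_inner_S1[OF b k] ..
  also have "\<dots> = T1form k f"
    unfolding T1form_def L2_inner_T_P_T[OF sq[OF f] sq[OF k]]
      L2_inner_vG1v[OF sq[OF f] S1L2_vpair[OF f] sq[OF k] S1L2_vpair[OF k]] by simp
  finally show "L2_inner k (T1 V f) = T1form k f" .
qed

lemma hermitian_T1form: "hermitian_form_on (S1L2 V) T1form"
  unfolding hermitian_form_on_def T1form_def
  by (auto simp: S1L2_sq_int vT_add vT_cmult moment_density_add moment_density_cmult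
      quartic_growth_intros sum.distrib sum_distrib_left algebra_simps add_divide_distrib)

definition T1quad :: "fn \<Rightarrow> real" where
  "T1quad f = (cmod (vT f))\<^sup>2 / L1norm V + 2 * T1coef * (\<Sum>j\<in>UNIV. (cmod (moment1 j f))\<^sup>2)"

lemma T1form_self: "T1form f f = complex_of_real (T1quad f)"
  unfolding T1form_def T1quad_def
  by (simp add: complex_norm_square mult.commute flip: of_real_power)

lemma T1quad_ge: "(cmod (vT f))\<^sup>2 / L1norm V \<le> T1quad f"
  unfolding T1quad_def using T1coef_pos by (simp add: sum_nonneg)

lemma T1quad_nonneg: "0 \<le> T1quad f"
  using T1quad_ge[of f] L1norm_pos by (meson divide_nonneg_pos order_trans zero_le_power2)

lemma T1quad_eq_0_iff: "T1quad f = 0 \<longleftrightarrow> vT f = 0 \<and> (\<forall>j. moment1 j f = 0)"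
proof -
  have "T1quad f = 0 \<longleftrightarrow> (cmod (vT f))\<^sup>2 / L1norm V = 0
      \<and> 2 * T1coef * (\<Sum>j\<in>UNIV. (cmod (moment1 j f))\<^sup>2) = 0"
    unfolding T1quad_def using L1norm_pos T1coef_pos
    by (intro add_nonneg_eq_0_iff) (auto intro!: mult_nonneg_nonneg sum_nonneg)
  then show ?thesis
    using L1norm_pos T1coef_pos by (simp add: sum_nonneg_eq_0_iff)
qed

lemma S2L2_iff: "f \<in> S2L2 V \<longleftrightarrow> f \<in> S1L2 V \<and> vT f = 0 \<and> (\<forall>j. moment1 j f = 0)"
proof (cases "f \<in> S1L2 V")
  case f: True
  have "f \<in> S2L2 V \<longleftrightarrow> (\<forall>k\<in>S1L2 V. T1form k f = 0)"
    unfolding S2L2_def using f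
    by (simp add: aeq_zero_iff_orthogonal[OF S1L2_subspace T1_in_S1L2] L2_inner_T1)
  also have "\<dots> \<longleftrightarrow> T1quad f = 0"
  proof
    show "T1quad f = 0" if "\<forall>k\<in>S1L2 V. T1form k f = 0"
      using that f T1form_self[of f] by simp
    show "\<forall>k\<in>S1L2 V. T1form k f = 0" if "T1quad f = 0"
      using that unfolding T1quad_eq_0_iff T1form_def by simp
  qed
  finally show ?thesis
    using f by (simp add: T1quad_eq_0_iff)
qed (simp add: S2L2_def)

lemma S2L2_subset: "S2L2 V \<subseteq> S1L2 V"
  by (auto simp: S2L2_iff)

lemma S2L2_sq_int: "f \<in> S2L2 V \<Longrightarrow> sq_int f"
  using S2L2_subset S1L2_sq_int by blast

lemma S2L2_subspace: "L2_subspace (S2L2 V)"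
proof -
  have "vT (\<lambda>_. 0) = 0" "moment1 j (\<lambda>_. 0) = 0" for j
    using vT_cmult[of 0 "\<lambda>_. 0"] moment_density_cmult[of _ 0 "\<lambda>_. 0"] by simp_all
  then show ?thesis
    unfolding L2_subspace_def
    by (auto simp: S2L2_iff L2_subspace_zero L2_subspace_add L2_subspace_cmult S1L2_subspace
        S1L2_sq_int vT_add vT_cmult moment_density_add moment_density_cmult quartic_growth_intros)
qed

lemma S2L2_finite_dim: "L2_finite_dim (S2L2 V)"
  by (rule L2_finite_dim_subset[OF S1L2_finite_dim S2L2_subset])

lemma
  assumes "sq_int g"
  shows S2_in_S2L2: "S2 V g \<in> S2L2 V"
    and L2_inner_S2: "k \<in> S2L2 V \<Longrightarrow> L2_inner k (S2 V g) = L2_inner k g"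
  unfolding S2_def by (rule orth_proj[OF S2L2_subspace S2L2_finite_dim assms], assumption?)+

lemma S2_in_S1L2: "sq_int g \<Longrightarrow> S2 V g \<in> S1L2 V"
  using S2_in_S2L2 S2L2_subset by blast

lemma L2_inner_S2_symmetric:
  assumes "sq_int k" "sq_int h"
  shows "L2_inner k (S2 V h) = L2_inner (S2 V k) h"
    and "L2_inner k (S2 V h) = L2_inner (S2 V k) (S2 V h)"
  unfolding S2_def
  using L2_inner_orth_proj_symmetric[OF S2L2_subspace S2L2_finite_dim assms] by simp_all

definition D1form :: "fn \<Rightarrow> fn \<Rightarrow> complex" where
  "D1form k h = T1form k h + L2_inner k (S2 V h)"

lemma hermitian_D1form: "hermitian_form_on (S1L2 V) D1form"
proof -
  have "hermitian_form_on (S1L2 V) (\<lambda>k h. L2_inner k (S2 V h))"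
    unfolding hermitian_form_on_def
  proof (intro conjI ballI allI)
    fix k h assume k: "k \<in> S1L2 V" and h: "h \<in> S1L2 V"
    note sq = S1L2_sq_int[OF k] S1L2_sq_int[OF h]
    show "L2_inner k (S2 V (\<lambda>x. c * h x)) = c * L2_inner k (S2 V h)" for c
      using sq by (simp add: L2_inner_S2_symmetric(1) L2_inner_cmult_right sq_int_cmult)
    show "L2_inner k (S2 V h) = cnj (L2_inner h (S2 V k))"
      unfolding L2_inner_S2_symmetric(1)[OF sq] by (rule L2_inner_commute)
    fix h' assume h': "h' \<in> S1L2 V"
    show "L2_inner k (S2 V (\<lambda>x. h x + h' x)) = L2_inner k (S2 V h) + L2_inner k (S2 V h')"
      using sq S1L2_sq_int[OF h'] S1L2_sq_int[OF S2_in_S1L2[OF sq(1)]]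
      by (simp add: L2_inner_S2_symmetric(1) L2_inner_add_right sq_int_add)
  qed
  then show ?thesis
    unfolding D1form_def by (rule hermitian_form_on_add[OF hermitian_T1form])
qed

lemma D1form_self:
  "h \<in> S1L2 V \<Longrightarrow> D1form h h = complex_of_real (T1quad h + (L2norm (S2 V h))\<^sup>2)"
  unfolding D1form_def T1form_self using L2_inner_S2_symmetric(2)[of h h] L2_inner_self[of "S2 V h"]
  by (simp add: S1L2_sq_int)

lemma D1form_definite:
  assumes h: "h \<in> S1L2 V" and zero: "D1form h h = 0"
  shows "aeq h (\<lambda>_. 0)"
proof -
  note sq = S1L2_sq_int[OF h]
  have "T1quad h + (L2norm (S2 V h))\<^sup>2 = 0"
    using zero unfolding D1form_self[OF h] of_real_eq_0_iff .
  then have T1: "T1quad h = 0" and S2: "(L2norm (S2 V h))\<^sup>2 = 0"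
    using T1quad_nonneg[of h] zero_le_power2[of "L2norm (S2 V h)"] by linarith+
  have "h \<in> S2L2 V"
    unfolding S2L2_iff using h T1 by (simp add: T1quad_eq_0_iff)
  then have "L2_inner h h = L2_inner (S2 V h) (S2 V h)"
    using L2_inner_S2[OF sq] L2_inner_S2_symmetric(2)[OF sq sq] by simp
  then have "L2norm h = 0"
    using S2 unfolding L2_inner_self by simp
  then show ?thesis
    by (rule aeq_zero_if_L2norm_eq_zero[OF sq])
qed

lemma
  assumes g: "sq_int g"
  shows D1_in_S1L2: "D1 V g \<in> S1L2 V"
    and D1form_D1: "k \<in> S1L2 V \<Longrightarrow> D1form k (D1 V g) = L2_inner k g"
proof -
  define A where "A h = (\<lambda>x. T1 V h x + S2 V h x)" for h
  note sq = S1L2_sq_int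
  have A: "A h \<in> S1L2 V" if "h \<in> S1L2 V" for h
    unfolding A_def
    by (intro L2_subspace_add[OF S1L2_subspace] T1_in_S1L2 S2_in_S1L2 sq that)
  have form: "L2_inner k (A h) = D1form k h" if "k \<in> S1L2 V" "h \<in> S1L2 V" for k h
    unfolding A_def D1form_def using that
    by (simp add: L2_inner_add_right L2_inner_T1 sq T1_in_S1L2 S2_in_S1L2)
  obtain h where h: "h \<in> S1L2 V" "\<And>k. k \<in> S1L2 V \<Longrightarrow> D1form k h = L2_inner k g"
    using definite_form_represents_L2_inner[OF S1L2_subspace S1L2_finite_dim g hermitian_D1form
        A form D1form_definite] by blast
  have "aeq (A h) (S1 V g)"
    by (rule aeq_if_L2_inner_eq[OF S1L2_subspace A[OF h(1)] S1_in_S1L2[OF g]])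
      (simp add: form h L2_inner_S1[OF g])
  then have "\<exists>h. h \<in> S1L2 V \<and> aeq (\<lambda>x. T1 V h x + S2 V h x) (S1 V g)"
    using h(1) unfolding A_def by blast
  from someI_ex[OF this] have D1: "D1 V g \<in> S1L2 V" "aeq (A (D1 V g)) (S1 V g)"
    unfolding D1_def[symmetric] A_def by auto
  show "D1 V g \<in> S1L2 V"
    by (rule D1(1))
  show "D1form k (D1 V g) = L2_inner k g" if k: "k \<in> S1L2 V"
    using L2_inner_aeq_right[OF sq[OF k] sq[OF A[OF D1(1)]] sq[OF S1_in_S1L2[OF g]] D1(2)]
    by (simp add: form[OF k D1(1)] L2_inner_S1[OF g k])
qed

lemma vG1v_S2L2:
  assumes "f \<in> S2L2 V"
  shows "vGv G1k V f = (\<lambda>x. moment_sq f * vc x)"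
proof -
  have "sq_int f" "vpair V f = 0" "\<And>j. moment1 j f = 0"
    using assms S1L2_vpair S1L2_sq_int unfolding S2L2_iff by blast+
  then show ?thesis
    unfolding vGv_eq by (simp add: moment_G1k moment_inner mult.commute)
qed

lemma L2_inner_vG1v_S2L2:
  assumes k: "k \<in> S2L2 V" and u: "sq_int u"
  shows "L2_inner k (vGv G1k V u) = cnj (moment_sq k) * vpair V u"
  unfolding vGv_symmetric[OF quartic_kernel_G1k G1k_commute u S2L2_sq_int[OF k]]
    vG1v_S2L2[OF k] L2_inner_cmult_left vpair_eq_L2_inner ..

text \<open>For \<open>h = D\<^sub>1 T v G\<^sub>1 v f\<close>, testing the equation of \<open>h\<close> against \<open>h\<close> bounds the resolvent term
  of \<^const>\<open>T2\<close> by the term \<open>(v G\<^sub>1 v)\<^sup>2\<close>.\<close>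

lemma vT_D1_T_vG1v:
  assumes f: "f \<in> S2L2 V"
  shows "\<exists>t\<le>L1norm V. vT (D1 V (Top V (vGv G1k V f))) = complex_of_real t * moment_sq f"
proof -
  define g where "g = Top V (vGv G1k V f)"
  define h where "h = D1 V g"
  have g_eq: "g = (\<lambda>x. moment_sq f * Top V vc x)"
    unfolding g_def vG1v_S2L2[OF f] by (rule Top_cmult)
  have g: "sq_int g"
    unfolding g_eq by (intro sq_int_cmult sq_int_Top sq_int_vc)
  have h: "h \<in> S1L2 V"
    unfolding h_def by (rule D1_in_S1L2[OF g])
  have "moment_sq f * cnj (vT h) = L2_inner h g"
    unfolding g_eq L2_inner_cmult_right L2_inner_Top_vc[OF S1L2_sq_int[OF h]] ..
  also have "\<dots> = D1form h h"
    using D1form_D1[OF g h] unfolding h_def by simp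
  also have "\<dots> = complex_of_real (T1quad h + (L2norm (S2 V h))\<^sup>2)"
    by (rule D1form_self[OF h])
  finally have energy: "moment_sq f * cnj (vT h)
      = complex_of_real (T1quad h + (L2norm (S2 V h))\<^sup>2)" .
  have "(cmod (vT h))\<^sup>2 / L1norm V \<le> T1quad h + (L2norm (S2 V h))\<^sup>2"
    using T1quad_ge[of h] by (simp add: add_increasing2)
  from real_multiple_if_mult_cnj_ge[OF energy this L1norm_pos] show ?thesis
    unfolding h_def g_def .
qed

definition T2_operand :: "fn \<Rightarrow> fn" where
  "T2_operand f = (\<lambda>x. vGv G3k V f x
     + complex_of_real (10 / (3 * L1norm V)) * vGv G1k V (vGv G1k V f) x
     - complex_of_real (10 / (3 * L1norm V)) * vGv G1k V (Top V (D1 V (Top V (vGv G1k V f)))) x)"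

lemma T2_eq: "T2 V f = S2 V (T2_operand f)"
  unfolding T2_def T2_operand_def ..

lemma sq_int_T2_summands:
  assumes "sq_int f"
  shows "sq_int (vGv G1k V f)" "sq_int (Top V (D1 V (Top V (vGv G1k V f))))"
    "sq_int (vGv G3k V f)" "sq_int (vGv G1k V (vGv G1k V f))"
    "sq_int (vGv G1k V (Top V (D1 V (Top V (vGv G1k V f)))))"
proof -
  note G1 = sq_int_vGv[OF quartic_kernel_G1k] and G3 = sq_int_vGv[OF quartic_kernel_G3k]
  show G1f: "sq_int (vGv G1k V f)"
    by (rule G1[OF assms])
  show D1: "sq_int (Top V (D1 V (Top V (vGv G1k V f))))"
    by (intro sq_int_Top S1L2_sq_int D1_in_S1L2 G1f)
  show "sq_int (vGv G3k V f)" "sq_int (vGv G1k V (vGv G1k V f))"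
    "sq_int (vGv G1k V (Top V (D1 V (Top V (vGv G1k V f)))))"
    by (rule G3[OF assms] G1[OF G1f] G1[OF D1])+
qed

lemma sq_int_T2_operand: "sq_int f \<Longrightarrow> sq_int (T2_operand f)"
  unfolding T2_operand_def by (intro sq_int_diff sq_int_add sq_int_cmult sq_int_T2_summands)

lemma T2_in_S2L2: "f \<in> S2L2 V \<Longrightarrow> T2 V f \<in> S2L2 V"
  unfolding T2_eq by (intro S2_in_S2L2 sq_int_T2_operand S2L2_sq_int)

lemma L2_inner_T2:
  assumes f: "f \<in> S2L2 V"
  shows "\<exists>a\<ge>0. \<forall>k\<in>S2L2 V. L2_inner k (T2 V f)
    = complex_of_real a * (cnj (moment_sq k) * moment_sq f)
      + 4 * (\<Sum>i\<in>UNIV. \<Sum>j\<in>UNIV. cnj (moment2 i j k) * moment2 i j f)"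
proof -
  define c where "c = 10 / (3 * L1norm V)"
  note sq = sq_int_T2_summands[OF S2L2_sq_int[OF f]]
  obtain t where t: "t \<le> L1norm V"
    and vT: "vT (D1 V (Top V (vGv G1k V f))) = complex_of_real t * moment_sq f"
    using vT_D1_T_vG1v[OF f] by blast
  have vG1v: "vpair V (vGv G1k V f) = complex_of_real (L1norm V) * moment_sq f"
    unfolding vG1v_S2L2[OF f] vpair_cmult vpair_eq_L2_inner L2_inner_self L1norm_eq by simp
  have "L2_inner k (T2 V f) = complex_of_real (2 + c * (L1norm V - t))
        * (cnj (moment_sq k) * moment_sq f)
      + 4 * (\<Sum>i\<in>UNIV. \<Sum>j\<in>UNIV. cnj (moment2 i j k) * moment2 i j f)" if k: "k \<in> S2L2 V" for k
  proof -
    have "L2_inner k (T2 V f) = L2_inner k (T2_operand f)"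
      unfolding T2_eq by (rule L2_inner_S2[OF sq_int_T2_operand[OF S2L2_sq_int[OF f]] k])
    also have "\<dots> = L2_inner k (vGv G3k V f)
        + complex_of_real c * L2_inner k (vGv G1k V (vGv G1k V f))
        - complex_of_real c * L2_inner k (vGv G1k V (Top V (D1 V (Top V (vGv G1k V f)))))"
      unfolding T2_operand_def c_def[symmetric] using S2L2_sq_int[OF k] sq
      by (simp only: L2_inner_diff_right L2_inner_add_right L2_inner_cmult_right sq_int_add
          sq_int_cmult)
    also have "L2_inner k (vGv G3k V f) = 2 * (cnj (moment_sq k) * moment_sq f)
        + 4 * (\<Sum>i\<in>UNIV. \<Sum>j\<in>UNIV. cnj (moment2 i j k) * moment2 i j f)"
      using f k by (intro L2_inner_vG3v) (auto simp: S2L2_iff S1L2_sq_int S1L2_vpair)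
    finally show ?thesis
      unfolding L2_inner_vG1v_S2L2[OF k sq(1)] L2_inner_vG1v_S2L2[OF k sq(2)] vG1v vT
      by (simp add: algebra_simps)
  qed
  moreover have "0 \<le> 2 + c * (L1norm V - t)"
    unfolding c_def using t L1norm_pos by (intro add_nonneg_nonneg mult_nonneg_nonneg) auto
  ultimately show ?thesis
    by blast
qed

lemma S3L2_iff: "f \<in> S3L2 V \<longleftrightarrow> f \<in> S2L2 V \<and> (\<forall>i j. moment2 i j f = 0)"
proof (cases "f \<in> S2L2 V")
  case f: True
  obtain a where a: "0 \<le> a" and T2: "\<And>k. k \<in> S2L2 V \<Longrightarrow> L2_inner k (T2 V f)
      = complex_of_real a * (cnj (moment_sq k) * moment_sq f)
        + 4 * (\<Sum>i\<in>UNIV. \<Sum>j\<in>UNIV. cnj (moment2 i j k) * moment2 i j f)"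
    using L2_inner_T2[OF f] by blast
  let ?S = "\<Sum>i\<in>UNIV. \<Sum>j\<in>UNIV. (cmod (moment2 i j f))\<^sup>2"
  have "f \<in> S3L2 V \<longleftrightarrow> (\<forall>k\<in>S2L2 V. L2_inner k (T2 V f) = 0)"
    unfolding S3L2_def using f
    by (simp add: aeq_zero_iff_orthogonal[OF S2L2_subspace T2_in_S2L2])
  also have "\<dots> \<longleftrightarrow> (\<forall>i j. moment2 i j f = 0)"
  proof
    assume "\<forall>k\<in>S2L2 V. L2_inner k (T2 V f) = 0"
    moreover have "cnj z * z = complex_of_real ((cmod z)\<^sup>2)" for z
      by (simp only: complex_norm_square mult.commute)
    ultimately have "complex_of_real (a * (cmod (moment_sq f))\<^sup>2 + 4 * ?S) = 0"
      using T2[OF f] f by simp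
    then have "a * (cmod (moment_sq f))\<^sup>2 + 4 * ?S = 0"
      unfolding of_real_eq_0_iff .
    moreover have "0 \<le> a * (cmod (moment_sq f))\<^sup>2" "0 \<le> ?S"
      using a by (auto intro!: sum_nonneg)
    ultimately have "?S = 0"
      by linarith
    then show "\<forall>i j. moment2 i j f = 0"
      by (simp add: sum_nonneg_eq_0_iff sum_nonneg)
  next
    assume "\<forall>i j. moment2 i j f = 0"
    then show "\<forall>k\<in>S2L2 V. L2_inner k (T2 V f) = 0"
      by (simp add: T2 moment_sq_eq[OF S2L2_sq_int[OF f]])
  qed
  finally show ?thesis
    using f by simp
qed (simp add: S3L2_def)

section \<open>The potential of a density\<close>

definition pot :: "fn \<Rightarrow> fn" where
  "pot f x = - intop G0k (mult v f) x"

lemma pot_eq: "pot f x = moment (dist x) f / complex_of_real (8 * pi)"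
proof -
  have "G0k x = (\<lambda>y. (- 1 / (8 * pi)) * dist x y)"
    unfolding G0k_def by auto
  then show ?thesis
    unfolding pot_def intop_eq_moment by (simp only: moment_cmult) simp
qed

lemma pot_borel: "sq_int f \<Longrightarrow> pot f \<in> borel_measurable borel"
  unfolding pot_def[abs_def] intop_eq_moment
  using borel_measurable_moment_kernel[OF quartic_kernel_G0k] by simp

lemma aeq_U_v_pot_iff:
  "aeq f (mult U (mult v (\<lambda>x. pot f x + c))) \<longleftrightarrow> aeq (Top V f) (\<lambda>x. c * vc x)"
proof -
  have "f x = complex_of_real (U x) * (vc x * (pot f x + c)) \<longleftrightarrow> Top V f x = c * vc x" for x
  proof -
    have "f x = complex_of_real (U x) * (vc x * (pot f x + c))
        \<longleftrightarrow> complex_of_real (U x) * f x = vc x * (pot f x + c)"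
      by (metis U_mult_U)
    also have "\<dots> \<longleftrightarrow> Top V f x = c * vc x"
      unfolding Top_def vGv_eq pot_def intop_eq_moment by (auto simp: algebra_simps)
    finally show ?thesis .
  qed
  then show ?thesis
    unfolding aeq_def mult_def by simp
qed

lemma
  assumes f: "sq_int f" and \<psi>: "test_fun \<psi>"
  shows integrable_pot_lap_lap: "integrable lborel (\<lambda>x. pot f x * complex_of_real (lap (lap \<psi>) x))"
    and integral_pot_lap_lap: "(LINT x|lborel. pot f x * complex_of_real (lap (lap \<psi>) x))
      = - (LINT y|lborel. complex_of_real (\<psi> y) * mult v f y)"
proof -
  define L where "L x = complex_of_real (lap (lap \<psi>) x / (8 * pi))" for x
  have pot_L: "pot f x * complex_of_real (lap (lap \<psi>) x) = L x * moment (dist x) f" for x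
    unfolding pot_eq L_def by simp
  obtain B where B: "\<And>x. norm x > B \<Longrightarrow> lap (lap \<psi>) x = 0"
    using lap_lap_support[OF \<psi>] by blast
  have "integrable lborel (\<lambda>x. (1 + norm x) ^ 4 * \<bar>lap (lap \<psi>) x / (8 * pi)\<bar>)"
    using continuous_on_lap_lap[OF \<psi>] B
    by (intro integrable_continuous_bounded_support[of _ B]) (auto intro!: continuous_intros)
  then have int: "integrable lborel (\<lambda>x. (1 + norm x) ^ 4 * cmod (L x))"
    unfolding L_def norm_of_real .
  note [measurable] = borel_measurable_continuous_onI[OF continuous_on_lap_lap[OF \<psi>]]
  have L: "L \<in> borel_measurable borel"
    unfolding L_def by measurable
  show "integrable lborel (\<lambda>x. pot f x * complex_of_real (lap (lap \<psi>) x))"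
    unfolding pot_L by (rule integrable_mult_moment[OF quartic_kernel_dist f L int])
  have "(LINT x|lborel. complex_of_real (dist x y) * L x) = - complex_of_real (\<psi> y)" for y
  proof -
    have "(LINT x|lborel. complex_of_real (dist x y) * L x)
        = (LINT x|lborel. complex_of_real (dist x y * lap (lap \<psi>) x / (8 * pi)))"
      unfolding L_def by simp
    also have "\<dots> = complex_of_real ((LINT x|lborel. dist x y * lap (lap \<psi>) x) / (8 * pi))"
      unfolding integral_complex_of_real by simp
    finally show ?thesis
      unfolding bilaplacian_fundamental_solution[OF \<psi>] by simp
  qed
  then show "(LINT x|lborel. pot f x * complex_of_real (lap (lap \<psi>) x))
      = - (LINT y|lborel. complex_of_real (\<psi> y) * mult v f y)"
    unfolding pot_L integral_mult_moment[OF quartic_kernel_dist f L int] by simp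
qed

lemma dist_H_zero_pot:
  assumes f: "sq_int f" and eq: "aeq f (mult U (mult v (\<lambda>x. pot f x + c)))"
  shows "dist_H_zero V (\<lambda>x. pot f x + c)"
  unfolding dist_H_zero_def
proof (intro allI impI)
  fix \<psi> assume \<psi>: "test_fun \<psi>"
  note [measurable] = borel_measurable_continuous_onI[OF test_fun_continuous[OF \<psi>]]
    pot_borel[OF f] sq_int_borel[OF f]
  obtain B where B: "\<And>x. norm x > B \<Longrightarrow> lap (lap \<psi>) x = 0"
    using lap_lap_support[OF \<psi>] by blast
  have int: "integrable lborel (\<lambda>x. complex_of_real (lap (lap \<psi>) x))"
    by (intro integrable_of_real
        integrable_continuous_bounded_support[OF continuous_on_lap_lap[OF \<psi>] B])
  have "(LINT x|lborel. (pot f x + c) * complex_of_real (lap (lap \<psi>) x))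
      = (LINT x|lborel. pot f x * complex_of_real (lap (lap \<psi>) x))
        + c * complex_of_real (LINT x|lborel. lap (lap \<psi>) x)"
    using integrable_pot_lap_lap[OF f \<psi>] int by (simp add: distrib_right)
  also have "\<dots> = - (LINT y|lborel. complex_of_real (\<psi> y) * mult v f y)"
    using integral_pot_lap_lap[OF f \<psi>] integral_lap_lap[OF \<psi>] by simp
  also have "(LINT y|lborel. complex_of_real (\<psi> y) * mult v f y)
      = (LINT y|lborel. complex_of_real (V y * \<psi> y) * (pot f y + c))"
  proof (rule integral_cong_AE)
    show "AE y in lborel. complex_of_real (\<psi> y) * mult v f y
        = complex_of_real (V y * \<psi> y) * (pot f y + c)"
      using eq unfolding aeq_def
    proof eventually_elim
      case (elim y)
      then show ?case
        unfolding V_eq[of y] mult_def by (simp add: mult_ac)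
    qed
  qed (unfold mult_def, measurable)
  finally show "(LINT x|lborel. (pot f x + c) * complex_of_real (lap (lap \<psi>) x))
      + (LINT x|lborel. complex_of_real (V x * \<psi> x) * (pot f x + c)) = 0"
    by simp
qed

lemma pot_approx:
  assumes f: "sq_int f" and q: "quartic_growth q"
    and c: "\<And>y. \<bar>dist x y - q y\<bar> \<le> c * (1 + norm y) ^ 4"
  shows "cmod (pot f x - moment q f / complex_of_real (8 * pi)) \<le> c * (L2norm weight * L2norm f)"
proof -
  have dist: "quartic_growth (dist x)"
    by (rule quartic_kernel_quartic_growth[OF quartic_kernel_dist])
  have "pot f x - moment q f / complex_of_real (8 * pi)
      = moment (\<lambda>y. dist x y - q y) f / complex_of_real (8 * pi)"
    unfolding pot_eq moment_diff[OF dist q f] by (simp add: diff_divide_distrib)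
  then have "cmod (pot f x - moment q f / complex_of_real (8 * pi))
      = cmod (moment (\<lambda>y. dist x y - q y) f) / (8 * pi)"
    by (simp add: norm_divide norm_mult)
  also have "\<dots> \<le> cmod (moment (\<lambda>y. dist x y - q y) f) / 1"
    using pi_gt3 by (intro divide_left_mono) auto
  also have "\<dots> \<le> c * (L2norm weight * L2norm f)"
    using moment_le_L2norm[OF quartic_growth_diff[OF dist q] c f] by simp
  finally show ?thesis .
qed

lemma pot_first_order:
  assumes f: "sq_int f"
  shows "cmod (pot f x - complex_of_real (norm x) * (vpair V f / complex_of_real (8 * pi)))
    \<le> L2norm weight * L2norm f"
proof -
  have "moment (\<lambda>_. norm x * 1) f = complex_of_real (norm x) * vpair V f"
    unfolding moment_cmult vpair_eq_moment ..
  moreover have "\<bar>dist x y - norm x * 1\<bar> \<le> 1 * (1 + norm y) ^ 4" for y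
    using order_trans[OF dist_first_order norm_power_le_weight[of 1 4 y, simplified]] by simp
  ultimately show ?thesis
    using pot_approx[OF f quartic_growth_const, of x "norm x * 1" 1] by simp
qed

lemma pot_second_order:
  assumes f: "sq_int f" "vpair V f = 0" and x: "x \<noteq> 0"
  shows "cmod (pot f x - - moment (\<lambda>y. x \<bullet> y) f / complex_of_real (8 * pi * norm x))
    \<le> L2norm weight * L2norm f / norm x"
proof -
  let ?q = "\<lambda>y. norm x * 1 - (1 / norm x) * (x \<bullet> y)"
  have q: "quartic_growth ?q"
    by (intro quartic_growth_intros)
  have "moment ?q f = - moment (\<lambda>y. x \<bullet> y) f / complex_of_real (norm x)"
    using f by (simp only: moment_diff moment_cmult quartic_growth_intros vpair_eq_moment) simp
  moreover have "\<bar>dist x y - ?q y\<bar> \<le> (1 / norm x) * (1 + norm y) ^ 4" for y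
  proof -
    have "\<bar>dist x y - ?q y\<bar> \<le> (norm y)\<^sup>2 / (2 * norm x)"
      using dist_second_order[OF x, of y] by simp
    also have "\<dots> \<le> (norm y)\<^sup>2 / norm x"
      using x by (intro divide_left_mono) auto
    also have "\<dots> \<le> (1 + norm y) ^ 4 / norm x"
      using norm_power_le_weight[of 2 4 y] by (intro divide_right_mono) auto
    finally show ?thesis
      by simp
  qed
  ultimately show ?thesis
    using pot_approx[OF f(1) q, of x "1 / norm x"] by (simp add: mult.commute)
qed

lemma pot_third_order:
  assumes f: "sq_int f" "vpair V f = 0" "\<And>j. moment1 j f = 0" and x: "x \<noteq> 0"
  shows "cmod (pot f x - (moment_sq f - moment (\<lambda>y. (x \<bullet> y)\<^sup>2) f / complex_of_real ((norm x)\<^sup>2))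
      / complex_of_real (16 * pi * norm x)) \<le> L2norm weight * L2norm f / (norm x)\<^sup>2"
proof -
  let ?q = "\<lambda>y. norm x * 1 - (1 / norm x) * (x \<bullet> y)
    + (1 / (2 * norm x)) * ((norm y)\<^sup>2 - (1 / (norm x)\<^sup>2) * (x \<bullet> y)\<^sup>2)"
  have q: "quartic_growth ?q"
    by (intro quartic_growth_intros)
  have "moment (\<lambda>y. x \<bullet> y) f = 0"
    unfolding moment_inner[OF f(1)] f(3) by simp
  then have "moment ?q f = (moment_sq f - moment (\<lambda>y. (x \<bullet> y)\<^sup>2) f / complex_of_real ((norm x)\<^sup>2))
      / complex_of_real (2 * norm x)"
    using f(1,2)
    by (simp only: moment_add moment_diff moment_cmult quartic_growth_intros vpair_eq_moment) simp
  moreover have "\<bar>dist x y - ?q y\<bar> \<le> (1 / (norm x)\<^sup>2) * (1 + norm y) ^ 4" for y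
  proof -
    have "\<bar>dist x y - ?q y\<bar> \<le> norm y ^ 3 / (2 * (norm x)\<^sup>2)"
      using dist_third_order[OF x, of y] by simp
    also have "\<dots> \<le> norm y ^ 3 / (norm x)\<^sup>2"
      using x by (intro divide_left_mono) auto
    also have "\<dots> \<le> (1 + norm y) ^ 4 / (norm x)\<^sup>2"
      using norm_power_le_weight[of 3 4 y] by (intro divide_right_mono) auto
    finally show ?thesis
      by simp
  qed
  ultimately show ?thesis
    using pot_approx[OF f(1) q, of x "1 / (norm x)\<^sup>2"] by (simp add: mult_ac)
qed

lemma vpair_zero_if_wL2:
  assumes f: "sq_int f" and pot: "wL2 s (\<lambda>x. pot f x + c)" and s: "0 \<le> s" "s < 5 / 2"
  shows "vpair V f = 0"
proof -
  let ?L = "\<lambda>_::real^3. vpair V f / complex_of_real (8 * pi)"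
  have "?L (axis 1 1) = 0"
  proof (rule wL2_leading_coefficient_zero[OF pot s(1), where k = 1])
    fix x :: "real^3" assume x: "1 \<le> norm x"
    have "cmod (pot f x + c - complex_of_real (norm x) * ?L x)
        \<le> cmod (pot f x - complex_of_real (norm x) * ?L x) + cmod c"
      using norm_triangle_ineq[of "pot f x - complex_of_real (norm x) * ?L x" c]
      by (simp add: algebra_simps)
    also have "\<dots> \<le> L2norm weight * L2norm f + cmod c"
      using pot_first_order[OF f, of x] by simp
    finally show "cmod (pot f x + c - complex_of_real (norm x powr 1) * ?L x)
        \<le> (L2norm weight * L2norm f + cmod c) * norm x powr (1 - 1)"
      using x by auto
  qed (use s in \<open>auto simp: axis_eq_0_iff\<close>)
  then show ?thesis
    by simp
qed

lemma moment1_zero_if_wL2: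
  assumes f: "sq_int f" "vpair V f = 0" and pot: "wL2 s (pot f)" and s: "0 \<le> s" "s < 3 / 2"
  shows "moment1 j f = 0"
proof -
  let ?L = "\<lambda>x. - moment (\<lambda>y. x \<bullet> y) f / complex_of_real (8 * pi * norm x)"
  have "?L (axis j 1) = 0"
  proof (rule wL2_leading_coefficient_zero[OF pot s(1), where k = 0])
    show "continuous_on (UNIV - {0}) ?L"
      unfolding moment_inner[OF f(1)] by (auto intro!: continuous_intros)
    show "?L (t *\<^sub>R x) = ?L x" if "0 < t" for t x
      using that by (simp add: moment_cmult)
    show "cmod (pot f x - complex_of_real (norm x powr 0) * ?L x)
        \<le> L2norm weight * L2norm f * norm x powr (0 - 1)" if "1 \<le> norm x" for x
    proof -
      have "x \<noteq> 0"
        using that by auto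
      then show ?thesis
        using pot_second_order[OF f, of x] by (simp add: powr_minus_divide)
    qed
  qed (use s in \<open>auto simp: axis_eq_0_iff\<close>)
  then show ?thesis
    by (simp add: inner_axis')
qed

lemma moment2_zero_if_isotropic:
  assumes f: "sq_int f"
    and isotropic: "\<And>x. moment (\<lambda>y. (x \<bullet> y)\<^sup>2) f = complex_of_real ((norm x)\<^sup>2) * moment_sq f"
  shows "moment2 i j f = 0"
proof -
  have diag: "moment2 i i f = moment_sq f" for i
    using isotropic[of "axis i 1"] by (simp add: inner_axis' power2_eq_square)
  have "moment_sq f = (\<Sum>i\<in>(UNIV::3 set). moment_sq f)"
    using moment_sq_eq[OF f] unfolding diag .
  then have zero: "moment_sq f = 0"
    by simp
  have "moment (\<lambda>y. ((axis i 1 + axis j 1) \<bullet> y)\<^sup>2) f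
      = moment (\<lambda>y. y $ i * y $ i + 2 * (y $ i * y $ j) + y $ j * y $ j) f"
    by (simp add: inner_add_left inner_axis' power2_sum power2_eq_square algebra_simps)
  also have "\<dots> = moment2 i i f + 2 * moment2 i j f + moment2 j j f"
    using f by (simp only: moment_add moment_cmult quartic_growth_intros) simp
  finally show ?thesis
    by (simp add: isotropic diag zero)
qed

lemma moment2_zero_if_wL2:
  assumes f: "sq_int f" "vpair V f = 0" "\<And>j. moment1 j f = 0"
    and pot: "wL2 s (pot f)" and s: "0 \<le> s" "s < 1 / 2"
  shows "moment2 i j f = 0"
proof (rule moment2_zero_if_isotropic[OF f(1)])
  fix x
  let ?L = "\<lambda>x. (moment_sq f - moment (\<lambda>y. (x \<bullet> y)\<^sup>2) f / complex_of_real ((norm x)\<^sup>2))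
    / complex_of_real (16 * pi)"
  have "?L x = 0" if "x \<noteq> 0"
  proof (rule wL2_leading_coefficient_zero[OF pot s(1), where k = "-1"])
    show "continuous_on (UNIV - {0}) ?L"
      unfolding moment_inner_square[OF f(1)] by (auto intro!: continuous_intros)
    show "?L (t *\<^sub>R x) = ?L x" if "0 < t" for t x
      using that by (simp add: power_mult_distrib moment_cmult)
    show "cmod (pot f x - complex_of_real (norm x powr - 1) * ?L x)
        \<le> L2norm weight * L2norm f * norm x powr (- 1 - 1)" if "1 \<le> norm x" for x
    proof -
      have "x \<noteq> 0"
        using that by auto
      moreover from this have "norm x powr (- 1 - 1) = 1 / (norm x)\<^sup>2"
        by (simp add: powr_minus_divide powr_numeral)
      ultimately show ?thesis
        using pot_third_order[OF f, of x] by (simp add: powr_minus_divide mult_ac)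
    qed
    show "x \<noteq> 0"
      by fact
  qed (use s in auto)
  then show "moment (\<lambda>y. (x \<bullet> y)\<^sup>2) f = complex_of_real ((norm x)\<^sup>2) * moment_sq f"
    by (cases "x = 0") (simp_all add: field_simps moment_eq_integral)
qed

lemma wL2_pot_if_decay:
  assumes f: "sq_int f" "vpair V f = 0"
    and far: "\<And>x. 1 \<le> norm x \<Longrightarrow> cmod (pot f x) \<le> L2norm weight * L2norm f / norm x ^ n"
    and s: "0 \<le> s" "3 / 2 - real n < s"
  shows "wL2 s (pot f)"
proof (rule wL2_if_norm_le_powr[OF pot_borel[OF f(1)] _ s])
  fix x
  let ?M = "L2norm weight * L2norm f"
  have "cmod (pot f x) \<le> ?M * (2 ^ n / (1 + norm x) ^ n)"
  proof (cases "1 \<le> norm x")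
    case True
    have "(1 + norm x) ^ n \<le> (2 * norm x) ^ n"
      using True by (intro power_mono) auto
    then have "1 / norm x ^ n \<le> 2 ^ n / (1 + norm x) ^ n"
      using True by (simp add: divide_simps power_mult_distrib)
    then have "?M * (1 / norm x ^ n) \<le> ?M * (2 ^ n / (1 + norm x) ^ n)"
      by (intro mult_left_mono) auto
    then show ?thesis
      using far[OF True] by simp
  next
    case False
    have "cmod (pot f x) \<le> ?M * 1"
      using pot_first_order[OF f(1), of x] f(2) by simp
    also have "\<dots> \<le> ?M * (2 ^ n / (1 + norm x) ^ n)"
      using False power_mono[of "1 + norm x" 2 n] zero_less_power[of "1 + norm x" n]
      by (intro mult_left_mono) (auto simp: le_divide_eq add_pos_nonneg)
    finally show ?thesis .
  qed
  then show "cmod (pot f x) \<le> ?M * 2 ^ n * (1 + norm x) powr (- real n)"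
    by (simp add: powr_minus_divide powr_realpow add_pos_nonneg)
qed

lemma pot_in_Wsp_3_2_iff:
  assumes f: "sq_int f"
  shows "(\<lambda>x. pot f x + c) \<in> Wsp (3/2) \<longleftrightarrow> vpair V f = 0"
proof
  assume "(\<lambda>x. pot f x + c) \<in> Wsp (3/2)"
  then have "wL2 2 (\<lambda>x. pot f x + c)"
    by (simp add: Wsp_def)
  then show "vpair V f = 0"
    by (rule vpair_zero_if_wL2[OF f]) auto
next
  assume "vpair V f = 0"
  then have pot: "cmod (pot f x) \<le> L2norm weight * L2norm f" for x
    using pot_first_order[OF f, of x] by simp
  have bound: "cmod (pot f x + c) \<le> (L2norm weight * L2norm f + cmod c) * (1 + norm x) powr (- 0)"
    for x
    using norm_triangle_ineq[of "pot f x" c] pot[of x]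
      add_pos_nonneg[OF zero_less_one norm_ge_zero[of x]] by simp
  note [measurable] = pot_borel[OF f]
  have "(\<lambda>x. pot f x + c) \<in> borel_measurable borel"
    by measurable
  then have "wL2 s (\<lambda>x. pot f x + c)" if "3 / 2 < s" for s
    by (rule wL2_if_norm_le_powr[OF _ bound]) (use that in auto)
  then show "(\<lambda>x. pot f x + c) \<in> Wsp (3/2)"
    unfolding Wsp_def by blast
qed

lemma pot_in_Wsp_1_2_iff:
  assumes f: "sq_int f"
  shows "pot f \<in> Wsp (1/2) \<longleftrightarrow> vpair V f = 0 \<and> (\<forall>j. moment1 j f = 0)"
proof
  assume "pot f \<in> Wsp (1/2)"
  then have "wL2 1 (pot f)"
    by (simp add: Wsp_def)
  then show "vpair V f = 0 \<and> (\<forall>j. moment1 j f = 0)"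
    using vpair_zero_if_wL2[OF f, of 1 0] moment1_zero_if_wL2[OF f, of 1] by simp
next
  assume moments: "vpair V f = 0 \<and> (\<forall>j. moment1 j f = 0)"
  have "cmod (pot f x) \<le> L2norm weight * L2norm f / norm x ^ 1" if "1 \<le> norm x" for x
  proof -
    have "x \<noteq> 0"
      using that by auto
    then show ?thesis
      using pot_second_order[OF f, of x] moments by (simp add: moment_inner[OF f])
  qed
  then show "pot f \<in> Wsp (1/2)"
    unfolding Wsp_def using moments by (auto intro!: wL2_pot_if_decay[OF f, of 1])
qed

lemma sq_int_pot_iff:
  assumes f: "sq_int f"
  shows "sq_int (pot f) \<longleftrightarrow>
    vpair V f = 0 \<and> (\<forall>j. moment1 j f = 0) \<and> (\<forall>i j. moment2 i j f = 0)"
proof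
  assume "sq_int (pot f)"
  then have "wL2 0 (pot f)"
    unfolding wL2_0_iff .
  then show "vpair V f = 0 \<and> (\<forall>j. moment1 j f = 0) \<and> (\<forall>i j. moment2 i j f = 0)"
    using vpair_zero_if_wL2[OF f, of 0 0] moment1_zero_if_wL2[OF f, of 0]
      moment2_zero_if_wL2[OF f, of 0] by simp
next
  assume moments: "vpair V f = 0 \<and> (\<forall>j. moment1 j f = 0) \<and> (\<forall>i j. moment2 i j f = 0)"
  have "cmod (pot f x) \<le> L2norm weight * L2norm f / norm x ^ 2" if "1 \<le> norm x" for x
  proof -
    have "x \<noteq> 0"
      using that by auto
    then show ?thesis
      using pot_third_order[OF f, of x] moments
      by (simp add: moment_inner_square[OF f] moment_sq_eq[OF f])
  qed
  then show "sq_int (pot f)"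
    unfolding wL2_0_iff[symmetric] using moments by (intro wL2_pot_if_decay[OF f, of 2]) auto
qed

section \<open>Characterisation of the three kernels\<close>

lemma solution_exists_iff:
  assumes f: "sq_int f"
    and X: "aeq_closed X"
  shows "(\<exists>\<phi>. \<phi> \<in> X \<and> dist_H_zero V \<phi> \<and> aeq f (mult U (mult v \<phi>)) \<and> aeq \<phi> (\<lambda>x. pot f x + c))
    \<longleftrightarrow> (\<lambda>x. pot f x + c) \<in> X \<and> aeq (Top V f) (\<lambda>x. c * vc x)"
    (is "(\<exists>\<phi>. ?sol \<phi>) \<longleftrightarrow> ?\<phi>\<^sub>0 \<in> X \<and> ?T")
proof
  assume "\<exists>\<phi>. ?sol \<phi>"
  then obtain \<phi> where \<phi>: "\<phi> \<in> X" "aeq f (mult U (mult v \<phi>))" "aeq \<phi> ?\<phi>\<^sub>0"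
    by blast
  note [measurable] = pot_borel[OF f]
  have "?\<phi>\<^sub>0 \<in> borel_measurable borel"
    by measurable
  moreover have "aeq f (mult U (mult v ?\<phi>\<^sub>0))"
    using \<phi>(2,3) by (blast intro: aeq_trans aeq_mult)
  ultimately show "?\<phi>\<^sub>0 \<in> X \<and> ?T"
    using X \<phi>(1,3) unfolding aeq_U_v_pot_iff aeq_closed_def by blast
next
  assume "?\<phi>\<^sub>0 \<in> X \<and> ?T"
  then show "\<exists>\<phi>. ?sol \<phi>"
    using dist_H_zero_pot[OF f, of c] unfolding aeq_U_v_pot_iff[symmetric] by auto
qed

theorem S1L2_characterisation:
  assumes f: "sq_int f"
  shows "f \<in> S1L2 V \<longleftrightarrow>
    (\<exists>\<phi>. \<phi> \<in> Wsp (3/2) \<and> dist_H_zero V \<phi> \<and> aeq f (mult U (mult v \<phi>))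
      \<and> aeq \<phi> (\<lambda>x. - intop G0k (mult v f) x + vpair V (Top V f) / complex_of_real (L1norm V)))"
  unfolding pot_def[symmetric] solution_exists_iff[OF f aeq_closed_Wsp] pot_in_Wsp_3_2_iff[OF f]
    S1L2_iff
  using f by simp

lemma S2L2_iff_Top:
  assumes f: "sq_int f"
  shows "f \<in> S2L2 V \<longleftrightarrow>
    aeq (Top V f) (\<lambda>_. 0) \<and> vpair V f = 0 \<and> (\<forall>j. moment1 j f = 0)"
proof -
  have "vT f = 0" if "aeq (Top V f) (\<lambda>_. 0)"
    using L2_inner_aeq_right[OF sq_int_vc sq_int_Top[OF f] sq_int_zero that]
    unfolding vpair_eq_L2_inner by simp
  then show ?thesis
    unfolding S2L2_iff S1L2_iff using f by auto
qed

theorem S2L2_characterisation: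
  assumes f: "sq_int f"
  shows "f \<in> S2L2 V \<longleftrightarrow>
    (\<exists>\<phi>. \<phi> \<in> Wsp (1/2) \<and> dist_H_zero V \<phi> \<and> aeq f (mult U (mult v \<phi>))
      \<and> aeq \<phi> (\<lambda>x. - intop G0k (mult v f) x))"
  using solution_exists_iff[OF f aeq_closed_Wsp, of "1/2" 0]
  by (simp add: S2L2_iff_Top[OF f] pot_in_Wsp_1_2_iff[OF f] conj_ac flip: pot_def)

theorem S3L2_characterisation:
  assumes f: "sq_int f"
  shows "f \<in> S3L2 V \<longleftrightarrow>
    (\<exists>\<phi>. sq_int \<phi> \<and> dist_H_zero V \<phi> \<and> aeq f (mult U (mult v \<phi>))
      \<and> aeq \<phi> (\<lambda>x. - intop G0k (mult v f) x))"
  using solution_exists_iff[OF f aeq_closed_sq_int, of 0]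
  by (simp add: S3L2_iff S2L2_iff_Top[OF f] sq_int_pot_iff[OF f] conj_ac flip: pot_def)

end

theorem theorem5p2:
  fixes V :: "real^3 \<Rightarrow> real" and \<beta> :: real
  assumes "V \<in> borel_measurable lborel"
    and "\<exists>C. \<forall>x. \<bar>V x\<bar> \<le> C * (1 + norm x) powr (- \<beta>)"
    and "L1norm V \<noteq> 0"
  shows "(\<beta> > 11 \<longrightarrow> (\<forall>f. sq_int f \<and> \<not> aeq f (\<lambda>_. 0) \<longrightarrow>
            (f \<in> S1L2 V \<longleftrightarrow>
              (\<exists>\<phi>. \<phi> \<in> Wsp (3/2) \<and> dist_H_zero V \<phi>
                  \<and> aeq f (mult (sgnU V) (mult (vfun V) \<phi>))
                  \<and> aeq \<phi> (\<lambda>x. - intop G0k (mult (vfun V) f) x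
                                 + vpair V (Top V f) / complex_of_real (L1norm V))))))
       \<and> (\<beta> > 19 \<longrightarrow> (\<forall>f. sq_int f \<and> \<not> aeq f (\<lambda>_. 0) \<longrightarrow>
            (f \<in> S2L2 V \<longleftrightarrow>
              (\<exists>\<phi>. \<phi> \<in> Wsp (1/2) \<and> dist_H_zero V \<phi>
                  \<and> aeq f (mult (sgnU V) (mult (vfun V) \<phi>))
                  \<and> aeq \<phi> (\<lambda>x. - intop G0k (mult (vfun V) f) x)))))
       \<and> (\<beta> > 23 \<longrightarrow> (\<forall>f. sq_int f \<and> \<not> aeq f (\<lambda>_. 0) \<longrightarrow>
            (f \<in> S3L2 V \<longleftrightarrow>
              (\<exists>\<phi>. sq_int \<phi> \<and> dist_H_zero V \<phi>
                  \<and> aeq f (mult (sgnU V) (mult (vfun V) \<phi>))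
                  \<and> aeq \<phi> (\<lambda>x. - intop G0k (mult (vfun V) f) x)))))"
proof -
  have decaying: "decaying_potential V \<beta>" if "\<beta> > 11"
    using assms that by unfold_locales
  show ?thesis
    using decaying_potential.S1L2_characterisation[OF decaying]
      decaying_potential.S2L2_characterisation[OF decaying]
      decaying_potential.S3L2_characterisation[OF decaying] by auto
qed

end
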